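(* (1) For every CSC-model $\mathcal C$ there are CSC-model morphisms $F:\mathcal C\to SL(\mathcal C)$ and $G:SL(\mathcal C)\to\mathcal C$ with natural isomorphisms $F\circ G\cong\mathrm{Id}$ and $\mathrm{Id}\cong G\circ F$. (2) For every CSC-theory $\mathbb T$ there are CSC-translations $V:\mathbb T\to LS(\mathbb T)$ and $W:LS(\mathbb T)\to\mathbb T$ with invertible CSC-translation transformations $V\circ W\cong\mathrm{Id}$ and $\mathrm{Id}\cong W\circ V$.
   Context: CSC (Central Submonad Calculus): types $A,B::=G\mid 1\mid A\to B\mid A\times B\mid\mathcal SA\mid\mathcal TA$; terms $x\mid *\mid\lambda x^A.M\mid MN\mid\langle M,N\rangle\mid\pi_iM\mid\mathtt{ret}_{\mathcal X}M\mid\iota M\mid\mathtt{do}_{\mathcal X}x\leftarrow M;N$ ($\mathcal X\in\{\mathcal S,\mathcal T\}$), usual simply-typed rules plus $\mathtt{ret}_{\mathcal X}:A\Rightarrow\mathcal XA$, $\iota:\mathcal SA\Rightarrow\mathcal TA$, and $\Gamma\vdash M:\mathcal XA$, $\Gamma,x:A\vdash N:\mathcal XB$ give $\Gamma\vdash\mathtt{do}_{\mathcal X}x\leftarrow M;N:\mathcal XB$. Judgements: $\vdash A:\mathtt{type}$, $\vdash A=B:\mathtt{type}$, $\Gamma\vdash M:A$, $\Gamma\vdash M=N:A$; type equality is a congruent equivalence relation respected by typing; term equality is a congruent equivalence relation closed under substitution and weakening containing $\beta\eta$ for $1,\times,\to$, the monad laws for each $\mathcal X$ (unit laws, associativity of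 $\mathtt{do}$), centrality $\mathtt{do}_{\mathcal T}x\leftarrow\iota M;\mathtt{do}_{\mathcal T}y\leftarrow N;P=\mathtt{do}_{\mathcal T}y\leftarrow N;\mathtt{do}_{\mathcal T}x\leftarrow\iota M;P$ ($M:\mathcal SA$, $N:\mathcal TB$), $\iota M=\iota N\iff M=N$, $\mathtt{do}_{\mathcal T}x\leftarrow\iota M;\iota N=\iota(\mathtt{do}_{\mathcal S}x\leftarrow M;N)$, $\iota(\mathtt{ret}_{\mathcal S}M)=\mathtt{ret}_{\mathcal T}M$. A CSC-theory extends CSC with ground types, constants (well-formed in every context) and equality axioms. A CSC-translation $V:\mathbb T\to\mathbb T'$ maps types to types and terms to terms, preserves derivability of all four judgement forms, and commutes with all type and term formers ($V(1)=1$, $V(\mathcal XA)=\mathcal XV(A)$, $V(A\to B)=V(A)\to V(B)$, $V(A\times B)=V(A)\times V(B)$, $V( * )=*$, $V(\lambda x^A.M)=\lambda x.V(M)$, $V(MN)=V(M)V(N)$, $V(\langle M,N\rangle)=\langle V(M),V(N)\rangle$, $V(\pi_iM)=\pi_iV(M)$, $V(\iota M)=\iota V(M)$, $V(\mathtt{ret}_{\mathcal X}M)=\mathtt{ret}_{\mathcal X}V(M)$, $V(\mathtt{do}_{\mathcal X}x\leftarrow M;N)=\mathtt{do}_{\mathcal X}x\leftarrow V(M);V(N)$). A CSC-translation transformation $\alpha:V\Rightarrow V'$ is a family of judgements $x:V(A)\vdash\alpha_A:V'(A)$ such that for every derivable $x:A\vdash f:B$, $x:V(A)\vdash\alpha_B[V(f)/x]=V'(f)[\alpha_A/x]:V'(B)$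 is derivable; these form a 2-category (composition by substitution). A CSC-model $(\mathcal C,\mathcal T,\mathcal S,\iota)$ is a cartesian closed category with a strong monad $\mathcal T$ and a central submonad $\iota:\mathcal S\Rightarrow\mathcal T$ (monic morphism of strong monads with each $(\mathcal SX,\iota_X)$ a central cone: $\mu\circ\mathcal T\tau'\circ\tau\circ(\iota_X\times\mathrm{id})=\mu\circ\mathcal T\tau\circ\tau'\circ(\iota_X\times\mathrm{id})$ on $\mathcal SX\times\mathcal TY$ for all $Y$, $\tau'$ the right strength). A CSC-model morphism $(\mathcal C,\mathcal T,\mathcal S,\iota)\to(\mathcal D,\mathcal M,\mathcal S',\iota')$ is a strict cartesian closed functor $F$ with $F(\mathcal TX)=\mathcal M(FX)$, $F(\mathcal SX)=\mathcal S'(FX)$, $F\iota_X=\iota'_{FX}$, $F\eta_X=\eta_{FX}$, $F\mu_X=\mu_{FX}$, $F\tau_{X,Y}=\tau_{FX,FY}$. $S(\mathbb T)$ is the syntactic CSC-model: types modulo type equality, morphisms judgements $x:A\vdash f:B$ modulo provable equality, composition by substitution, with $\mathcal X[A]=[\mathcal XA]$, $\eta^{\mathcal X}=[x\vdash\mathtt{ret}_{\mathcal X}x]$, $\mu^{\mathcal X}=[x\vdash\mathtt{do}_{\mathcal X}y\leftarrow x;y]$, $\tau^{\mathcal X}=[x\vdash\mathtt{do}_{\mathcal X}y\leftarrow\pi_2x;\mathtt{ret}_{\mathcal X}\langle\pi_1x,y\rangle]$, $\iota=[x\vdash\iota x]$. $L(\mathcal C)$ is the internal language of a CSC-model $\mathcal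 C$: ground types $A^*$ for objects $A$ with $[\![A^*]\!]=A$ (extended compositionally: $\to$ exponential, $\times$ product, $\mathcal X$ the monads), constants $c_f:A^*\to B^*$ for morphisms $f:A\to B$ interpreted as the curried $f$, type equality axioms $A=B$ whenever $[\![A]\!]=[\![B]\!]$, term equality axioms $M=N$ whenever their interpretations (standard, with $\mathtt{ret}\mapsto\eta\circ-$, $\iota\mapsto\iota\circ-$, $\mathtt{do}_{\mathcal X}x\leftarrow M;N\mapsto\mu^{\mathcal X}\circ\mathcal X[\![N]\!]\circ\tau^{\mathcal X}\circ\langle\mathrm{id},[\![M]\!]\rangle$) coincide.
   Formalization: Besides λ, the terms MN, π_iM, ιM and do_X x←M;N also carry the types of their premises; with the unannotated terms of the text the interpretation defining L(C) is ambiguous when type formers are not injective, and (1) fails, e.g. for a skeleton of finite sets. *)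

theory Defs
  imports Main
begin

section \<open>Types and terms of the central submonad calculus\<close>

datatype mname = SMon | TMon

datatype 'g ty =
    Ground 'g
  | TOne
  | TFun "'g ty" "'g ty"
  | TProd "'g ty" "'g ty"
  | TM mname "'g ty"

text \<open>
  Terms are de Bruijn terms (index \<open>0\<close> is the innermost variable): \<open>Lam\<close> binds one variable
  in its term argument, and \<open>Do X A B M N\<close>, which is \<open>do\<^sub>X x \<leftarrow> M; N\<close>
  with \<open>x : A\<close> and \<open>N : X B\<close>, binds one variable in \<open>N\<close>.

  Like the abstraction, the elimination forms and \<open>Iota\<close> carry the types of their premises,
  which the conclusion does not determine: \<open>App A B M N\<close> is \<open>M N\<close> for \<open>M : A \<rightarrow> B\<close>;
  \<open>Pi1 A B M\<close> and \<open>Pi2 A B M\<close> are the projections of \<open>M : A \<times> B\<close>; \<open>Iota A M\<close> is \<open>\<iota> M\<close> for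
  \<open>M : S A\<close>. This matters because a theory may equate, say, \<open>A \<times> B\<close> and \<open>A' \<times> B'\<close> without equating
  the components, and the internal language of a model does so whenever the two objects
  coincide. Without annotations a term would then have several interpretations and be identified
  with all of them: in a skeleton of finite sets, \<open>2 \<times> (2 \<times> 3)\<close> and \<open>3 \<times> (2 \<times> 2)\<close> are the same
  object, the closed terms \<open>\<langle>0,\<langle>0,2\<rangle>\<rangle>\<close> and \<open>\<langle>0,\<langle>1,0\<rangle>\<rangle>\<close> name the same element of it, and applying
  the unannotated \<open>\<pi>\<^sub>1 (\<pi>\<^sub>2 _)\<close> to both would give \<open>0 = 1 : 2\<close>.
\<close>

datatype ('g, 'c) tm =
    Var nat
  | Const 'c
  | Star
  | Lam "'g ty" "('g, 'c) tm"
  | App "'g ty" "'g ty" "('g, 'c) tm" "('g, 'c) tm"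
  | Pr "('g, 'c) tm" "('g, 'c) tm"
  | Pi1 "'g ty" "'g ty" "('g, 'c) tm"
  | Pi2 "'g ty" "'g ty" "('g, 'c) tm"
  | Ret mname "('g, 'c) tm"
  | Iota "'g ty" "('g, 'c) tm"
  | Do mname "'g ty" "'g ty" "('g, 'c) tm" "('g, 'c) tm"

definition up_ren :: "(nat \<Rightarrow> nat) \<Rightarrow> nat \<Rightarrow> nat" where
  "up_ren r i = (case i of 0 \<Rightarrow> 0 | Suc j \<Rightarrow> Suc (r j))"

primrec rename :: "(nat \<Rightarrow> nat) \<Rightarrow> ('g, 'c) tm \<Rightarrow> ('g, 'c) tm" where
  "rename r (Var i) = Var (r i)"
| "rename r (Const c) = Const c"
| "rename r Star = Star"
| "rename r (Lam A M) = Lam A (rename (up_ren r) M)"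
| "rename r (App A B M N) = App A B (rename r M) (rename r N)"
| "rename r (Pr M N) = Pr (rename r M) (rename r N)"
| "rename r (Pi1 A B M) = Pi1 A B (rename r M)"
| "rename r (Pi2 A B M) = Pi2 A B (rename r M)"
| "rename r (Ret X M) = Ret X (rename r M)"
| "rename r (Iota A M) = Iota A (rename r M)"
| "rename r (Do X A B M N) = Do X A B (rename r M) (rename (up_ren r) N)"

abbreviation shift :: "('g, 'c) tm \<Rightarrow> ('g, 'c) tm" where
  "shift \<equiv> rename Suc"

definition swap_ren :: "nat \<Rightarrow> nat" where
  "swap_ren i = (if i = 0 then 1 else if i = 1 then 0 else i)"

definition up_sub :: "(nat \<Rightarrow> ('g, 'c) tm) \<Rightarrow> nat \<Rightarrow> ('g, 'c) tm" where
  "up_sub \<sigma> i = (case i of 0 \<Rightarrow> Var 0 | Suc j \<Rightarrow> shift (\<sigma> j))"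

primrec subst :: "(nat \<Rightarrow> ('g, 'c) tm) \<Rightarrow> ('g, 'c) tm \<Rightarrow> ('g, 'c) tm" where
  "subst \<sigma> (Var i) = \<sigma> i"
| "subst \<sigma> (Const c) = Const c"
| "subst \<sigma> Star = Star"
| "subst \<sigma> (Lam A M) = Lam A (subst (up_sub \<sigma>) M)"
| "subst \<sigma> (App A B M N) = App A B (subst \<sigma> M) (subst \<sigma> N)"
| "subst \<sigma> (Pr M N) = Pr (subst \<sigma> M) (subst \<sigma> N)"
| "subst \<sigma> (Pi1 A B M) = Pi1 A B (subst \<sigma> M)"
| "subst \<sigma> (Pi2 A B M) = Pi2 A B (subst \<sigma> M)"
| "subst \<sigma> (Ret X M) = Ret X (subst \<sigma> M)"
| "subst \<sigma> (Iota A M) = Iota A (subst \<sigma> M)"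
| "subst \<sigma> (Do X A B M N) = Do X A B (subst \<sigma> M) (subst (up_sub \<sigma>) N)"

text \<open>
  \<open>inst M N\<close> substitutes \<open>M\<close> for variable \<open>0\<close> in \<open>N\<close>. For \<open>N\<close> in a one-variable context this is
  the composite \<open>N[M/x]\<close>, whatever the context of \<open>M\<close>.
\<close>

definition inst :: "('g, 'c) tm \<Rightarrow> ('g, 'c) tm \<Rightarrow> ('g, 'c) tm" where
  "inst M N = subst (\<lambda>i. case i of 0 \<Rightarrow> M | Suc j \<Rightarrow> Var j) N"


section \<open>Theories and derivability\<close>

record ('g, 'c) csc_sig =
  grounds :: "'g set"
  consts_of :: "'c set"
  const_ty :: "'c \<Rightarrow> 'g ty"
  ty_axioms :: "('g ty \<times> 'g ty) set"

text \<open>An element \<open>(\<Gamma>, M, N, A)\<close> of \<open>tm_axioms\<close> is the axiom \<open>\<Gamma> \<turnstile> M = N : A\<close>.\<close>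

record ('g, 'c) csc_thy = "('g, 'c) csc_sig" +
  tm_axioms :: "('g ty list \<times> ('g, 'c) tm \<times> ('g, 'c) tm \<times> 'g ty) set"

inductive wf_ty :: "('g, 'c, 'x) csc_sig_scheme \<Rightarrow> 'g ty \<Rightarrow> bool" for T where
  wf_Ground: "g \<in> grounds T \<Longrightarrow> wf_ty T (Ground g)"
| wf_One: "wf_ty T TOne"
| wf_Fun: "wf_ty T A \<Longrightarrow> wf_ty T B \<Longrightarrow> wf_ty T (TFun A B)"
| wf_Prod: "wf_ty T A \<Longrightarrow> wf_ty T B \<Longrightarrow> wf_ty T (TProd A B)"
| wf_M: "wf_ty T A \<Longrightarrow> wf_ty T (TM X A)"

definition wf_ctx :: "('g, 'c, 'x) csc_sig_scheme \<Rightarrow> 'g ty list \<Rightarrow> bool" where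
  "wf_ctx T \<Gamma> \<longleftrightarrow> (\<forall>A \<in> set \<Gamma>. wf_ty T A)"

inductive ty_eq :: "('g, 'c, 'x) csc_sig_scheme \<Rightarrow> 'g ty \<Rightarrow> 'g ty \<Rightarrow> bool" for T where
  teq_ax: "(A, B) \<in> ty_axioms T \<Longrightarrow> ty_eq T A B"
| teq_refl: "wf_ty T A \<Longrightarrow> ty_eq T A A"
| teq_sym: "ty_eq T A B \<Longrightarrow> ty_eq T B A"
| teq_trans: "ty_eq T A B \<Longrightarrow> ty_eq T B C \<Longrightarrow> ty_eq T A C"
| teq_Fun: "ty_eq T A A' \<Longrightarrow> ty_eq T B B' \<Longrightarrow> ty_eq T (TFun A B) (TFun A' B')"
| teq_Prod: "ty_eq T A A' \<Longrightarrow> ty_eq T B B' \<Longrightarrow> ty_eq T (TProd A B) (TProd A' B')"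
| teq_M: "ty_eq T A A' \<Longrightarrow> ty_eq T (TM X A) (TM X A')"

inductive typing :: "('g, 'c, 'x) csc_sig_scheme \<Rightarrow> 'g ty list \<Rightarrow> ('g, 'c) tm \<Rightarrow> 'g ty \<Rightarrow> bool"
  for T where
  ty_Var: "wf_ctx T \<Gamma> \<Longrightarrow> i < length \<Gamma> \<Longrightarrow> typing T \<Gamma> (Var i) (\<Gamma> ! i)"
| ty_Const: "wf_ctx T \<Gamma> \<Longrightarrow> c \<in> consts_of T \<Longrightarrow> typing T \<Gamma> (Const c) (const_ty T c)"
| ty_Star: "wf_ctx T \<Gamma> \<Longrightarrow> typing T \<Gamma> Star TOne"
| ty_Lam: "typing T (A # \<Gamma>) M B \<Longrightarrow> typing T \<Gamma> (Lam A M) (TFun A B)"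
| ty_App: "typing T \<Gamma> M (TFun A B) \<Longrightarrow> typing T \<Gamma> N A \<Longrightarrow> typing T \<Gamma> (App A B M N) B"
| ty_Pr: "typing T \<Gamma> M A \<Longrightarrow> typing T \<Gamma> N B \<Longrightarrow> typing T \<Gamma> (Pr M N) (TProd A B)"
| ty_Pi1: "typing T \<Gamma> M (TProd A B) \<Longrightarrow> typing T \<Gamma> (Pi1 A B M) A"
| ty_Pi2: "typing T \<Gamma> M (TProd A B) \<Longrightarrow> typing T \<Gamma> (Pi2 A B M) B"
| ty_Ret: "typing T \<Gamma> M A \<Longrightarrow> typing T \<Gamma> (Ret X M) (TM X A)"
| ty_Iota: "typing T \<Gamma> M (TM SMon A) \<Longrightarrow> typing T \<Gamma> (Iota A M) (TM TMon A)"
| ty_Do: "typing T \<Gamma> M (TM X A) \<Longrightarrow> typing T (A # \<Gamma>) N (TM X B) \<Longrightarrow>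
    typing T \<Gamma> (Do X A B M N) (TM X B)"
| ty_conv: "typing T \<Gamma> M A \<Longrightarrow> ty_eq T A B \<Longrightarrow> typing T \<Gamma> M B"

text \<open>
  Rule \<open>eq_subst\<close> is closure under simultaneous substitution; with variables for \<open>\<sigma>\<close> and \<open>\<tau>\<close>
  it is weakening. In \<open>eq_centrality\<close> the term \<open>P\<close> lives in \<open>\<Gamma>, x : A, y : B\<close>, and the renaming
  on the right moves it to \<open>\<Gamma>, y : B, x : A\<close>.
\<close>

inductive tm_eq ::
  "('g, 'c) csc_thy \<Rightarrow> 'g ty list \<Rightarrow> ('g, 'c) tm \<Rightarrow> ('g, 'c) tm \<Rightarrow> 'g ty \<Rightarrow> bool"
  for T where
  eq_ax: "(\<Gamma>, M, N, A) \<in> tm_axioms T \<Longrightarrow> tm_eq T \<Gamma> M N A"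
| eq_refl: "typing T \<Gamma> M A \<Longrightarrow> tm_eq T \<Gamma> M M A"
| eq_sym: "tm_eq T \<Gamma> M N A \<Longrightarrow> tm_eq T \<Gamma> N M A"
| eq_trans: "tm_eq T \<Gamma> M N A \<Longrightarrow> tm_eq T \<Gamma> N P A \<Longrightarrow> tm_eq T \<Gamma> M P A"
| eq_conv: "tm_eq T \<Gamma> M N A \<Longrightarrow> ty_eq T A B \<Longrightarrow> tm_eq T \<Gamma> M N B"
| eq_subst: "tm_eq T \<Gamma> M N A \<Longrightarrow> wf_ctx T \<Delta> \<Longrightarrow>
    (\<forall>i < length \<Gamma>. tm_eq T \<Delta> (\<sigma> i) (\<tau> i) (\<Gamma> ! i)) \<Longrightarrow>
    tm_eq T \<Delta> (subst \<sigma> M) (subst \<tau> N) A"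
| eq_Lam: "ty_eq T A A' \<Longrightarrow> tm_eq T (A # \<Gamma>) M M' B \<Longrightarrow>
    tm_eq T \<Gamma> (Lam A M) (Lam A' M') (TFun A B)"
| eq_App: "ty_eq T A A' \<Longrightarrow> ty_eq T B B' \<Longrightarrow>
    tm_eq T \<Gamma> M M' (TFun A B) \<Longrightarrow> tm_eq T \<Gamma> N N' A \<Longrightarrow>
    tm_eq T \<Gamma> (App A B M N) (App A' B' M' N') B"
| eq_Pr: "tm_eq T \<Gamma> M M' A \<Longrightarrow> tm_eq T \<Gamma> N N' B \<Longrightarrow>
    tm_eq T \<Gamma> (Pr M N) (Pr M' N') (TProd A B)"
| eq_Pi1: "ty_eq T A A' \<Longrightarrow> ty_eq T B B' \<Longrightarrow> tm_eq T \<Gamma> M M' (TProd A B) \<Longrightarrow>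
    tm_eq T \<Gamma> (Pi1 A B M) (Pi1 A' B' M') A"
| eq_Pi2: "ty_eq T A A' \<Longrightarrow> ty_eq T B B' \<Longrightarrow> tm_eq T \<Gamma> M M' (TProd A B) \<Longrightarrow>
    tm_eq T \<Gamma> (Pi2 A B M) (Pi2 A' B' M') B"
| eq_Ret: "tm_eq T \<Gamma> M M' A \<Longrightarrow> tm_eq T \<Gamma> (Ret X M) (Ret X M') (TM X A)"
| eq_Iota: "ty_eq T A A' \<Longrightarrow> tm_eq T \<Gamma> M M' (TM SMon A) \<Longrightarrow>
    tm_eq T \<Gamma> (Iota A M) (Iota A' M') (TM TMon A)"
| eq_Do: "ty_eq T A A' \<Longrightarrow> ty_eq T B B' \<Longrightarrow>
    tm_eq T \<Gamma> M M' (TM X A) \<Longrightarrow> tm_eq T (A # \<Gamma>) N N' (TM X B) \<Longrightarrow>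
    tm_eq T \<Gamma> (Do X A B M N) (Do X A' B' M' N') (TM X B)"
| eq_One_eta: "typing T \<Gamma> M TOne \<Longrightarrow> tm_eq T \<Gamma> M Star TOne"
| eq_Pi1_beta: "typing T \<Gamma> M A \<Longrightarrow> typing T \<Gamma> N B \<Longrightarrow> tm_eq T \<Gamma> (Pi1 A B (Pr M N)) M A"
| eq_Pi2_beta: "typing T \<Gamma> M A \<Longrightarrow> typing T \<Gamma> N B \<Longrightarrow> tm_eq T \<Gamma> (Pi2 A B (Pr M N)) N B"
| eq_Prod_eta: "typing T \<Gamma> M (TProd A B) \<Longrightarrow>
    tm_eq T \<Gamma> (Pr (Pi1 A B M) (Pi2 A B M)) M (TProd A B)"
| eq_Fun_beta: "typing T (A # \<Gamma>) M B \<Longrightarrow> typing T \<Gamma> N A \<Longrightarrow>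
    tm_eq T \<Gamma> (App A B (Lam A M) N) (inst N M) B"
| eq_Fun_eta: "typing T \<Gamma> M (TFun A B) \<Longrightarrow>
    tm_eq T \<Gamma> (Lam A (App A B (shift M) (Var 0))) M (TFun A B)"
| eq_Do_left_unit: "typing T \<Gamma> M A \<Longrightarrow> typing T (A # \<Gamma>) N (TM X B) \<Longrightarrow>
    tm_eq T \<Gamma> (Do X A B (Ret X M) N) (inst M N) (TM X B)"
| eq_Do_right_unit: "typing T \<Gamma> M (TM X A) \<Longrightarrow>
    tm_eq T \<Gamma> (Do X A A M (Ret X (Var 0))) M (TM X A)"
| eq_Do_assoc: "typing T \<Gamma> M (TM X A) \<Longrightarrow> typing T (A # \<Gamma>) N (TM X B) \<Longrightarrow>
    typing T (B # \<Gamma>) P (TM X C) \<Longrightarrow>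
    tm_eq T \<Gamma> (Do X B C (Do X A B M N) P)
      (Do X A C M (Do X B C N (rename (up_ren Suc) P))) (TM X C)"
| eq_centrality: "typing T \<Gamma> M (TM SMon A) \<Longrightarrow> typing T \<Gamma> N (TM TMon B) \<Longrightarrow>
    typing T (B # A # \<Gamma>) P (TM TMon C) \<Longrightarrow>
    tm_eq T \<Gamma> (Do TMon A C (Iota A M) (Do TMon B C (shift N) P))
      (Do TMon B C N (Do TMon A C (shift (Iota A M)) (rename swap_ren P))) (TM TMon C)"
| eq_Iota_inj: "tm_eq T \<Gamma> (Iota A M) (Iota A N) (TM TMon A) \<Longrightarrow>
    typing T \<Gamma> M (TM SMon A) \<Longrightarrow> typing T \<Gamma> N (TM SMon A) \<Longrightarrow>
    tm_eq T \<Gamma> M N (TM SMon A)"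
| eq_Iota_Do: "typing T \<Gamma> M (TM SMon A) \<Longrightarrow> typing T (A # \<Gamma>) N (TM SMon B) \<Longrightarrow>
    tm_eq T \<Gamma> (Do TMon A B (Iota A M) (Iota B N)) (Iota B (Do SMon A B M N)) (TM TMon B)"
| eq_Iota_Ret: "typing T \<Gamma> M A \<Longrightarrow>
    tm_eq T \<Gamma> (Iota A (Ret SMon M)) (Ret TMon M) (TM TMon A)"

definition csc_theory :: "('g, 'c) csc_thy \<Rightarrow> bool" where
  "csc_theory T \<longleftrightarrow>
     (\<forall>c \<in> consts_of T. wf_ty T (const_ty T c)) \<and>
     (\<forall>(A, B) \<in> ty_axioms T. wf_ty T A \<and> wf_ty T B) \<and>
     (\<forall>(\<Gamma>, M, N, A) \<in> tm_axioms T. typing T \<Gamma> M A \<and> typing T \<Gamma> N A)"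


section \<open>Translations and their transformations\<close>

record ('g, 'c, 'h, 'd) trans =
  trTy :: "'g ty \<Rightarrow> 'h ty"
  trTm :: "('g, 'c) tm \<Rightarrow> ('h, 'd) tm"

locale csc_translation =
  fixes T :: "('g, 'c) csc_thy" and T' :: "('h, 'd) csc_thy" and V :: "('g, 'c, 'h, 'd) trans"
  assumes source: "csc_theory T"
    and target: "csc_theory T'"
    and pres_wf_ty: "wf_ty T A \<Longrightarrow> wf_ty T' (trTy V A)"
    and pres_ty_eq: "ty_eq T A B \<Longrightarrow> ty_eq T' (trTy V A) (trTy V B)"
    and pres_typing: "typing T \<Gamma> M A \<Longrightarrow> typing T' (map (trTy V) \<Gamma>) (trTm V M) (trTy V A)"
    and pres_tm_eq: "tm_eq T \<Gamma> M N A \<Longrightarrow>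
      tm_eq T' (map (trTy V) \<Gamma>) (trTm V M) (trTm V N) (trTy V A)"
    and tr_One: "trTy V TOne = TOne"
    and tr_Fun: "trTy V (TFun A B) = TFun (trTy V A) (trTy V B)"
    and tr_Prod: "trTy V (TProd A B) = TProd (trTy V A) (trTy V B)"
    and tr_M: "trTy V (TM X A) = TM X (trTy V A)"
    and tr_Var: "trTm V (Var i) = Var i"
    and tr_Star: "trTm V Star = Star"
    and tr_Lam: "trTm V (Lam A M) = Lam (trTy V A) (trTm V M)"
    and tr_App: "trTm V (App A B M N) = App (trTy V A) (trTy V B) (trTm V M) (trTm V N)"
    and tr_Pr: "trTm V (Pr M N) = Pr (trTm V M) (trTm V N)"
    and tr_Pi1: "trTm V (Pi1 A B M) = Pi1 (trTy V A) (trTy V B) (trTm V M)"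
    and tr_Pi2: "trTm V (Pi2 A B M) = Pi2 (trTy V A) (trTy V B) (trTm V M)"
    and tr_Ret: "trTm V (Ret X M) = Ret X (trTm V M)"
    and tr_Iota: "trTm V (Iota A M) = Iota (trTy V A) (trTm V M)"
    and tr_Do: "trTm V (Do X A B M N) = Do X (trTy V A) (trTy V B) (trTm V M) (trTm V N)"

definition tr_id :: "('g, 'c, 'g, 'c) trans" where
  "tr_id = \<lparr>trTy = (\<lambda>A. A), trTm = (\<lambda>M. M)\<rparr>"

definition tr_comp ::
  "('h, 'd, 'k, 'e) trans \<Rightarrow> ('g, 'c, 'h, 'd) trans \<Rightarrow> ('g, 'c, 'k, 'e) trans" where
  "tr_comp W V = \<lparr>trTy = trTy W \<circ> trTy V, trTm = trTm W \<circ> trTm V\<rparr>"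

definition csc_transformation ::
  "('g, 'c) csc_thy \<Rightarrow> ('h, 'd) csc_thy \<Rightarrow> ('g, 'c, 'h, 'd) trans \<Rightarrow> ('g, 'c, 'h, 'd) trans \<Rightarrow>
   ('g ty \<Rightarrow> ('h, 'd) tm) \<Rightarrow> bool" where
  "csc_transformation T T' V V' \<alpha> \<longleftrightarrow>
     csc_translation T T' V \<and> csc_translation T T' V' \<and>
     (\<forall>A. wf_ty T A \<longrightarrow> typing T' [trTy V A] (\<alpha> A) (trTy V' A)) \<and>
     (\<forall>A B f. typing T [A] f B \<longrightarrow>
        tm_eq T' [trTy V A] (inst (trTm V f) (\<alpha> B)) (inst (\<alpha> A) (trTm V' f)) (trTy V' B))"

text \<open>
  Two transformations are the same 2-cell if their components are provably equal; identities
  consist of variables and vertical composition is substitution.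
\<close>

definition transf_eq ::
  "('g, 'c) csc_thy \<Rightarrow> ('h, 'd) csc_thy \<Rightarrow> ('g, 'c, 'h, 'd) trans \<Rightarrow> ('g, 'c, 'h, 'd) trans \<Rightarrow>
   ('g ty \<Rightarrow> ('h, 'd) tm) \<Rightarrow> ('g ty \<Rightarrow> ('h, 'd) tm) \<Rightarrow> bool" where
  "transf_eq T T' V V' \<alpha> \<beta> \<longleftrightarrow>
     (\<forall>A. wf_ty T A \<longrightarrow> tm_eq T' [trTy V A] (\<alpha> A) (\<beta> A) (trTy V' A))"

definition transf_id :: "'g ty \<Rightarrow> ('h, 'd) tm" where
  "transf_id A = Var 0"

definition transf_comp ::
  "('g ty \<Rightarrow> ('h, 'd) tm) \<Rightarrow> ('g ty \<Rightarrow> ('h, 'd) tm) \<Rightarrow> 'g ty \<Rightarrow> ('h, 'd) tm" where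
  "transf_comp \<beta> \<alpha> A = inst (\<alpha> A) (\<beta> A)"

definition invertible_transformation ::
  "('g, 'c) csc_thy \<Rightarrow> ('h, 'd) csc_thy \<Rightarrow> ('g, 'c, 'h, 'd) trans \<Rightarrow> ('g, 'c, 'h, 'd) trans \<Rightarrow>
   ('g ty \<Rightarrow> ('h, 'd) tm) \<Rightarrow> bool" where
  "invertible_transformation T T' V V' \<alpha> \<longleftrightarrow>
     csc_transformation T T' V V' \<alpha> \<and>
     (\<exists>\<beta>. csc_transformation T T' V' V \<beta> \<and>
          transf_eq T T' V V (transf_comp \<beta> \<alpha>) transf_id \<and>
          transf_eq T T' V' V' (transf_comp \<alpha> \<beta>) transf_id)"


section \<open>Categories and functors\<close>

record ('o, 'm) cat =
  Obj :: "'o set"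
  Arr :: "'m set"
  Dom :: "'m \<Rightarrow> 'o"
  Cod :: "'m \<Rightarrow> 'o"
  Ident :: "'o \<Rightarrow> 'm"
  Comp :: "'m \<Rightarrow> 'm \<Rightarrow> 'm"  (infixr "\<cdot>\<index>" 75)

definition hom :: "('o, 'm, 'x) cat_scheme \<Rightarrow> 'o \<Rightarrow> 'o \<Rightarrow> 'm set" where
  "hom C A B = {f \<in> Arr C. Dom C f = A \<and> Cod C f = B}"

locale category =
  fixes C :: "('o, 'm, 'x) cat_scheme" (structure)
  assumes Dom_in_Obj: "f \<in> Arr C \<Longrightarrow> Dom C f \<in> Obj C"
    and Cod_in_Obj: "f \<in> Arr C \<Longrightarrow> Cod C f \<in> Obj C"
    and Ident_in_hom: "A \<in> Obj C \<Longrightarrow> Ident C A \<in> hom C A A"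
    and Comp_in_hom: "f \<in> hom C A B \<Longrightarrow> g \<in> hom C B D \<Longrightarrow> g \<cdot> f \<in> hom C A D"
    and Comp_Ident: "f \<in> hom C A B \<Longrightarrow> f \<cdot> Ident C A = f"
    and Ident_Comp: "f \<in> hom C A B \<Longrightarrow> Ident C B \<cdot> f = f"
    and Comp_assoc: "f \<in> hom C A B \<Longrightarrow> g \<in> hom C B D \<Longrightarrow> h \<in> hom C D E \<Longrightarrow>
      (h \<cdot> g) \<cdot> f = h \<cdot> (g \<cdot> f)"

definition monic :: "('o, 'm, 'x) cat_scheme \<Rightarrow> 'm \<Rightarrow> bool" where
  "monic C m \<longleftrightarrow> m \<in> Arr C \<and>
     (\<forall>A f g. f \<in> hom C A (Dom C m) \<longrightarrow> g \<in> hom C A (Dom C m) \<longrightarrow>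
        Comp C m f = Comp C m g \<longrightarrow> f = g)"

definition iso :: "('o, 'm, 'x) cat_scheme \<Rightarrow> 'm \<Rightarrow> bool" where
  "iso C f \<longleftrightarrow> f \<in> Arr C \<and>
     (\<exists>g \<in> hom C (Cod C f) (Dom C f).
        Comp C g f = Ident C (Dom C f) \<and> Comp C f g = Ident C (Cod C f))"

record ('o, 'm, 'p, 'n) funct =
  FObj :: "'o \<Rightarrow> 'p"
  FArr :: "'m \<Rightarrow> 'n"

locale cat_functor = C: category C + D: category D
  for C :: "('o, 'm, 'x) cat_scheme" and D :: "('p, 'n, 'y) cat_scheme" +
  fixes F :: "('o, 'm, 'p, 'n) funct"
  assumes FObj_in_Obj: "A \<in> Obj C \<Longrightarrow> FObj F A \<in> Obj D"
    and FArr_in_hom: "f \<in> hom C A B \<Longrightarrow> FArr F f \<in> hom D (FObj F A) (FObj F B)"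
    and FArr_Ident: "A \<in> Obj C \<Longrightarrow> FArr F (Ident C A) = Ident D (FObj F A)"
    and FArr_Comp: "f \<in> hom C A B \<Longrightarrow> g \<in> hom C B E \<Longrightarrow>
      FArr F (Comp C g f) = Comp D (FArr F g) (FArr F f)"

definition funct_id :: "('o, 'm, 'o, 'm) funct" where
  "funct_id = \<lparr>FObj = (\<lambda>A. A), FArr = (\<lambda>f. f)\<rparr>"

definition funct_comp ::
  "('p, 'n, 'q, 'r) funct \<Rightarrow> ('o, 'm, 'p, 'n) funct \<Rightarrow> ('o, 'm, 'q, 'r) funct" where
  "funct_comp G F = \<lparr>FObj = FObj G \<circ> FObj F, FArr = FArr G \<circ> FArr F\<rparr>"

definition natural_transformation ::
  "('o, 'm, 'x) cat_scheme \<Rightarrow> ('p, 'n, 'y) cat_scheme \<Rightarrow>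
   ('o, 'm, 'p, 'n) funct \<Rightarrow> ('o, 'm, 'p, 'n) funct \<Rightarrow> ('o \<Rightarrow> 'n) \<Rightarrow> bool" where
  "natural_transformation C D F G \<alpha> \<longleftrightarrow>
     cat_functor C D F \<and> cat_functor C D G \<and>
     (\<forall>A \<in> Obj C. \<alpha> A \<in> hom D (FObj F A) (FObj G A)) \<and>
     (\<forall>A B. \<forall>f \<in> hom C A B. Comp D (\<alpha> B) (FArr F f) = Comp D (FArr G f) (\<alpha> A))"

definition natural_isomorphism ::
  "('o, 'm, 'x) cat_scheme \<Rightarrow> ('p, 'n, 'y) cat_scheme \<Rightarrow>
   ('o, 'm, 'p, 'n) funct \<Rightarrow> ('o, 'm, 'p, 'n) funct \<Rightarrow> ('o \<Rightarrow> 'n) \<Rightarrow> bool" where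
  "natural_isomorphism C D F G \<alpha> \<longleftrightarrow>
     natural_transformation C D F G \<alpha> \<and> (\<forall>A \<in> Obj C. iso D (\<alpha> A))"


section \<open>Cartesian closed categories with chosen structure\<close>

record ('o, 'm) ccc = "('o, 'm) cat" +
  One :: 'o
  Bang :: "'o \<Rightarrow> 'm"
  Prod :: "'o \<Rightarrow> 'o \<Rightarrow> 'o"
  Fst :: "'o \<Rightarrow> 'o \<Rightarrow> 'm"
  Snd :: "'o \<Rightarrow> 'o \<Rightarrow> 'm"
  Tuple :: "'m \<Rightarrow> 'm \<Rightarrow> 'm"
  Exp :: "'o \<Rightarrow> 'o \<Rightarrow> 'o"
  Ev :: "'o \<Rightarrow> 'o \<Rightarrow> 'm"
  Curry :: "'o \<Rightarrow> 'o \<Rightarrow> 'm \<Rightarrow> 'm"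

text \<open>
  \<open>Exp C A B\<close> is the exponential \<open>A \<Rightarrow> B\<close> with evaluation \<open>Ev C A B : (A \<Rightarrow> B) \<times> A \<rightarrow> B\<close>, and
  \<open>Curry C X A f : X \<rightarrow> (A \<Rightarrow> B)\<close> is the transpose of \<open>f : X \<times> A \<rightarrow> B\<close>.
\<close>

locale cartesian_closed_category = category C
  for C :: "('o, 'm, 'x) ccc_scheme" (structure) +
  assumes One_in_Obj: "One C \<in> Obj C"
    and Bang_in_hom: "A \<in> Obj C \<Longrightarrow> Bang C A \<in> hom C A (One C)"
    and Bang_unique: "f \<in> hom C A (One C) \<Longrightarrow> f = Bang C A"
    and Prod_in_Obj: "A \<in> Obj C \<Longrightarrow> B \<in> Obj C \<Longrightarrow> Prod C A B \<in> Obj C"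
    and Fst_in_hom: "A \<in> Obj C \<Longrightarrow> B \<in> Obj C \<Longrightarrow> Fst C A B \<in> hom C (Prod C A B) A"
    and Snd_in_hom: "A \<in> Obj C \<Longrightarrow> B \<in> Obj C \<Longrightarrow> Snd C A B \<in> hom C (Prod C A B) B"
    and Tuple_in_hom: "f \<in> hom C X A \<Longrightarrow> g \<in> hom C X B \<Longrightarrow> Tuple C f g \<in> hom C X (Prod C A B)"
    and Fst_Tuple: "f \<in> hom C X A \<Longrightarrow> g \<in> hom C X B \<Longrightarrow> Fst C A B \<cdot> Tuple C f g = f"
    and Snd_Tuple: "f \<in> hom C X A \<Longrightarrow> g \<in> hom C X B \<Longrightarrow> Snd C A B \<cdot> Tuple C f g = g"
    and Tuple_unique: "A \<in> Obj C \<Longrightarrow> B \<in> Obj C \<Longrightarrow> h \<in> hom C X (Prod C A B) \<Longrightarrow>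
      h = Tuple C (Fst C A B \<cdot> h) (Snd C A B \<cdot> h)"
    and Exp_in_Obj: "A \<in> Obj C \<Longrightarrow> B \<in> Obj C \<Longrightarrow> Exp C A B \<in> Obj C"
    and Ev_in_hom: "A \<in> Obj C \<Longrightarrow> B \<in> Obj C \<Longrightarrow> Ev C A B \<in> hom C (Prod C (Exp C A B) A) B"
    and Curry_in_hom: "X \<in> Obj C \<Longrightarrow> A \<in> Obj C \<Longrightarrow> f \<in> hom C (Prod C X A) B \<Longrightarrow>
      Curry C X A f \<in> hom C X (Exp C A B)"
    and Ev_Curry: "X \<in> Obj C \<Longrightarrow> A \<in> Obj C \<Longrightarrow> f \<in> hom C (Prod C X A) B \<Longrightarrow>
      Ev C A B \<cdot> Tuple C (Curry C X A f \<cdot> Fst C X A) (Snd C X A) = f"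
    and Curry_unique: "A \<in> Obj C \<Longrightarrow> B \<in> Obj C \<Longrightarrow> g \<in> hom C X (Exp C A B) \<Longrightarrow>
      g = Curry C X A (Ev C A B \<cdot> Tuple C (g \<cdot> Fst C X A) (Snd C X A))"

definition cross :: "('o, 'm, 'x) ccc_scheme \<Rightarrow> 'm \<Rightarrow> 'm \<Rightarrow> 'm" where
  "cross C f g = Tuple C (Comp C f (Fst C (Dom C f) (Dom C g)))
                         (Comp C g (Snd C (Dom C f) (Dom C g)))"

definition prod_assoc :: "('o, 'm, 'x) ccc_scheme \<Rightarrow> 'o \<Rightarrow> 'o \<Rightarrow> 'o \<Rightarrow> 'm" where
  "prod_assoc C A B D =
     Tuple C (Comp C (Fst C A B) (Fst C (Prod C A B) D))
             (Tuple C (Comp C (Snd C A B) (Fst C (Prod C A B) D)) (Snd C (Prod C A B) D))"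

definition prod_swap :: "('o, 'm, 'x) ccc_scheme \<Rightarrow> 'o \<Rightarrow> 'o \<Rightarrow> 'm" where
  "prod_swap C A B = Tuple C (Snd C A B) (Fst C A B)"


section \<open>Strong monads and central submonads\<close>

record ('o, 'm) monad =
  MObj :: "'o \<Rightarrow> 'o"
  MArr :: "'m \<Rightarrow> 'm"
  Unit :: "'o \<Rightarrow> 'm"
  Mult :: "'o \<Rightarrow> 'm"
  Str :: "'o \<Rightarrow> 'o \<Rightarrow> 'm"

locale strong_monad = cartesian_closed_category C
  for C :: "('o, 'm, 'x) ccc_scheme" (structure) +
  fixes M :: "('o, 'm) monad"
  assumes endofunctor: "cat_functor C C \<lparr>FObj = MObj M, FArr = MArr M\<rparr>"
    and Unit_in_hom: "A \<in> Obj C \<Longrightarrow> Unit M A \<in> hom C A (MObj M A)"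
    and Unit_natural: "f \<in> hom C A B \<Longrightarrow> Unit M B \<cdot> f = MArr M f \<cdot> Unit M A"
    and Mult_in_hom: "A \<in> Obj C \<Longrightarrow> Mult M A \<in> hom C (MObj M (MObj M A)) (MObj M A)"
    and Mult_natural: "f \<in> hom C A B \<Longrightarrow> Mult M B \<cdot> MArr M (MArr M f) = MArr M f \<cdot> Mult M A"
    and Mult_Unit: "A \<in> Obj C \<Longrightarrow> Mult M A \<cdot> Unit M (MObj M A) = Ident C (MObj M A)"
    and Mult_MArr_Unit: "A \<in> Obj C \<Longrightarrow> Mult M A \<cdot> MArr M (Unit M A) = Ident C (MObj M A)"
    and Mult_assoc: "A \<in> Obj C \<Longrightarrow> Mult M A \<cdot> Mult M (MObj M A) = Mult M A \<cdot> MArr M (Mult M A)"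
    and Str_in_hom: "A \<in> Obj C \<Longrightarrow> B \<in> Obj C \<Longrightarrow>
      Str M A B \<in> hom C (Prod C A (MObj M B)) (MObj M (Prod C A B))"
    and Str_natural: "f \<in> hom C A A' \<Longrightarrow> g \<in> hom C B B' \<Longrightarrow>
      Str M A' B' \<cdot> cross C f (MArr M g) = MArr M (cross C f g) \<cdot> Str M A B"
    and Str_One: "A \<in> Obj C \<Longrightarrow>
      MArr M (Snd C (One C) A) \<cdot> Str M (One C) A = Snd C (One C) (MObj M A)"
    and Str_assoc: "A \<in> Obj C \<Longrightarrow> B \<in> Obj C \<Longrightarrow> D \<in> Obj C \<Longrightarrow>
      MArr M (prod_assoc C A B D) \<cdot> Str M (Prod C A B) D
      = Str M A (Prod C B D) \<cdot> cross C (Ident C A) (Str M B D) \<cdot> prod_assoc C A B (MObj M D)"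
    and Str_Unit: "A \<in> Obj C \<Longrightarrow> B \<in> Obj C \<Longrightarrow>
      Str M A B \<cdot> cross C (Ident C A) (Unit M B) = Unit M (Prod C A B)"
    and Str_Mult: "A \<in> Obj C \<Longrightarrow> B \<in> Obj C \<Longrightarrow>
      Str M A B \<cdot> cross C (Ident C A) (Mult M B)
      = Mult M (Prod C A B) \<cdot> MArr M (Str M A B) \<cdot> Str M A (MObj M B)"

definition right_str :: "('o, 'm, 'x) ccc_scheme \<Rightarrow> ('o, 'm) monad \<Rightarrow> 'o \<Rightarrow> 'o \<Rightarrow> 'm" where
  "right_str C M A B =
     Comp C (MArr M (prod_swap C B A)) (Comp C (Str M B A) (prod_swap C (MObj M A) B))"

definition central_cone ::
  "('o, 'm, 'x) ccc_scheme \<Rightarrow> ('o, 'm) monad \<Rightarrow> 'o \<Rightarrow> 'o \<Rightarrow> 'm \<Rightarrow> bool" where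
  "central_cone C M X Z f \<longleftrightarrow> f \<in> hom C Z (MObj M X) \<and>
     (\<forall>Y \<in> Obj C.
        Comp C (Mult M (Prod C X Y)) (Comp C (MArr M (right_str C M X Y))
          (Comp C (Str M (MObj M X) Y) (cross C f (Ident C (MObj M Y)))))
      = Comp C (Mult M (Prod C X Y)) (Comp C (MArr M (Str M X Y))
          (Comp C (right_str C M X (MObj M Y)) (cross C f (Ident C (MObj M Y))))))"

locale central_submonad = S: strong_monad C S + T: strong_monad C T
  for C :: "('o, 'm, 'x) ccc_scheme" (structure)
    and S :: "('o, 'm) monad" and T :: "('o, 'm) monad" +
  fixes \<iota> :: "'o \<Rightarrow> 'm"
  assumes iota_in_hom: "A \<in> Obj C \<Longrightarrow> \<iota> A \<in> hom C (MObj S A) (MObj T A)"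
    and iota_natural: "f \<in> hom C A B \<Longrightarrow> \<iota> B \<cdot> MArr S f = MArr T f \<cdot> \<iota> A"
    and iota_Unit: "A \<in> Obj C \<Longrightarrow> \<iota> A \<cdot> Unit S A = Unit T A"
    and iota_Mult: "A \<in> Obj C \<Longrightarrow> \<iota> A \<cdot> Mult S A = Mult T A \<cdot> MArr T (\<iota> A) \<cdot> \<iota> (MObj S A)"
    and iota_Str: "A \<in> Obj C \<Longrightarrow> B \<in> Obj C \<Longrightarrow>
      \<iota> (Prod C A B) \<cdot> Str S A B = Str T A B \<cdot> cross C (Ident C A) (\<iota> B)"
    and iota_monic: "A \<in> Obj C \<Longrightarrow> monic C (\<iota> A)"
    and iota_central: "A \<in> Obj C \<Longrightarrow> central_cone C T A (MObj S A) (\<iota> A)"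


section \<open>Models and their morphisms\<close>

record ('o, 'm) csc_structure = "('o, 'm) ccc" +
  mon :: "mname \<Rightarrow> ('o, 'm) monad"
  iota :: "'o \<Rightarrow> 'm"

definition csc_model :: "('o, 'm) csc_structure \<Rightarrow> bool" where
  "csc_model C \<longleftrightarrow> central_submonad C (mon C SMon) (mon C TMon) (iota C)"

locale csc_model_morphism = cat_functor C D F
  for C :: "('o, 'm) csc_structure" and D :: "('p, 'n) csc_structure"
    and F :: "('o, 'm, 'p, 'n) funct" +
  assumes source: "csc_model C"
    and target: "csc_model D"
    and pres_One: "FObj F (One C) = One D"
    and pres_Prod: "A \<in> Obj C \<Longrightarrow> B \<in> Obj C \<Longrightarrow>
      FObj F (Prod C A B) = Prod D (FObj F A) (FObj F B)"
    and pres_Fst: "A \<in> Obj C \<Longrightarrow> B \<in> Obj C \<Longrightarrow>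
      FArr F (Fst C A B) = Fst D (FObj F A) (FObj F B)"
    and pres_Snd: "A \<in> Obj C \<Longrightarrow> B \<in> Obj C \<Longrightarrow>
      FArr F (Snd C A B) = Snd D (FObj F A) (FObj F B)"
    and pres_Exp: "A \<in> Obj C \<Longrightarrow> B \<in> Obj C \<Longrightarrow>
      FObj F (Exp C A B) = Exp D (FObj F A) (FObj F B)"
    and pres_Ev: "A \<in> Obj C \<Longrightarrow> B \<in> Obj C \<Longrightarrow>
      FArr F (Ev C A B) = Ev D (FObj F A) (FObj F B)"
    and pres_MObj: "A \<in> Obj C \<Longrightarrow> FObj F (MObj (mon C X) A) = MObj (mon D X) (FObj F A)"
    and pres_MArr: "f \<in> Arr C \<Longrightarrow> FArr F (MArr (mon C X) f) = MArr (mon D X) (FArr F f)"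
    and pres_iota: "A \<in> Obj C \<Longrightarrow> FArr F (iota C A) = iota D (FObj F A)"
    and pres_Unit: "A \<in> Obj C \<Longrightarrow> FArr F (Unit (mon C X) A) = Unit (mon D X) (FObj F A)"
    and pres_Mult: "A \<in> Obj C \<Longrightarrow> FArr F (Mult (mon C X) A) = Mult (mon D X) (FObj F A)"
    and pres_Str: "A \<in> Obj C \<Longrightarrow> B \<in> Obj C \<Longrightarrow>
      FArr F (Str (mon C X) A B) = Str (mon D X) (FObj F A) (FObj F B)"


section \<open>The syntactic model of a theory\<close>

definition ty_class :: "('g, 'c) csc_thy \<Rightarrow> 'g ty \<Rightarrow> 'g ty set" where
  "ty_class T A = {A'. ty_eq T A A'}"

text \<open>\<open>jdg_class T A M B\<close> is the class of the judgement \<open>x : A \<turnstile> M : B\<close>.\<close>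

definition jdg_class ::
  "('g, 'c) csc_thy \<Rightarrow> 'g ty \<Rightarrow> ('g, 'c) tm \<Rightarrow> 'g ty \<Rightarrow> ('g ty \<times> ('g, 'c) tm \<times> 'g ty) set" where
  "jdg_class T A M B = {(A', M', B'). ty_eq T A A' \<and> ty_eq T B B' \<and> tm_eq T [A] M M' B}"

text \<open>
  Operations on classes are unions over all representatives, as in the theory
  \<open>Equiv_Relations\<close>. In all occurrences of \<open>jdg_class\<close>, \<open>Var 0\<close> outside and \<open>Var 1\<close> inside one
  binder denote the variable of the judgement. Since \<open>M\<close> with \<open>(A, M, B)\<close> in an arrow has no
  variable except \<open>0\<close>, it may be placed under the binder of \<open>Do\<close> as it is, to make
  \<open>do\<^sub>X y \<leftarrow> x; ret\<^sub>X M[y/x]\<close>.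
\<close>

definition syn_monad ::
  "('g, 'c) csc_thy \<Rightarrow> mname \<Rightarrow> ('g ty set, ('g ty \<times> ('g, 'c) tm \<times> 'g ty) set) monad" where
  "syn_monad T X = \<lparr>
     MObj = (\<lambda>a. \<Union>A\<in>a. ty_class T (TM X A)),
     MArr = (\<lambda>m. \<Union>(A, M, B)\<in>m.
       jdg_class T (TM X A) (Do X A B (Var 0) (Ret X M)) (TM X B)),
     Unit = (\<lambda>a. \<Union>A\<in>a. jdg_class T A (Ret X (Var 0)) (TM X A)),
     Mult = (\<lambda>a. \<Union>A\<in>a.
       jdg_class T (TM X (TM X A)) (Do X (TM X A) A (Var 0) (Var 0)) (TM X A)),
     Str = (\<lambda>a b. \<Union>A\<in>a. \<Union>B\<in>b.
       jdg_class T (TProd A (TM X B))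
         (Do X B (TProd A B) (Pi2 A (TM X B) (Var 0))
            (Ret X (Pr (Pi1 A (TM X B) (Var 1)) (Var 0))))
         (TM X (TProd A B)))\<rparr>"

definition syn_model ::
  "('g, 'c) csc_thy \<Rightarrow> ('g ty set, ('g ty \<times> ('g, 'c) tm \<times> 'g ty) set) csc_structure" where
  "syn_model T = \<lparr>
     Obj = {ty_class T A |A. wf_ty T A},
     Arr = {jdg_class T A M B |A M B. typing T [A] M B},
     Dom = (\<lambda>m. \<Union>(A, M, B)\<in>m. ty_class T A),
     Cod = (\<lambda>m. \<Union>(A, M, B)\<in>m. ty_class T B),
     Ident = (\<lambda>a. \<Union>A\<in>a. jdg_class T A (Var 0) A),
     Comp = (\<lambda>n m. \<Union>(A, M, B)\<in>m. \<Union>(B', N, C)\<in>n. jdg_class T A (inst M N) C),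
     One = ty_class T TOne,
     Bang = (\<lambda>a. \<Union>A\<in>a. jdg_class T A Star TOne),
     Prod = (\<lambda>a b. \<Union>A\<in>a. \<Union>B\<in>b. ty_class T (TProd A B)),
     Fst = (\<lambda>a b. \<Union>A\<in>a. \<Union>B\<in>b. jdg_class T (TProd A B) (Pi1 A B (Var 0)) A),
     Snd = (\<lambda>a b. \<Union>A\<in>a. \<Union>B\<in>b. jdg_class T (TProd A B) (Pi2 A B (Var 0)) B),
     Tuple = (\<lambda>m n. \<Union>(A, M, B)\<in>m. \<Union>(A', N, C)\<in>n. jdg_class T A (Pr M N) (TProd B C)),
     Exp = (\<lambda>a b. \<Union>A\<in>a. \<Union>B\<in>b. ty_class T (TFun A B)),
     Ev = (\<lambda>a b. \<Union>A\<in>a. \<Union>B\<in>b.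
       jdg_class T (TProd (TFun A B) A)
         (App A B (Pi1 (TFun A B) A (Var 0)) (Pi2 (TFun A B) A (Var 0))) B),
     Curry = (\<lambda>x a m. \<Union>X\<in>x. \<Union>A\<in>a. \<Union>(D, M, B)\<in>m.
       jdg_class T X (Lam A (inst (Pr (Var 1) (Var 0)) M)) (TFun A B)),
     mon = syn_monad T,
     iota = (\<lambda>a. \<Union>A\<in>a. jdg_class T (TM SMon A) (Iota A (Var 0)) (TM TMon A))\<rparr>"


section \<open>The internal language of a model\<close>

text \<open>
  The ground type \<open>A\<^sup>*\<close> of an object \<open>A\<close> is \<open>Ground A\<close>, and the constant \<open>c\<^sub>f\<close> of a
  morphism \<open>f\<close> is \<open>Const f\<close>.
\<close>

primrec ity :: "('o, 'm) csc_structure \<Rightarrow> 'o ty \<Rightarrow> 'o" where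
  "ity C (Ground A) = A"
| "ity C TOne = One C"
| "ity C (TFun A B) = Exp C (ity C A) (ity C B)"
| "ity C (TProd A B) = Prod C (ity C A) (ity C B)"
| "ity C (TM X A) = MObj (mon C X) (ity C A)"

primrec ictx :: "('o, 'm) csc_structure \<Rightarrow> 'o ty list \<Rightarrow> 'o" where
  "ictx C [] = One C"
| "ictx C (A # \<Gamma>) = Prod C (ictx C \<Gamma>) (ity C A)"

primrec ivar :: "('o, 'm) csc_structure \<Rightarrow> 'o ty list \<Rightarrow> nat \<Rightarrow> 'm" where
  "ivar C [] i = undefined"
| "ivar C (A # \<Gamma>) i = (case i of
     0 \<Rightarrow> Snd C (ictx C \<Gamma>) (ity C A)
   | Suc j \<Rightarrow> Comp C (ivar C \<Gamma> j) (Fst C (ictx C \<Gamma>) (ity C A)))"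

primrec itm :: "('o, 'm) csc_structure \<Rightarrow> ('o, 'm) tm \<Rightarrow> 'o ty list \<Rightarrow> 'm" where
  "itm C (Var i) \<Gamma> = ivar C \<Gamma> i"
| "itm C (Const f) \<Gamma> =
     Comp C (Curry C (One C) (Dom C f) (Comp C f (Snd C (One C) (Dom C f)))) (Bang C (ictx C \<Gamma>))"
| "itm C Star \<Gamma> = Bang C (ictx C \<Gamma>)"
| "itm C (Lam A M) \<Gamma> = Curry C (ictx C \<Gamma>) (ity C A) (itm C M (A # \<Gamma>))"
| "itm C (App A B M N) \<Gamma> =
     Comp C (Ev C (ity C A) (ity C B)) (Tuple C (itm C M \<Gamma>) (itm C N \<Gamma>))"
| "itm C (Pr M N) \<Gamma> = Tuple C (itm C M \<Gamma>) (itm C N \<Gamma>)"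
| "itm C (Pi1 A B M) \<Gamma> = Comp C (Fst C (ity C A) (ity C B)) (itm C M \<Gamma>)"
| "itm C (Pi2 A B M) \<Gamma> = Comp C (Snd C (ity C A) (ity C B)) (itm C M \<Gamma>)"
| "itm C (Ret X M) \<Gamma> = Comp C (Unit (mon C X) (Cod C (itm C M \<Gamma>))) (itm C M \<Gamma>)"
| "itm C (Iota A M) \<Gamma> = Comp C (iota C (ity C A)) (itm C M \<Gamma>)"
| "itm C (Do X A B M N) \<Gamma> =
     Comp C (Mult (mon C X) (ity C B))
       (Comp C (MArr (mon C X) (itm C N (A # \<Gamma>)))
         (Comp C (Str (mon C X) (ictx C \<Gamma>) (ity C A))
           (Tuple C (Ident C (ictx C \<Gamma>)) (itm C M \<Gamma>))))"

text \<open>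
  Well-formedness of types does not depend on the axioms, and typing does not depend on the term
  axioms, so both can be used to restrict the axioms to well-formed ones.
\<close>

definition int_sig :: "('o, 'm) csc_structure \<Rightarrow> ('o, 'm) csc_sig" where
  "int_sig C =
     (let s = \<lparr>grounds = Obj C, consts_of = Arr C,
               const_ty = (\<lambda>f. TFun (Ground (Dom C f)) (Ground (Cod C f))), ty_axioms = {}\<rparr>
      in s\<lparr>ty_axioms := {(A, B). wf_ty s A \<and> wf_ty s B \<and> ity C A = ity C B}\<rparr>)"

definition int_lang :: "('o, 'm) csc_structure \<Rightarrow> ('o, 'm) csc_thy" where
  "int_lang C = csc_sig.extend (int_sig C)
     \<lparr>tm_axioms = {(\<Gamma>, M, N, A).
        typing (int_sig C) \<Gamma> M A \<and> typing (int_sig C) \<Gamma> N A \<and> itm C M \<Gamma> = itm C N \<Gamma>}\<rparr>"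

end

(*
  Both halves come from computing with representatives in the syntactic model.

  For a theory T, the internal language of S(T) is translated back to T by choosing representatives
  of the classes of types and judgements; its terms are interpreted in S(T) as the classes of their
  translations, with the variables replaced by projections out of the product of the context. So
  equality of interpretations is provable equality in T, both translations preserve the axioms of
  the internal language, and the two composites are equal to the identities up to provable equality:
  all the transformations consist of variables.

  For a model C, soundness makes the interpretation of the internal language well defined on
  the classes of S(L(C)), and the axioms of L(C) make it injective. Hence the interpretation is an
  isomorphism of structures from S(L(C)) to C, whose inverse sends an object and a morphism to their
  names. The axioms of a model are transported along it, so no syntactic proof that S(L(C)) is
  a model is needed, and both natural isomorphisms are identities.
*)

theory Submission
  imports Defs
begin

section \<open>Substitution\<close>

text \<open>Type equality is the obstacle. A theory may equate two products without equating their
  components, so a type does not determine the types of its parts: typing is used by induction on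
  derivations, never by inversion, and component types are read off the annotations. A class of
  types or judgements can thus have quite different members, and each operation has to be evaluated
  on an arbitrary one.

  The second half does not rest on \<open>syn_model T\<close> being a model. The function
  \<open>itm\<close> makes sense in any structure, and \<open>itm_syn\<close> calculates it in
  \<open>syn_model T\<close> term by term, which takes the place of a soundness theorem there. The
  translations need a check only on generators and axioms, because all other rules are preserved by
  any map that commutes with the formers. An axiom of \<open>T\<close> is checked in
  \<open>LS\<close> by translating it back: provably equal back-translations have equal
  interpretations, and these are equated by an axiom of \<open>LS\<close>.

  In the first half soundness is reduced to laws of \<open>bind\<close>, a \<open>do\<close>
  relative to a context; its associativity and centrality are where the strength does its
  work.\<close>

lemma up_ren_simps [simp]: "up_ren r 0 = 0" "up_ren r (Suc i) = Suc (r i)"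
  by (simp_all add: up_ren_def)

lemma up_sub_simps [simp]: "up_sub \<sigma> 0 = Var 0" "up_sub \<sigma> (Suc i) = shift (\<sigma> i)"
  by (simp_all add: up_sub_def)

lemma up_sub_Var [simp]: "up_sub Var = Var"
proof
  fix i show "up_sub Var i = Var i" by (cases i) simp_all
qed

lemma subst_Var [simp]: "subst Var M = M"
  by (induction M) simp_all

lemma up_sub_ren: "up_sub (\<lambda>i. Var (r i)) = (\<lambda>i. Var (up_ren r i))"
proof
  fix i show "up_sub (\<lambda>i. Var (r i)) i = Var (up_ren r i)" by (cases i) simp_all
qed

text \<open>Makes weakening an instance of substitution, so that results on substitution, such as
  the rule \<open>eq_subst\<close>, also serve for \<open>shift\<close>.\<close>

lemma rename_eq_subst: "rename r M = subst (\<lambda>i. Var (r i)) M"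
  by (induction M arbitrary: r) (simp_all add: up_sub_ren)

text \<open>Composing two substitutions under a binder requires moving \<open>subst\<close> past
  \<open>shift\<close> on either side, so the two mixed laws come before
  \<open>subst_subst\<close>.\<close>

lemma subst_rename: "subst \<sigma> (rename r M) = subst (\<lambda>i. \<sigma> (r i)) M"
proof (induction M arbitrary: \<sigma> r)
  have *: "(\<lambda>i. up_sub \<sigma> (up_ren r i)) = up_sub (\<lambda>i. \<sigma> (r i))" for \<sigma> :: "nat \<Rightarrow> ('a, 'b) tm" and r
  proof
    fix i show "up_sub \<sigma> (up_ren r i) = up_sub (\<lambda>i. \<sigma> (r i)) i" by (cases i) simp_all
  qed
  { case Lam then show ?case by (simp add: *)
  next case Do then show ?case by (simp add: *) }
qed simp_all

lemma rename_rename: "rename s (rename r M) = rename (\<lambda>i. s (r i)) M"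
  by (simp add: rename_eq_subst[of s] subst_rename) (simp add: rename_eq_subst)

lemma rename_subst: "rename r (subst \<sigma> M) = subst (\<lambda>i. rename r (\<sigma> i)) M"
proof (induction M arbitrary: \<sigma> r)
  have *: "(\<lambda>i. rename (up_ren r) (up_sub \<sigma> i)) = up_sub (\<lambda>i. rename r (\<sigma> i))"
    for \<sigma> :: "nat \<Rightarrow> ('a, 'b) tm" and r
  proof
    fix i show "rename (up_ren r) (up_sub \<sigma> i) = up_sub (\<lambda>i. rename r (\<sigma> i)) i"
      by (cases i) (simp_all add: rename_rename)
  qed
  { case Lam then show ?case by (simp add: *)
  next case Do then show ?case by (simp add: *) }
qed simp_all

lemma subst_subst: "subst \<tau> (subst \<sigma> M) = subst (\<lambda>i. subst \<tau> (\<sigma> i)) M"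
proof (induction M arbitrary: \<sigma> \<tau>)
  have *: "(\<lambda>i. subst (up_sub \<tau>) (up_sub \<sigma> i)) = up_sub (\<lambda>i. subst \<tau> (\<sigma> i))"
    for \<sigma> \<tau> :: "nat \<Rightarrow> ('a, 'b) tm"
  proof
    fix i show "subst (up_sub \<tau>) (up_sub \<sigma> i) = up_sub (\<lambda>i. subst \<tau> (\<sigma> i)) i"
      by (cases i) (simp_all add: subst_rename rename_subst)
  qed
  { case Lam then show ?case by (simp add: *)
  next case Do then show ?case by (simp add: *) }
qed simp_all

definition inst_sub :: "('g, 'c) tm \<Rightarrow> nat \<Rightarrow> ('g, 'c) tm" where
  "inst_sub N i = (case i of 0 \<Rightarrow> N | Suc j \<Rightarrow> Var j)"

lemma inst_sub_simps [simp]: "inst_sub N 0 = N" "inst_sub N (Suc i) = Var i"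
  by (simp_all add: inst_sub_def)

lemma inst_eq: "inst N M = subst (inst_sub N) M"
  by (simp add: inst_def inst_sub_def[abs_def])

lemma inst_Var0 [simp]: "inst M (Var 0) = M"
  by (simp add: inst_def)


section \<open>Typing\<close>

lemma wf_ctx_simps [simp]:
  "wf_ctx T []" "wf_ctx T (A # \<Gamma>) \<longleftrightarrow> wf_ty T A \<and> wf_ctx T \<Gamma>"
  by (auto simp: wf_ctx_def)

lemma wf_ctx_nth: "wf_ctx T \<Gamma> \<Longrightarrow> i < length \<Gamma> \<Longrightarrow> wf_ty T (\<Gamma> ! i)"
  by (simp add: wf_ctx_def)

lemma wf_ty_simps [simp]:
  "wf_ty T (Ground g) \<longleftrightarrow> g \<in> grounds T"
  "wf_ty T TOne"
  "wf_ty T (TFun A B) \<longleftrightarrow> wf_ty T A \<and> wf_ty T B"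
  "wf_ty T (TProd A B) \<longleftrightarrow> wf_ty T A \<and> wf_ty T B"
  "wf_ty T (TM X A) \<longleftrightarrow> wf_ty T A"
  by (auto intro: wf_ty.intros elim: wf_ty.cases)

lemmas typing_rules = ty_Const ty_Star ty_Lam ty_App ty_Pr ty_Pi1 ty_Pi2 ty_Ret ty_Iota ty_Do

lemma typing_wf_ctx: "typing T \<Gamma> M A \<Longrightarrow> wf_ctx T \<Gamma>"
  by (induction rule: typing.induct) auto

lemma typing_rename:
  "typing T \<Gamma> M A \<Longrightarrow> wf_ctx T \<Delta> \<Longrightarrow> (\<And>i. i < length \<Gamma> \<Longrightarrow> r i < length \<Delta> \<and> \<Delta> ! r i = \<Gamma> ! i) \<Longrightarrow>
    typing T \<Delta> (rename r M) A"
proof (induction arbitrary: r \<Delta> rule: typing.induct)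
  case (ty_Var \<Gamma> i)
  then show ?case using typing.ty_Var[of T \<Delta> "r i"] by simp
next
  case (ty_Lam A \<Gamma> M B)
  have "typing T (A # \<Delta>) (rename (up_ren r) M) B"
  proof (rule ty_Lam.IH)
    show "wf_ctx T (A # \<Delta>)" using typing_wf_ctx[OF ty_Lam.hyps] ty_Lam.prems by simp
    show "up_ren r i < length (A # \<Delta>) \<and> (A # \<Delta>) ! up_ren r i = (A # \<Gamma>) ! i"
      if "i < length (A # \<Gamma>)" for i
      using that ty_Lam.prems(2) by (cases i) auto
  qed
  then show ?case by (simp add: typing.ty_Lam)
next
  case (ty_Do \<Gamma> M X A N B)
  have "typing T (A # \<Delta>) (rename (up_ren r) N) (TM X B)"
  proof (rule ty_Do.IH)
    show "wf_ctx T (A # \<Delta>)" using typing_wf_ctx[OF ty_Do.hyps(2)] ty_Do.prems by simp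
    show "up_ren r i < length (A # \<Delta>) \<and> (A # \<Delta>) ! up_ren r i = (A # \<Gamma>) ! i"
      if "i < length (A # \<Gamma>)" for i
      using that ty_Do.prems(2) by (cases i) auto
  qed
  then show ?case using ty_Do by (simp add: typing.ty_Do)
next
  case ty_conv
  then show ?case by (blast intro: typing.ty_conv)
qed (auto intro: typing_rules)

lemma typing_shift: "typing T \<Gamma> M A \<Longrightarrow> wf_ty T B \<Longrightarrow> typing T (B # \<Gamma>) (shift M) A"
  using typing_wf_ctx[of T \<Gamma> M A] by (intro typing_rename) auto

lemma typing_subst:
  "typing T \<Gamma> M A \<Longrightarrow> wf_ctx T \<Delta> \<Longrightarrow> (\<And>i. i < length \<Gamma> \<Longrightarrow> typing T \<Delta> (\<sigma> i) (\<Gamma> ! i)) \<Longrightarrow>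
    typing T \<Delta> (subst \<sigma> M) A"
proof (induction arbitrary: \<sigma> \<Delta> rule: typing.induct)
  case (ty_Lam A \<Gamma> M B)
  have "typing T (A # \<Delta>) (subst (up_sub \<sigma>) M) B"
  proof (rule ty_Lam.IH)
    show *: "wf_ctx T (A # \<Delta>)" using typing_wf_ctx[OF ty_Lam.hyps] ty_Lam.prems by simp
    show "typing T (A # \<Delta>) (up_sub \<sigma> i) ((A # \<Gamma>) ! i)" if "i < length (A # \<Gamma>)" for i
      using that * ty_Lam.prems(2) ty_Var[OF *, of 0] by (cases i) (auto intro: typing_shift)
  qed
  then show ?case by (simp add: typing.ty_Lam)
next
  case (ty_Do \<Gamma> M X A N B)
  have "typing T (A # \<Delta>) (subst (up_sub \<sigma>) N) (TM X B)"
  proof (rule ty_Do.IH)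
    show *: "wf_ctx T (A # \<Delta>)" using typing_wf_ctx[OF ty_Do.hyps(2)] ty_Do.prems by simp
    show "typing T (A # \<Delta>) (up_sub \<sigma> i) ((A # \<Gamma>) ! i)" if "i < length (A # \<Gamma>)" for i
      using that * ty_Do.prems(2) ty_Var[OF *, of 0] by (cases i) (auto intro: typing_shift)
  qed
  then show ?case using ty_Do by (simp add: typing.ty_Do)
next
  case ty_conv
  then show ?case by (blast intro: typing.ty_conv)
qed (auto intro: typing_rules)

lemma ty_Var0: "wf_ctx T (A # \<Gamma>) \<Longrightarrow> typing T (A # \<Gamma>) (Var 0) A"
  using ty_Var[of T "A # \<Gamma>" 0] by simp

lemma ty_Var1: "wf_ctx T (B # A # \<Gamma>) \<Longrightarrow> typing T (B # A # \<Gamma>) (Var (Suc 0)) A"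
  using ty_Var[of T "B # A # \<Gamma>" 1] by simp

lemma typing_inst:
  assumes "typing T (A # \<Gamma>) M B" "typing T \<Gamma> N A"
  shows "typing T \<Gamma> (inst N M) B"
  unfolding inst_eq
proof (rule typing_subst[OF assms(1)])
  show w: "wf_ctx T \<Gamma>" using assms(2) by (rule typing_wf_ctx)
  show "typing T \<Gamma> (inst_sub N i) ((A # \<Gamma>) ! i)" if "i < length (A # \<Gamma>)" for i
    using that assms w by (cases i) (auto intro: ty_Var)
qed

text \<open>Composition of judgements, in any context: \<open>M\<close> has at most variable 0, so
  no other value of the substitution matters.\<close>

lemma typing_inst1:
  assumes "typing T [A] M B" "typing T \<Gamma> N A"
  shows "typing T \<Gamma> (inst N M) B"
  unfolding inst_eq
proof (rule typing_subst[OF assms(1)])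
  show "wf_ctx T \<Gamma>" using assms(2) by (rule typing_wf_ctx)
qed (use assms in auto)

lemma up_sub_cong:
  "(\<And>i. i < n \<Longrightarrow> \<sigma> i = \<tau> i) \<Longrightarrow> i < Suc n \<Longrightarrow> up_sub \<sigma> i = up_sub \<tau> i"
  by (cases i) auto

text \<open>A typed term contains no variable beyond its context. Substitutions into closed or
  one-variable terms can therefore be compared at a single index or none.\<close>

lemma subst_cong:
  "typing T \<Gamma> M A \<Longrightarrow> (\<forall>i < length \<Gamma>. \<sigma> i = \<tau> i) \<Longrightarrow> subst \<sigma> M = subst \<tau> M"
proof (induction arbitrary: \<sigma> \<tau> rule: typing.induct)
  case (ty_Lam A \<Gamma> M B)
  have "subst (up_sub \<sigma>) M = subst (up_sub \<tau>) M"
    by (rule ty_Lam.IH) (use ty_Lam.prems up_sub_cong[of "length \<Gamma>" \<sigma> \<tau>] in simp)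
  then show ?case by simp
next
  case (ty_Do \<Gamma> M X A N B)
  have "subst (up_sub \<sigma>) N = subst (up_sub \<tau>) N"
    by (rule ty_Do.IH) (use ty_Do.prems up_sub_cong[of "length \<Gamma>" \<sigma> \<tau>] in simp)
  moreover have "subst \<sigma> M = subst \<tau> M" by (rule ty_Do.IH(1)) (rule ty_Do.prems)
  ultimately show ?case by simp
next
  case (ty_App \<Gamma> M A B N)
  with ty_App.IH[OF ty_App.prems] show ?case by simp
next
  case (ty_Pr \<Gamma> M A N B)
  with ty_Pr.IH[OF ty_Pr.prems] show ?case by simp
next
  case (ty_Pi1 \<Gamma> M A B) with ty_Pi1.IH[OF ty_Pi1.prems] show ?case by simp
next
  case (ty_Pi2 \<Gamma> M A B) with ty_Pi2.IH[OF ty_Pi2.prems] show ?case by simp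
next
  case (ty_Ret \<Gamma> M A X) with ty_Ret.IH[OF ty_Ret.prems] show ?case by simp
next
  case (ty_Iota \<Gamma> M A) with ty_Iota.IH[OF ty_Iota.prems] show ?case by simp
next
  case (ty_conv \<Gamma> M A B) then show ?case by blast
qed simp_all

lemma subst_closed: "typing T [] M A \<Longrightarrow> subst \<sigma> M = M"
  using subst_cong[of T "[]" M A \<sigma> Var] by simp

lemma inst_single: "typing T [A] M B \<Longrightarrow> inst N M = subst (\<lambda>_. N) M"
  unfolding inst_eq by (rule subst_cong) auto

lemma inst_Var0_left: "typing T [A] M B \<Longrightarrow> inst (Var 0) M = M"
  using subst_cong[of T "[A]" M B "inst_sub (Var 0)" Var] by (simp add: inst_eq)

text \<open>The identity substitution, with each variable retyped by \<open>ty_conv\<close>, is a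
  substitution between the two contexts.\<close>

lemma typing_ctx_conv:
  assumes "typing T \<Gamma> M A" "wf_ctx T \<Delta>" "list_all2 (ty_eq T) \<Delta> \<Gamma>"
  shows "typing T \<Delta> M A"
proof -
  have "typing T \<Delta> (subst Var M) A"
  proof (rule typing_subst[OF assms(1,2)])
    fix i assume "i < length \<Gamma>"
    then show "typing T \<Delta> (Var i) (\<Gamma> ! i)"
      using assms(2,3) by (auto simp: list_all2_conv_all_nth intro: ty_conv[OF ty_Var])
  qed
  then show ?thesis by simp
qed

section \<open>Presuppositions and derived rules over a well-formed theory\<close>

locale theory_of = fixes T :: "('g, 'c) csc_thy" assumes thy: "csc_theory T"
begin

lemma ty_eq_wf: "ty_eq T A B \<Longrightarrow> wf_ty T A \<and> wf_ty T B"
  by (induction rule: ty_eq.induct) (use thy in \<open>auto simp: csc_theory_def\<close>)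

lemma ty_eq_wf1: "ty_eq T A B \<Longrightarrow> wf_ty T A" and ty_eq_wf2: "ty_eq T A B \<Longrightarrow> wf_ty T B"
  using ty_eq_wf by auto

lemma typing_wf_ty: "typing T \<Gamma> M A \<Longrightarrow> wf_ty T A"
  by (induction rule: typing.induct)
    (use thy in \<open>auto simp: csc_theory_def wf_ctx_nth dest: ty_eq_wf typing_wf_ctx\<close>)

lemma list_all2_ty_eq_refl: "wf_ctx T \<Gamma> \<Longrightarrow> list_all2 (ty_eq T) \<Gamma> \<Gamma>"
  by (induction \<Gamma>) (auto intro: teq_refl)

lemma typing_head_conv:
  assumes "typing T (A # \<Gamma>) M B" "ty_eq T A A'" shows "typing T (A' # \<Gamma>) M B"
  by (rule typing_ctx_conv[OF assms(1)])
    (use teq_sym[OF assms(2)] ty_eq_wf[OF assms(2)] typing_wf_ctx[OF assms(1)] list_all2_ty_eq_refl[of \<Gamma>] in simp_all)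

text \<open>The congruence rules take types from the left-hand annotations. The right-hand side is
  typed with its own annotations, after its parts have been converted, and the result is converted
  back. For axioms this is part of \<open>csc_theory\<close>.\<close>

lemma tm_eq_typing: "tm_eq T \<Gamma> M N A \<Longrightarrow> typing T \<Gamma> M A \<and> typing T \<Gamma> N A"
proof (induction rule: tm_eq.induct)
  case (eq_ax \<Gamma> M N A)
  then show ?case using thy by (auto simp: csc_theory_def)
next
  case (eq_subst \<Gamma> M N A \<Delta> \<sigma> \<tau>)
  have "typing T \<Delta> (subst \<sigma> M) A"
    by (rule typing_subst[of T \<Gamma>]) (use eq_subst in auto)
  moreover have "typing T \<Delta> (subst \<tau> N) A"
    by (rule typing_subst[of T \<Gamma>]) (use eq_subst in auto)
  ultimately show ?case ..
next
  case (eq_conv \<Gamma> M N A B)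
  then show ?case by (auto intro: ty_conv)
next
  case (eq_Lam A A' \<Gamma> M M' B)
  then have *: "typing T (A' # \<Gamma>) M' B" "ty_eq T B B"
    using typing_head_conv[of A \<Gamma> M' B A'] by (auto intro: teq_refl dest: typing_wf_ty)
  have "typing T \<Gamma> (Lam A' M') (TFun A B)"
    by (rule ty_conv[OF ty_Lam[OF *(1)] teq_Fun[OF teq_sym[OF eq_Lam(1)] *(2)]])
  with eq_Lam show ?case by (simp add: ty_Lam)
next
  case (eq_App A A' B B' \<Gamma> M M' N N')
  then have "typing T \<Gamma> M' (TFun A' B')" "typing T \<Gamma> N' A'"
    by (auto intro: ty_conv teq_Fun)
  from ty_conv[OF ty_App[OF this] teq_sym[OF eq_App(2)]] eq_App show ?case by (simp add: ty_App)
next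
  case (eq_Pi1 A A' B B' \<Gamma> M M')
  then have "typing T \<Gamma> M' (TProd A' B')" by (auto intro: ty_conv teq_Prod)
  from ty_conv[OF ty_Pi1[OF this] teq_sym[OF eq_Pi1(1)]] eq_Pi1 show ?case by (simp add: ty_Pi1)
next
  case (eq_Pi2 A A' B B' \<Gamma> M M')
  then have "typing T \<Gamma> M' (TProd A' B')" by (auto intro: ty_conv teq_Prod)
  from ty_conv[OF ty_Pi2[OF this] teq_sym[OF eq_Pi2(2)]] eq_Pi2 show ?case by (simp add: ty_Pi2)
next
  case (eq_Iota A A' \<Gamma> M M')
  then have "typing T \<Gamma> M' (TM SMon A')" by (auto intro: ty_conv teq_M)
  from ty_conv[OF ty_Iota[OF this] teq_M[OF teq_sym[OF eq_Iota(1)]]] eq_Iota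
  show ?case by (simp add: ty_Iota)
next
  case (eq_Do A A' B B' \<Gamma> M M' X N N')
  then have "typing T \<Gamma> M' (TM X A')" "typing T (A' # \<Gamma>) N' (TM X B')"
    using typing_head_conv[of A \<Gamma> N' "TM X B" A'] by (auto intro: ty_conv teq_M)
  from ty_conv[OF ty_Do[OF this] teq_M[OF teq_sym[OF eq_Do(2)]]] eq_Do
  show ?case by (simp add: ty_Do)
next
  case (eq_Fun_eta \<Gamma> M A B)
  then have "wf_ty T A" "wf_ctx T \<Gamma>" by (auto dest: typing_wf_ty typing_wf_ctx)
  with eq_Fun_eta show ?case by (auto intro!: ty_Lam ty_App typing_shift ty_Var0)
next
  case (eq_Do_assoc \<Gamma> M X A N B P C)
  have w: "wf_ty T A" "wf_ty T B" "wf_ctx T \<Gamma>"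
    using typing_wf_ctx[OF eq_Do_assoc(2)] typing_wf_ctx[OF eq_Do_assoc(3)] by auto
  have "typing T (B # A # \<Gamma>) (rename (up_ren Suc) P) (TM X C)"
    by (rule typing_rename[OF eq_Do_assoc(3)]) (use w in \<open>auto simp: nth_Cons split: nat.splits\<close>)
  with eq_Do_assoc show ?case by (auto intro: ty_Do)
next
  case (eq_centrality \<Gamma> M A N B P C)
  have w: "wf_ty T A" "wf_ty T B" "wf_ctx T \<Gamma>"
    using typing_wf_ctx[OF eq_centrality(3)] by auto
  have "typing T (A # B # \<Gamma>) (rename swap_ren P) (TM TMon C)"
    by (rule typing_rename[OF eq_centrality(3)])
      (use w in \<open>auto simp: nth_Cons swap_ren_def split: nat.splits\<close>)
  moreover have "typing T (B # \<Gamma>) (shift (Iota A M)) (TM TMon A)"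
    using eq_centrality w by (auto intro: typing_shift ty_Iota)
  ultimately show ?case
    using eq_centrality w by (auto intro!: ty_Do ty_Iota intro: typing_shift)
next
  case (eq_Do_right_unit \<Gamma> M X A)
  with typing_wf_ty[OF this] typing_wf_ctx[OF this] have "wf_ty T A" "wf_ctx T \<Gamma>" by simp_all
  with eq_Do_right_unit show ?case by (auto intro!: ty_Do ty_Ret ty_Var0)
next
  case eq_Fun_beta then show ?case by (simp add: ty_App ty_Lam typing_inst)
next
  case (eq_Do_left_unit \<Gamma> M A N X B)
  from typing_inst[OF this(2,1)] eq_Do_left_unit show ?case by (simp add: ty_Do ty_Ret)
next
  case (eq_One_eta \<Gamma> M)
  then show ?case by (simp add: ty_Star typing_wf_ctx[OF eq_One_eta])
next
  case (eq_trans \<Gamma> M N A P) then show ?case by simp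
next
  case eq_Prod_eta then show ?case by (simp add: ty_Pr ty_Pi1 ty_Pi2)
next
  case (eq_Iota_Do \<Gamma> M A N B) then show ?case by (simp add: ty_Iota ty_Do)
next
  case eq_refl then show ?case by simp
next
  case eq_sym then show ?case by simp
next
  case eq_Pr then show ?case by (simp add: ty_Pr)
next
  case eq_Ret then show ?case by (simp add: ty_Ret)
next
  case eq_Pi1_beta then show ?case by (simp add: ty_Pi1 ty_Pr)
next
  case eq_Pi2_beta then show ?case by (simp add: ty_Pi2 ty_Pr)
next
  case eq_Iota_inj then show ?case by simp
next
  case eq_Iota_Ret then show ?case by (simp add: ty_Iota ty_Ret)
qed

lemmas tm_eq_typing1 = tm_eq_typing[THEN conjunct1]
lemmas tm_eq_typing2 = tm_eq_typing[THEN conjunct2]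

lemma tm_eq_ctx_conv:
  assumes "tm_eq T \<Gamma> M N A" "wf_ctx T \<Delta>" "list_all2 (ty_eq T) \<Delta> \<Gamma>"
  shows "tm_eq T \<Delta> M N A"
proof -
  have "tm_eq T \<Delta> (subst Var M) (subst Var N) A"
  proof (rule eq_subst[OF assms(1,2)], intro allI impI)
    fix i assume "i < length \<Gamma>"
    then show "tm_eq T \<Delta> (Var i) (Var i) (\<Gamma> ! i)"
      using assms(2,3) by (auto simp: list_all2_conv_all_nth intro!: eq_refl intro: ty_conv[OF ty_Var])
  qed
  then show ?thesis by simp
qed

lemma tm_eq_head_conv:
  assumes "tm_eq T (A # \<Gamma>) M N B" "ty_eq T A A'" shows "tm_eq T (A' # \<Gamma>) M N B"
  by (rule tm_eq_ctx_conv[OF assms(1)])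
    (use teq_sym[OF assms(2)] ty_eq_wf[OF assms(2)] typing_wf_ctx[OF tm_eq_typing1[OF assms(1)]]
      list_all2_ty_eq_refl[of \<Gamma>] in simp_all)

lemma tm_eq_wf_ctx: "tm_eq T \<Gamma> M N A \<Longrightarrow> wf_ctx T \<Gamma>"
  by (rule typing_wf_ctx[OF tm_eq_typing1])

lemma tm_eq_subst_cong:
  assumes "typing T \<Gamma> M A" "wf_ctx T \<Delta>" "\<And>i. i < length \<Gamma> \<Longrightarrow> tm_eq T \<Delta> (\<sigma> i) (\<tau> i) (\<Gamma> ! i)"
  shows "tm_eq T \<Delta> (subst \<sigma> M) (subst \<tau> M) A"
  by (rule eq_subst[OF eq_refl[OF assms(1)] assms(2)]) (simp add: assms(3))

lemma tm_eq_subst: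
  assumes "tm_eq T \<Gamma> M N A" "wf_ctx T \<Delta>" "\<And>i. i < length \<Gamma> \<Longrightarrow> typing T \<Delta> (\<sigma> i) (\<Gamma> ! i)"
  shows "tm_eq T \<Delta> (subst \<sigma> M) (subst \<sigma> N) A"
  by (rule eq_subst[OF assms(1,2)]) (simp add: assms(3) eq_refl)

lemma tm_eq_shift:
  assumes "tm_eq T \<Gamma> M N A" "wf_ty T B" shows "tm_eq T (B # \<Gamma>) (shift M) (shift N) A"
  unfolding rename_eq_subst
proof (rule tm_eq_subst[OF assms(1)])
  show w: "wf_ctx T (B # \<Gamma>)" using assms tm_eq_wf_ctx by simp
  show "typing T (B # \<Gamma>) (Var (Suc i)) (\<Gamma> ! i)" if "i < length \<Gamma>" for i
    using ty_Var[OF w, of "Suc i"] that by simp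
qed

lemma tm_eq_inst1:
  assumes "tm_eq T [A] M M' B" "tm_eq T \<Gamma> N N' A"
  shows "tm_eq T \<Gamma> (inst N M) (inst N' M') B"
  unfolding inst_eq
  by (rule eq_subst[OF assms(1) tm_eq_wf_ctx[OF assms(2)]]) (simp add: assms(2))

end


section \<open>The operations of the syntactic model on representatives\<close>

context theory_of
begin

lemma eq_Var0: "wf_ctx T (A # \<Gamma>) \<Longrightarrow> tm_eq T (A # \<Gamma>) (Var 0) (Var 0) A"
  by (rule eq_refl[OF ty_Var0])

lemma eq_Var1: "wf_ctx T (B # A # \<Gamma>) \<Longrightarrow> tm_eq T (B # A # \<Gamma>) (Var (Suc 0)) (Var (Suc 0)) A"
  by (rule eq_refl[OF ty_Var1])

lemma eq_Star: "wf_ctx T \<Gamma> \<Longrightarrow> tm_eq T \<Gamma> Star Star TOne"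
  by (rule eq_refl[OF ty_Star])

lemmas tm_congs = eq_Var0 eq_Var1 eq_Star eq_Lam eq_App eq_Pr eq_Pi1 eq_Pi2 eq_Ret eq_Iota eq_Do
lemmas ty_congs = teq_Fun teq_Prod teq_M

lemma typing_extend: "typing T [A] M B \<Longrightarrow> wf_ctx T (A # \<Gamma>) \<Longrightarrow> typing T (A # \<Gamma>) M B"
  using typing_subst[of T "[A]" M B "A # \<Gamma>" Var] by (simp add: ty_Var0)

lemma tm_eq_extend: "tm_eq T [A] M N B \<Longrightarrow> wf_ctx T (A # \<Gamma>) \<Longrightarrow> tm_eq T (A # \<Gamma>) M N B"
  using tm_eq_subst[of "[A]" M N B "A # \<Gamma>" Var] by (simp add: ty_Var0)

section \<open>Classes of types and of judgements, and unions over them\<close>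

lemma mem_ty_class: "A' \<in> ty_class T A \<longleftrightarrow> ty_eq T A A'"
  by (simp add: ty_class_def)

lemma ty_class_eqI: "ty_eq T A B \<Longrightarrow> ty_class T A = ty_class T B"
  unfolding ty_class_def by (blast intro: teq_sym teq_trans)

lemma ty_class_eq_iff:
  assumes "wf_ty T A" shows "ty_class T A = ty_class T B \<longleftrightarrow> ty_eq T A B"
proof
  assume "ty_class T A = ty_class T B"
  with teq_refl[OF assms] have "A \<in> ty_class T B" by (simp add: mem_ty_class[symmetric])
  then show "ty_eq T A B" by (simp add: mem_ty_class teq_sym)
qed (rule ty_class_eqI)

text \<open>A union of a constant family over a nonempty set is its value. This evaluates an
  operation of \<open>syn_model\<close>, written as a union over all representatives, at any one of
  them.\<close>

lemma UN_ty_class: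
  assumes "wf_ty T A" "\<And>A'. ty_eq T A A' \<Longrightarrow> f A' = f A"
  shows "(\<Union>A'\<in>ty_class T A. f A') = f A"
proof (rule UN_constant_eq[of A])
  show "A \<in> ty_class T A" by (simp add: mem_ty_class teq_refl assms(1))
  show "\<forall>A'\<in>ty_class T A. f A' = f A" unfolding mem_ty_class Ball_def using assms(2) by blast
qed

lemma UN_ty_class2:
  assumes "wf_ty T A" "wf_ty T B" "\<And>A' B'. ty_eq T A A' \<Longrightarrow> ty_eq T B B' \<Longrightarrow> f A' B' = f A B"
  shows "(\<Union>A'\<in>ty_class T A. \<Union>B'\<in>ty_class T B. f A' B') = f A B"
proof -
  have "(\<Union>B'\<in>ty_class T B. f A' B') = f A B" if "ty_eq T A A'" for A'
  proof (rule UN_constant_eq[of B])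
    show "B \<in> ty_class T B" by (simp add: mem_ty_class teq_refl assms(2))
    show "\<forall>B'\<in>ty_class T B. f A' B' = f A B"
      unfolding mem_ty_class Ball_def using assms(3)[OF that] by blast
  qed
  then show ?thesis
    by (intro UN_constant_eq[of A]) (use teq_refl[OF assms(1)] in \<open>simp_all add: mem_ty_class\<close>)
qed

lemma jdg_class_eqI:
  assumes "ty_eq T A A'" "ty_eq T B B'" "tm_eq T [A] M M' B"
  shows "jdg_class T A M B = jdg_class T A' M' B'"
proof -
  have "tm_eq T [A'] M' P B' \<longleftrightarrow> tm_eq T [A] M P B" for P
  proof
    assume "tm_eq T [A'] M' P B'"
    from eq_conv[OF tm_eq_head_conv[OF this teq_sym[OF assms(1)]] teq_sym[OF assms(2)]]
    show "tm_eq T [A] M P B" by (rule eq_trans[OF assms(3)])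
  next
    assume "tm_eq T [A] M P B"
    from tm_eq_head_conv[OF eq_conv[OF eq_trans[OF eq_sym[OF assms(3)] this] assms(2)] assms(1)]
    show "tm_eq T [A'] M' P B'" .
  qed
  moreover have "ty_eq T A P \<longleftrightarrow> ty_eq T A' P" "ty_eq T B P \<longleftrightarrow> ty_eq T B' P" for P
    using assms(1,2) by (blast intro: teq_sym teq_trans)+
  ultimately show ?thesis by (simp add: jdg_class_def)
qed

lemma mem_jdg_class:
  "(A', M', B') \<in> jdg_class T A M B \<longleftrightarrow> ty_eq T A A' \<and> ty_eq T B B' \<and> tm_eq T [A] M M' B"
  by (simp add: jdg_class_def)

lemma jdg_class_self: "typing T [A] M B \<Longrightarrow> (A, M, B) \<in> jdg_class T A M B"
  using typing_wf_ctx[of T "[A]" M B] typing_wf_ty[of "[A]" M B]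
  by (simp add: jdg_class_def teq_refl eq_refl)

lemma jdg_class_eqD:
  assumes "typing T [A] M B" "jdg_class T A' M' B' = jdg_class T A M B"
  shows "ty_eq T A' A" "ty_eq T B' B" "tm_eq T [A'] M' M B'"
  using jdg_class_self[OF assms(1)] assms(2)[symmetric] by (auto simp: jdg_class_def)

lemma UN_jdg_class:
  assumes "typing T [A] M B"
    "\<And>A' M' B'. ty_eq T A A' \<Longrightarrow> ty_eq T B B' \<Longrightarrow> tm_eq T [A] M M' B \<Longrightarrow> f A' M' B' = f A M B"
  shows "(\<Union>(A', M', B')\<in>jdg_class T A M B. f A' M' B') = f A M B"
proof -
  have "(case p of (A', M', B') \<Rightarrow> f A' M' B') = f A M B" if "p \<in> jdg_class T A M B" for p
    using that assms(2) by (auto simp: jdg_class_def)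
  with jdg_class_self[OF assms(1)] show ?thesis by (intro UN_constant_eq) auto
qed

section \<open>Evaluation of the structure of the syntactic model\<close>

lemma syn_Dom: "typing T [A] M B \<Longrightarrow> Dom (syn_model T) (jdg_class T A M B) = ty_class T A"
  by (simp add: syn_model_def) (rule UN_jdg_class, auto dest: ty_class_eqI)

lemma syn_Cod: "typing T [A] M B \<Longrightarrow> Cod (syn_model T) (jdg_class T A M B) = ty_class T B"
  by (simp add: syn_model_def) (rule UN_jdg_class, auto dest: ty_class_eqI)

lemma syn_Ident: "wf_ty T A \<Longrightarrow> Ident (syn_model T) (ty_class T A) = jdg_class T A (Var 0) A"
  by (simp add: syn_model_def)
    (rule UN_ty_class, assumption, rule jdg_class_eqI[symmetric], auto intro!: tm_congs)

lemma UN_jdg_class2: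
  assumes "typing T [A] M B" "typing T [C] N D"
    "\<And>A' M' B' C' N' D'. ty_eq T A A' \<Longrightarrow> ty_eq T B B' \<Longrightarrow> tm_eq T [A] M M' B \<Longrightarrow>
       ty_eq T C C' \<Longrightarrow> ty_eq T D D' \<Longrightarrow> tm_eq T [C] N N' D \<Longrightarrow> f A' M' B' C' N' D' = f A M B C N D"
  shows "(\<Union>(A', M', B')\<in>jdg_class T A M B. \<Union>(C', N', D')\<in>jdg_class T C N D. f A' M' B' C' N' D')
     = f A M B C N D"
proof -
  have *: "(\<Union>(C', N', D')\<in>jdg_class T C N D. f A' M' B' C' N' D') = f A M B C N D"
    if "ty_eq T A A'" "ty_eq T B B'" "tm_eq T [A] M M' B" for A' M' B'
    by (rule UN_constant_eq[OF jdg_class_self[OF assms(2)]])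
      (auto simp: jdg_class_def assms(3)[OF that])
  show ?thesis
  proof (rule UN_constant_eq[OF jdg_class_self[OF assms(1)]], intro ballI)
    fix p assume "p \<in> jdg_class T A M B"
    then show "(case p of (A', M', B') \<Rightarrow>
        \<Union>(C', N', D')\<in>jdg_class T C N D. f A' M' B' C' N' D') = f A M B C N D"
      by (cases p) (simp only: mem_jdg_class prod.case *)
  qed
qed

lemma syn_Comp:
  assumes "typing T [A] M B" "typing T [B] N C"
  shows "Comp (syn_model T) (jdg_class T B N C) (jdg_class T A M B) = jdg_class T A (inst M N) C"
  unfolding syn_model_def cat.simps
  by (rule UN_jdg_class2[OF assms]) (rule jdg_class_eqI[symmetric], auto intro: tm_eq_inst1)

lemma syn_One: "One (syn_model T) = ty_class T TOne"
  by (simp add: syn_model_def)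

lemma syn_Bang: "wf_ty T A \<Longrightarrow> Bang (syn_model T) (ty_class T A) = jdg_class T A Star TOne"
  by (simp add: syn_model_def)
    (rule UN_ty_class, assumption, rule jdg_class_eqI[symmetric], auto intro!: tm_congs teq_refl)

lemma syn_Prod: "wf_ty T A \<Longrightarrow> wf_ty T B \<Longrightarrow>
    Prod (syn_model T) (ty_class T A) (ty_class T B) = ty_class T (TProd A B)"
  by (simp add: syn_model_def)
    (rule UN_ty_class2, assumption+, rule ty_class_eqI[symmetric], auto intro!: ty_congs)

lemma syn_Exp: "wf_ty T A \<Longrightarrow> wf_ty T B \<Longrightarrow>
    Exp (syn_model T) (ty_class T A) (ty_class T B) = ty_class T (TFun A B)"
  by (simp add: syn_model_def)
    (rule UN_ty_class2, assumption+, rule ty_class_eqI[symmetric], auto intro!: ty_congs)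

lemma syn_MObj: "wf_ty T A \<Longrightarrow>
    MObj (mon (syn_model T) X) (ty_class T A) = ty_class T (TM X A)"
  by (simp add: syn_model_def syn_monad_def)
    (rule UN_ty_class, assumption, rule ty_class_eqI[symmetric], auto intro!: ty_congs)

lemma syn_Fst: "wf_ty T A \<Longrightarrow> wf_ty T B \<Longrightarrow>
    Fst (syn_model T) (ty_class T A) (ty_class T B) = jdg_class T (TProd A B) (Pi1 A B (Var 0)) A"
  by (simp add: syn_model_def)
    (rule UN_ty_class2, assumption+, rule jdg_class_eqI[symmetric], auto intro!: ty_congs tm_congs)

lemma syn_Snd: "wf_ty T A \<Longrightarrow> wf_ty T B \<Longrightarrow>
    Snd (syn_model T) (ty_class T A) (ty_class T B) = jdg_class T (TProd A B) (Pi2 A B (Var 0)) B"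
  by (simp add: syn_model_def)
    (rule UN_ty_class2, assumption+, rule jdg_class_eqI[symmetric], auto intro!: ty_congs tm_congs)

lemma syn_Ev: "wf_ty T A \<Longrightarrow> wf_ty T B \<Longrightarrow>
    Ev (syn_model T) (ty_class T A) (ty_class T B) = jdg_class T (TProd (TFun A B) A)
      (App A B (Pi1 (TFun A B) A (Var 0)) (Pi2 (TFun A B) A (Var 0))) B"
  by (simp add: syn_model_def)
    (rule UN_ty_class2, assumption+, rule jdg_class_eqI[symmetric], auto intro!: ty_congs tm_congs)

lemma syn_Tuple:
  assumes "typing T [A] M B" "typing T [A] N C"
  shows "Tuple (syn_model T) (jdg_class T A M B) (jdg_class T A N C) = jdg_class T A (Pr M N) (TProd B C)"
  unfolding syn_model_def ccc.simps
  by (rule UN_jdg_class2[OF assms]) (rule jdg_class_eqI[symmetric], auto intro!: tm_congs ty_congs)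

lemma syn_Curry:
  assumes "typing T [TProd X A] M B" "wf_ty T X" "wf_ty T A"
  shows "Curry (syn_model T) (ty_class T X) (ty_class T A) (jdg_class T (TProd X A) M B) =
    jdg_class T X (Lam A (inst (Pr (Var 1) (Var 0)) M)) (TFun A B)"
proof -
  have eq: "jdg_class T X' (Lam A' (inst (Pr (Var 1) (Var 0)) M')) (TFun A' B') =
      jdg_class T X (Lam A (inst (Pr (Var 1) (Var 0)) M)) (TFun A B)"
    if "ty_eq T X X'" "ty_eq T A A'" "ty_eq T B B'" "tm_eq T [TProd X A] M M' B" for X' A' B' M'
    using that assms(2,3)
    by (intro jdg_class_eqI[symmetric] ty_congs eq_Lam tm_eq_inst1[OF that(4)])
      (auto intro!: tm_congs)
  \<comment> \<open>The representatives \<open>X'\<close> and \<open>A'\<close> are chosen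
    separately from \<open>D'\<close>, which is only provably equal to \<open>TProd X A\<close>.
    Hence the union over judgements is collapsed first, for fixed \<open>X'\<close> and
    \<open>A'\<close>.\<close>
  have "(\<Union>(D', M', B')\<in>jdg_class T (TProd X A) M B.
          jdg_class T X' (Lam A' (inst (Pr (Var 1) (Var 0)) M')) (TFun A' B')) =
      jdg_class T X (Lam A (inst (Pr (Var 1) (Var 0)) M)) (TFun A B)"
    if "ty_eq T X X'" "ty_eq T A A'" for X' A'
  proof -
    have "typing T [TProd X A] M B \<Longrightarrow> ty_eq T B B" by (blast intro: teq_refl typing_wf_ty)
    with UN_jdg_class[OF assms(1), of "\<lambda>D' M' B'. jdg_class T X' (Lam A' (inst (Pr (Var 1) (Var 0)) M')) (TFun A' B')"]
    show ?thesis using eq[OF that] assms(1) by (simp add: eq_refl)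
  qed
  then show ?thesis
    unfolding syn_model_def ccc.simps
    by (subst UN_ty_class2[OF assms(2,3)]) (simp_all add: teq_refl assms(2,3))
qed

lemma syn_Unit: "wf_ty T A \<Longrightarrow>
    Unit (mon (syn_model T) X) (ty_class T A) = jdg_class T A (Ret X (Var 0)) (TM X A)"
  by (simp add: syn_model_def syn_monad_def)
    (rule UN_ty_class, assumption, rule jdg_class_eqI[symmetric], auto intro!: ty_congs tm_congs)

lemma syn_Mult: "wf_ty T A \<Longrightarrow>
    Mult (mon (syn_model T) X) (ty_class T A) =
    jdg_class T (TM X (TM X A)) (Do X (TM X A) A (Var 0) (Var 0)) (TM X A)"
  by (simp add: syn_model_def syn_monad_def)
    (rule UN_ty_class, assumption, rule jdg_class_eqI[symmetric], auto intro!: ty_congs tm_congs)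

lemma syn_Str: "wf_ty T A \<Longrightarrow> wf_ty T B \<Longrightarrow>
    Str (mon (syn_model T) X) (ty_class T A) (ty_class T B) =
      jdg_class T (TProd A (TM X B))
         (Do X B (TProd A B) (Pi2 A (TM X B) (Var 0))
            (Ret X (Pr (Pi1 A (TM X B) (Var (Suc 0))) (Var 0))))
         (TM X (TProd A B))"
  by (simp add: syn_model_def syn_monad_def)
    (rule UN_ty_class2, assumption+, rule jdg_class_eqI[symmetric], auto intro!: ty_congs tm_congs)

lemma syn_iota: "wf_ty T A \<Longrightarrow>
    iota (syn_model T) (ty_class T A) = jdg_class T (TM SMon A) (Iota A (Var 0)) (TM TMon A)"
  by (simp add: syn_model_def)
    (rule UN_ty_class, assumption, rule jdg_class_eqI[symmetric], auto intro!: ty_congs tm_congs)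

lemma syn_MArr:
  assumes "typing T [A] M B"
  shows "MArr (mon (syn_model T) X) (jdg_class T A M B) =
    jdg_class T (TM X A) (Do X A B (Var 0) (Ret X M)) (TM X B)"
  using typing_wf_ctx[OF assms]
  unfolding syn_model_def syn_monad_def csc_structure.simps monad.simps
  by (intro UN_jdg_class[OF assms])
    (rule jdg_class_eqI[symmetric], auto intro!: tm_congs ty_congs intro: tm_eq_extend)
end


section \<open>Translations induced by an assignment on ground types and constants\<close>

primrec bty :: "('g \<Rightarrow> 'h ty) \<Rightarrow> 'g ty \<Rightarrow> 'h ty" where
  "bty \<phi> (Ground g) = \<phi> g"
| "bty \<phi> TOne = TOne"
| "bty \<phi> (TFun A B) = TFun (bty \<phi> A) (bty \<phi> B)"
| "bty \<phi> (TProd A B) = TProd (bty \<phi> A) (bty \<phi> B)"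
| "bty \<phi> (TM X A) = TM X (bty \<phi> A)"

primrec btm :: "('g \<Rightarrow> 'h ty) \<Rightarrow> ('c \<Rightarrow> ('h, 'd) tm) \<Rightarrow> ('g, 'c) tm \<Rightarrow> ('h, 'd) tm" where
  "btm \<phi> \<kappa> (Var i) = Var i"
| "btm \<phi> \<kappa> (Const c) = \<kappa> c"
| "btm \<phi> \<kappa> Star = Star"
| "btm \<phi> \<kappa> (Lam A M) = Lam (bty \<phi> A) (btm \<phi> \<kappa> M)"
| "btm \<phi> \<kappa> (App A B M N) = App (bty \<phi> A) (bty \<phi> B) (btm \<phi> \<kappa> M) (btm \<phi> \<kappa> N)"
| "btm \<phi> \<kappa> (Pr M N) = Pr (btm \<phi> \<kappa> M) (btm \<phi> \<kappa> N)"
| "btm \<phi> \<kappa> (Pi1 A B M) = Pi1 (bty \<phi> A) (bty \<phi> B) (btm \<phi> \<kappa> M)"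
| "btm \<phi> \<kappa> (Pi2 A B M) = Pi2 (bty \<phi> A) (bty \<phi> B) (btm \<phi> \<kappa> M)"
| "btm \<phi> \<kappa> (Ret X M) = Ret X (btm \<phi> \<kappa> M)"
| "btm \<phi> \<kappa> (Iota A M) = Iota (bty \<phi> A) (btm \<phi> \<kappa> M)"
| "btm \<phi> \<kappa> (Do X A B M N) = Do X (bty \<phi> A) (bty \<phi> B) (btm \<phi> \<kappa> M) (btm \<phi> \<kappa> N)"

lemma bty_bty: "bty \<phi> (bty \<psi> A) = bty (\<lambda>g. bty \<phi> (\<psi> g)) A"
  by (induction A) simp_all

lemma btm_btm: "btm \<phi> \<kappa> (btm \<psi> \<kappa>' M) = btm (\<lambda>g. bty \<phi> (\<psi> g)) (\<lambda>c. btm \<phi> \<kappa> (\<kappa>' c)) M"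
  by (induction M) (simp_all add: bty_bty)

text \<open>\<open>kappa_closed\<close> is asked of every \<open>c\<close>, because
  \<open>btm_rename\<close> and \<open>btm_subst\<close> are equations between raw terms. Term
  axioms are left to the hypothesis of \<open>translation\<close>: typing does not depend on them,
  and \<open>typing_btm\<close> is needed to verify them.\<close>

locale sig_morphism =
  T: theory_of T + T': theory_of T' for T :: "('g, 'c) csc_thy" and T' :: "('h, 'd) csc_thy" +
  fixes \<phi> :: "'g \<Rightarrow> 'h ty" and \<kappa> :: "'c \<Rightarrow> ('h, 'd) tm"
  assumes wf_phi: "g \<in> grounds T \<Longrightarrow> wf_ty T' (\<phi> g)"
    and kappa_closed: "subst \<sigma> (\<kappa> c) = \<kappa> c"
    and kappa_typing: "c \<in> consts_of T \<Longrightarrow> typing T' [] (\<kappa> c) (bty \<phi> (const_ty T c))"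
    and ty_axioms_bty: "(A, B) \<in> ty_axioms T \<Longrightarrow> ty_eq T' (bty \<phi> A) (bty \<phi> B)"
begin

lemma kappa_rename: "rename r (\<kappa> c) = \<kappa> c"
  by (simp add: rename_eq_subst kappa_closed)

lemma btm_rename: "btm \<phi> \<kappa> (rename r M) = rename r (btm \<phi> \<kappa> M)"
  by (induction M arbitrary: r) (simp_all add: kappa_rename)

lemma btm_subst: "btm \<phi> \<kappa> (subst \<sigma> M) = subst (\<lambda>i. btm \<phi> \<kappa> (\<sigma> i)) (btm \<phi> \<kappa> M)"
proof (induction M arbitrary: \<sigma>)
  have *: "(\<lambda>i. btm \<phi> \<kappa> (up_sub \<sigma> i)) = up_sub (\<lambda>i. btm \<phi> \<kappa> (\<sigma> i))" for \<sigma>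
  proof
    fix i show "btm \<phi> \<kappa> (up_sub \<sigma> i) = up_sub (\<lambda>i. btm \<phi> \<kappa> (\<sigma> i)) i"
      by (cases i) (simp_all add: btm_rename)
  qed
  { case Lam then show ?case by (simp add: *)
  next case Do then show ?case by (simp add: *) }
qed (simp_all add: kappa_closed)

lemma btm_inst: "btm \<phi> \<kappa> (inst N M) = inst (btm \<phi> \<kappa> N) (btm \<phi> \<kappa> M)"
proof -
  have "(\<lambda>i. btm \<phi> \<kappa> (inst_sub N i)) = inst_sub (btm \<phi> \<kappa> N)"
  proof
    fix i show "btm \<phi> \<kappa> (inst_sub N i) = inst_sub (btm \<phi> \<kappa> N) i" by (cases i) simp_all
  qed
  then show ?thesis by (simp add: inst_eq btm_subst)
qed

lemma wf_bty: "wf_ty T A \<Longrightarrow> wf_ty T' (bty \<phi> A)"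
  by (induction A) (auto intro: wf_phi)

lemma wf_ctx_bty: "wf_ctx T \<Gamma> \<Longrightarrow> wf_ctx T' (map (bty \<phi>) \<Gamma>)"
  by (auto simp: wf_ctx_def wf_bty)

lemma ty_eq_bty: "ty_eq T A B \<Longrightarrow> ty_eq T' (bty \<phi> A) (bty \<phi> B)"
proof (induction rule: ty_eq.induct)
  case teq_sym show ?case by (rule ty_eq.teq_sym[OF teq_sym.IH])
next
  case teq_trans show ?case by (rule ty_eq.teq_trans[OF teq_trans.IH])
qed (simp_all add: ty_axioms_bty teq_refl wf_bty teq_Fun teq_Prod teq_M)

lemma typing_btm: "typing T \<Gamma> M A \<Longrightarrow> typing T' (map (bty \<phi>) \<Gamma>) (btm \<phi> \<kappa> M) (bty \<phi> A)"
proof (induction rule: typing.induct)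
  case (ty_Var \<Gamma> i)
  then show ?case using typing.ty_Var[of T' "map (bty \<phi>) \<Gamma>" i] by (simp add: wf_ctx_bty)
next
  case (ty_Const \<Gamma> c)
  then show ?case
    using typing_subst[OF kappa_typing, of c "map (bty \<phi>) \<Gamma>" Var] by (simp add: wf_ctx_bty)
next
  case ty_conv then show ?case by (blast intro: typing.ty_conv ty_eq_bty)
qed (auto simp: wf_ctx_bty intro!: typing_rules)

text \<open>All rules except \<open>eq_ax\<close> are preserved because \<open>btm\<close> commutes
  with the formers, with renaming and with substitution.\<close>

lemma translation:
  assumes ax: "\<And>\<Gamma> M N A. (\<Gamma>, M, N, A) \<in> tm_axioms T \<Longrightarrow>
      tm_eq T' (map (bty \<phi>) \<Gamma>) (btm \<phi> \<kappa> M) (btm \<phi> \<kappa> N) (bty \<phi> A)"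
  shows "csc_translation T T' \<lparr>trTy = bty \<phi>, trTm = btm \<phi> \<kappa>\<rparr>"
proof -
  have "tm_eq T' (map (bty \<phi>) \<Gamma>) (btm \<phi> \<kappa> M) (btm \<phi> \<kappa> N) (bty \<phi> A)" if "tm_eq T \<Gamma> M N A" for \<Gamma> M N A
    using that
  proof (induction rule: tm_eq.induct)
    case eq_ax then show ?case by (rule ax)
  next
    case eq_refl then show ?case by (intro tm_eq.eq_refl typing_btm)
  next
    case eq_sym show ?case by (rule tm_eq.eq_sym[OF eq_sym.IH])
  next
    case eq_trans show ?case by (rule tm_eq.eq_trans[OF eq_trans.IH])
  next
    case (eq_conv \<Gamma> M N A B) show ?case by (rule tm_eq.eq_conv[OF eq_conv.IH ty_eq_bty[OF eq_conv.hyps(2)]])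
  next
    case (eq_subst \<Gamma> M N A \<Delta> \<sigma> \<tau>)
    show ?case unfolding btm_subst
      by (rule tm_eq.eq_subst[OF eq_subst.IH(1)]) (use eq_subst in \<open>simp_all add: wf_ctx_bty\<close>)
  next
    case (eq_Lam A A' \<Gamma> M M' B)
    then show ?case using tm_eq.eq_Lam[OF ty_eq_bty] by simp
  next
    case (eq_App A A' B B' \<Gamma> M M' N N')
    then show ?case using tm_eq.eq_App[OF ty_eq_bty ty_eq_bty] by simp
  next
    case eq_Pr then show ?case by (simp add: tm_eq.eq_Pr)
  next
    case (eq_Pi1 A A' B B' \<Gamma> M M')
    then show ?case using tm_eq.eq_Pi1[OF ty_eq_bty ty_eq_bty] by simp
  next
    case (eq_Pi2 A A' B B' \<Gamma> M M')
    then show ?case using tm_eq.eq_Pi2[OF ty_eq_bty ty_eq_bty] by simp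
  next
    case eq_Ret then show ?case by (simp add: tm_eq.eq_Ret)
  next
    case (eq_Iota A A' \<Gamma> M M')
    then show ?case using tm_eq.eq_Iota[OF ty_eq_bty] by simp
  next
    case (eq_Do A A' B B' \<Gamma> M M' X N N')
    then show ?case using tm_eq.eq_Do[OF ty_eq_bty ty_eq_bty] by simp
  next
    case (eq_One_eta \<Gamma> M)
    from tm_eq.eq_One_eta[OF this[THEN typing_btm, simplified]] show ?case by simp
  next
    case (eq_Pi1_beta \<Gamma> M A N B)
    from tm_eq.eq_Pi1_beta[OF this[THEN typing_btm]] show ?case by simp
  next
    case (eq_Pi2_beta \<Gamma> M A N B)
    from tm_eq.eq_Pi2_beta[OF this[THEN typing_btm]] show ?case by simp
  next
    case (eq_Prod_eta \<Gamma> M A B)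
    from tm_eq.eq_Prod_eta[OF this[THEN typing_btm, simplified]] show ?case by simp
  next
    case (eq_Fun_beta A \<Gamma> M B N)
    from tm_eq.eq_Fun_beta[OF this[THEN typing_btm, simplified]] show ?case by (simp add: btm_inst)
  next
    case (eq_Fun_eta \<Gamma> M A B)
    from tm_eq.eq_Fun_eta[OF this[THEN typing_btm, simplified]] show ?case by (simp add: btm_rename)
  next
    case (eq_Do_left_unit \<Gamma> M A N X B)
    from tm_eq.eq_Do_left_unit[OF this[THEN typing_btm, simplified]] show ?case by (simp add: btm_inst)
  next
    case (eq_Do_right_unit \<Gamma> M X A)
    from tm_eq.eq_Do_right_unit[OF this[THEN typing_btm, simplified]] show ?case by simp
  next
    case (eq_Do_assoc \<Gamma> M X A N B P C)
    from tm_eq.eq_Do_assoc[OF this[THEN typing_btm, simplified]] show ?case by (simp add: btm_rename)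
  next
    case (eq_centrality \<Gamma> M A N B P C)
    from tm_eq.eq_centrality[OF this[THEN typing_btm, simplified]] show ?case by (simp add: btm_rename)
  next
    case (eq_Iota_inj \<Gamma> A M N)
    from tm_eq.eq_Iota_inj[OF eq_Iota_inj.IH[simplified] eq_Iota_inj.hyps(2,3)[THEN typing_btm, simplified]]
    show ?case by simp
  next
    case (eq_Iota_Do \<Gamma> M A N B)
    from tm_eq.eq_Iota_Do[OF this[THEN typing_btm, simplified]] show ?case by simp
  next
    case (eq_Iota_Ret \<Gamma> M A)
    from tm_eq.eq_Iota_Ret[OF this[THEN typing_btm, simplified]] show ?case by simp
  qed
  then show ?thesis
    by unfold_locales (simp_all add: T.thy T'.thy wf_bty ty_eq_bty typing_btm)
qed

end

context theory_of
begin

text \<open>For the round trip from \<open>T\<close> to \<open>LS\<close> and back, the identity is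
  verified on generators only; congruence and conversion extend it, here to types and below to
  terms.\<close>

lemma bty_near_identity:
  assumes "\<And>g. g \<in> grounds T \<Longrightarrow> ty_eq T (\<phi> g) (Ground g)"
  shows "wf_ty T A \<Longrightarrow> ty_eq T (bty \<phi> A) A"
  by (induction A) (auto intro: assms teq_refl ty_congs)

lemma btm_near_identity:
  assumes phi: "\<And>g. g \<in> grounds T \<Longrightarrow> ty_eq T (\<phi> g) (Ground g)"
    and kappa: "\<And>c. c \<in> consts_of T \<Longrightarrow> tm_eq T [] (\<kappa> c) (Const c) (const_ty T c)"
  shows "typing T \<Gamma> M A \<Longrightarrow> tm_eq T \<Gamma> (btm \<phi> \<kappa> M) M A"
proof -
  have ty: "ty_eq T (bty \<phi> A) A" if "wf_ty T A" for A
    by (rule bty_near_identity[OF phi that])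
  show "tm_eq T \<Gamma> (btm \<phi> \<kappa> M) M A" if "typing T \<Gamma> M A"
    using that
  proof (induction rule: typing.induct)
    case (ty_Var \<Gamma> i) then show ?case by (simp add: eq_refl typing.ty_Var)
  next
    case (ty_Const \<Gamma> c)
    have "tm_eq T \<Gamma> (subst Var (\<kappa> c)) (subst Var (Const c)) (const_ty T c)"
      by (rule tm_eq_subst[OF kappa]) (use ty_Const in auto)
    then show ?case by simp
  next
    case ty_Star then show ?case by (simp add: eq_Star)
  next
    case (ty_Lam A \<Gamma> M B)
    then have w: "wf_ty T A" using typing_wf_ctx by fastforce
    \<comment> \<open>The congruence rule takes the context of the body and the type from the
      left-hand annotation, so the equation is derived starting from the original term and then
      reversed. The other annotated formers are treated in the same way.\<close>
    have "tm_eq T \<Gamma> (Lam A M) (Lam (bty \<phi> A) (btm \<phi> \<kappa> M)) (TFun A B)"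
      by (rule eq_Lam[OF teq_sym[OF ty[OF w]] eq_sym[OF ty_Lam.IH]])
    then show ?case by (simp add: eq_sym)
  next
    case (ty_App \<Gamma> M A B N)
    then have w: "ty_eq T A (bty \<phi> A)" "ty_eq T B (bty \<phi> B)"
      using typing_wf_ty by (fastforce intro: teq_sym[OF ty])+
    from eq_App[OF this ty_App.IH[THEN eq_sym]] show ?case by (simp add: eq_sym)
  next
    case ty_Pr then show ?case by (simp add: eq_Pr)
  next
    case (ty_Pi1 \<Gamma> M A B)
    then have w: "ty_eq T A (bty \<phi> A)" "ty_eq T B (bty \<phi> B)"
      using typing_wf_ty by (fastforce intro: teq_sym[OF ty])+
    from eq_Pi1[OF this ty_Pi1.IH[THEN eq_sym]] show ?case by (simp add: eq_sym)
  next
    case (ty_Pi2 \<Gamma> M A B)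
    then have w: "ty_eq T A (bty \<phi> A)" "ty_eq T B (bty \<phi> B)"
      using typing_wf_ty by (fastforce intro: teq_sym[OF ty])+
    from eq_Pi2[OF this ty_Pi2.IH[THEN eq_sym]] show ?case by (simp add: eq_sym)
  next
    case ty_Ret then show ?case by (simp add: eq_Ret)
  next
    case (ty_Iota \<Gamma> M A)
    then have w: "ty_eq T A (bty \<phi> A)"
      using typing_wf_ty by (fastforce intro: teq_sym[OF ty])+
    from eq_Iota[OF this ty_Iota.IH[THEN eq_sym]] show ?case by (simp add: eq_sym)
  next
    case (ty_Do \<Gamma> M X A N B)
    then have w: "ty_eq T A (bty \<phi> A)" "ty_eq T B (bty \<phi> B)"
      using typing_wf_ty by (fastforce intro: teq_sym[OF ty])+
    from eq_Do[OF this ty_Do.IH[THEN eq_sym]] show ?case by (simp add: eq_sym)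
  next
    case (ty_conv \<Gamma> M A B) show ?case by (rule eq_conv[OF ty_conv.IH ty_conv.hyps(2)])
  qed
qed

text \<open>Since \<open>trTy U A\<close> and \<open>A\<close> are equal types, the variable itself
  is a judgement from either to the other, and it is its own inverse. Naturality then says only that
  \<open>trTm U f\<close> and \<open>f\<close> are provably equal.\<close>

lemma identity_transformation:
  assumes tr: "csc_translation T T U"
    and ty: "\<And>A. wf_ty T A \<Longrightarrow> ty_eq T (trTy U A) A"
    and tm: "\<And>\<Gamma> M A. typing T \<Gamma> M A \<Longrightarrow> tm_eq T \<Gamma> (trTm U M) M A"
  shows "invertible_transformation T T U tr_id (\<lambda>_. Var 0)"
    and "invertible_transformation T T tr_id U (\<lambda>_. Var 0)"
proof -
  have id: "csc_translation T T tr_id"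
    by unfold_locales (simp_all add: tr_id_def thy)
  have v: "typing T [A] (Var 0) B" "tm_eq T [A] (Var 0) (Var 0) B" if "ty_eq T A B" for A B
    using ty_conv[OF ty_Var0 that] ty_eq_wf[OF that] by (auto intro: eq_refl)
  have tm': "tm_eq T [A'] (trTm U M) M B'" "typing T [A'] (trTm U M) B'"
    if "typing T [A] M B" "ty_eq T A A'" "ty_eq T B B'" for A M B A' B'
    using eq_conv[OF tm_eq_head_conv[OF tm[OF that(1)] that(2)] that(3)]
    by (auto intro: tm_eq_typing1)
  have nat: "tm_eq T [A'] (trTm U M) (inst (Var 0) M) B'" "tm_eq T [A'] M (inst (Var 0) (trTm U M)) B'"
    if "typing T [A] M B" "ty_eq T A A'" "ty_eq T B B'" for A M B A' B'
    using inst_Var0_left[OF tm'(2)[OF that]] inst_Var0_left[OF that(1)] tm'(1)[OF that]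
    by (simp_all add: eq_sym)
  have wf: "wf_ty T A" "wf_ty T B" if "typing T [A] f B" for A f B
    using typing_wf_ctx[OF that] typing_wf_ty[OF that] by auto
  have trf1: "csc_transformation T T U tr_id (\<lambda>_. Var 0)"
    unfolding csc_transformation_def using tr id
    by (simp add: tr_id_def v(1)[OF ty] nat(1)[OF _ teq_sym[OF ty[OF wf(1)]] teq_refl[OF wf(2)]])
  have trf2: "csc_transformation T T tr_id U (\<lambda>_. Var 0)"
    unfolding csc_transformation_def using tr id
    by (simp add: tr_id_def v(1)[OF teq_sym[OF ty]]
        nat(2)[OF _ teq_refl[OF wf(1)] teq_sym[OF ty[OF wf(2)]]])
  have "wf_ty T A \<Longrightarrow> tm_eq T [trTy U A] (Var 0) (Var 0) (trTy U A)"
    "wf_ty T A \<Longrightarrow> tm_eq T [A] (Var 0) (Var 0) A" for A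
    using v(2)[OF teq_refl] ty_eq_wf1[OF ty] by auto
  then show "invertible_transformation T T U tr_id (\<lambda>_. Var 0)"
    and "invertible_transformation T T tr_id U (\<lambda>_. Var 0)"
    unfolding invertible_transformation_def transf_eq_def transf_comp_def transf_id_def
    using trf1 trf2 by (auto intro!: exI[of _ "\<lambda>_. Var 0"] simp: tr_id_def)
qed

end

section \<open>The internal language\<close>

text \<open>The axioms of \<open>int_lang\<close> are restricted by well-formedness and typing over
  the signatures from which it is built. This and the later congruence lemmas express those
  restrictions over the finished theory.\<close>

lemma wf_ty_cong_sig: "grounds T = grounds T' \<Longrightarrow> wf_ty T A \<longleftrightarrow> wf_ty T' A"
  by (induction A) simp_all

lemma int_sig_sel [simp]:
  "grounds (int_sig C) = Obj C" "consts_of (int_sig C) = Arr C"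
  "const_ty (int_sig C) f = TFun (Ground (Dom C f)) (Ground (Cod C f))"
  by (simp_all add: int_sig_def Let_def)

lemma int_lang_sel [simp]:
  "grounds (int_lang C) = Obj C" "consts_of (int_lang C) = Arr C"
  "const_ty (int_lang C) f = TFun (Ground (Dom C f)) (Ground (Cod C f))"
  by (simp_all add: int_lang_def csc_sig.defs)

lemma int_sig_ty_axioms:
  "ty_axioms (int_sig C) = {(A, B). wf_ty (int_lang C) A \<and> wf_ty (int_lang C) B \<and> ity C A = ity C B}"
proof -
  have "wf_ty (int_lang C) = wf_ty \<lparr>grounds = Obj C, consts_of = Arr C,
      const_ty = (\<lambda>f. TFun (Ground (Dom C f)) (Ground (Cod C f))), ty_axioms = {}\<rparr>"
    by (rule ext, rule wf_ty_cong_sig) simp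
  then show ?thesis by (simp add: int_sig_def Let_def)
qed

lemma int_lang_ty_axioms:
  "ty_axioms (int_lang C) = {(A, B). wf_ty (int_lang C) A \<and> wf_ty (int_lang C) B \<and> ity C A = ity C B}"
  unfolding int_sig_ty_axioms[symmetric] by (simp add: int_lang_def csc_sig.defs)

lemma ty_eq_cong_sig:
  assumes "grounds T = grounds T'" "ty_axioms T = ty_axioms T'"
  shows "ty_eq T A B \<Longrightarrow> ty_eq T' A B"
proof (induction rule: ty_eq.induct)
  case teq_sym show ?case by (rule ty_eq.teq_sym[OF teq_sym.IH])
next
  case teq_trans show ?case by (rule ty_eq.teq_trans[OF teq_trans.IH])
next
  case teq_ax then show ?case using assms by (simp add: ty_eq.teq_ax)
qed (use wf_ty_cong_sig[OF assms(1)] in \<open>simp_all add: teq_refl teq_Fun teq_Prod teq_M\<close>)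

lemma typing_cong_sig:
  assumes "grounds T = grounds T'" "ty_axioms T = ty_axioms T'"
    "consts_of T = consts_of T'" "const_ty T = const_ty T'"
  shows "typing T \<Gamma> M A \<Longrightarrow> typing T' \<Gamma> M A"
proof (induction rule: typing.induct)
  have [simp]: "wf_ctx T \<Gamma> = wf_ctx T' \<Gamma>" for \<Gamma>
    using wf_ty_cong_sig[OF assms(1)] by (simp add: wf_ctx_def)
  {
    case ty_conv
    then show ?case by (blast intro: typing.ty_conv ty_eq_cong_sig[OF assms(1,2)])
  next
    case ty_Var then show ?case by (simp add: typing.ty_Var)
  next
    case ty_Const then show ?case using assms by (simp add: typing.ty_Const)
  next
    case ty_Star then show ?case by (simp add: typing.ty_Star)
  }
qed (simp_all add: typing_rules)

lemma typing_int_sig: "typing (int_sig C) = typing (int_lang C)"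
proof -
  have ct: "const_ty (int_sig C) = const_ty (int_lang C)" by (rule ext) simp
  have ax: "ty_axioms (int_sig C) = ty_axioms (int_lang C)"
    by (simp add: int_lang_ty_axioms int_sig_ty_axioms)
  show ?thesis
    by (intro ext iffI) (erule typing_cong_sig[rotated -1]; simp add: ax ct)+
qed

lemma int_lang_tm_axioms:
  "tm_axioms (int_lang C) = {(\<Gamma>, M, N, A). typing (int_lang C) \<Gamma> M A \<and>
      typing (int_lang C) \<Gamma> N A \<and> itm C M \<Gamma> = itm C N \<Gamma>}"
proof -
  have "tm_axioms (int_lang C) = {(\<Gamma>, M, N, A). typing (int_sig C) \<Gamma> M A \<and>
      typing (int_sig C) \<Gamma> N A \<and> itm C M \<Gamma> = itm C N \<Gamma>}"
    by (simp add: int_lang_def csc_sig.defs)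
  then show ?thesis by (simp add: typing_int_sig)
qed

lemma int_lang_tm_eqI:
  "typing (int_lang C) \<Gamma> M A \<Longrightarrow> typing (int_lang C) \<Gamma> N A \<Longrightarrow> itm C M \<Gamma> = itm C N \<Gamma> \<Longrightarrow>
    tm_eq (int_lang C) \<Gamma> M N A"
  by (rule eq_ax) (simp add: int_lang_tm_axioms)

text \<open>\<open>ity\<close> is compositional, so the other rules of type equality derive only
  pairs that are already axioms.\<close>

lemma int_lang_ty_eq_iff:
  "ty_eq (int_lang C) A B \<longleftrightarrow> wf_ty (int_lang C) A \<and> wf_ty (int_lang C) B \<and> ity C A = ity C B"
proof
  show "ty_eq (int_lang C) A B \<Longrightarrow> wf_ty (int_lang C) A \<and> wf_ty (int_lang C) B \<and> ity C A = ity C B"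
    by (induction rule: ty_eq.induct) (auto simp: int_lang_ty_axioms)
  show "wf_ty (int_lang C) A \<and> wf_ty (int_lang C) B \<and> ity C A = ity C B \<Longrightarrow> ty_eq (int_lang C) A B"
    by (rule teq_ax) (simp add: int_lang_ty_axioms)
qed

lemma csc_theory_int_lang:
  assumes "\<And>f. f \<in> Arr C \<Longrightarrow> Dom C f \<in> Obj C" "\<And>f. f \<in> Arr C \<Longrightarrow> Cod C f \<in> Obj C"
  shows "csc_theory (int_lang C)"
  using assms by (auto simp: csc_theory_def int_lang_tm_axioms int_lang_ty_axioms)


section \<open>Contexts as products\<close>

text \<open>An arrow of the syntactic model has one variable, so a context is packed into one
  product type, associated as in \<open>ictx\<close>.\<close>

primrec ctx_ty :: "'g ty list \<Rightarrow> 'g ty" where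
  "ctx_ty [] = TOne"
| "ctx_ty (A # \<Gamma>) = TProd (ctx_ty \<Gamma>) A"

text \<open>The substitution that reads the variables of a context out of the packed variable.
  Indices beyond the context get arbitrary values.\<close>

primrec projs :: "'g ty list \<Rightarrow> nat \<Rightarrow> ('g, 'c) tm" where
  "projs [] i = Var 0"
| "projs (A # \<Gamma>) i = (case i of 0 \<Rightarrow> Pi2 (ctx_ty \<Gamma>) A (Var 0)
     | Suc j \<Rightarrow> inst (Pi1 (ctx_ty \<Gamma>) A (Var 0)) (projs \<Gamma> j))"

lemma projs_simps [simp]:
  "projs (A # \<Gamma>) 0 = Pi2 (ctx_ty \<Gamma>) A (Var 0)"
  "projs (A # \<Gamma>) (Suc j) = inst (Pi1 (ctx_ty \<Gamma>) A (Var 0)) (projs \<Gamma> j)"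
  by simp_all

declare projs.simps(2) [simp del]

text \<open>Packs the variables of a context into one term; substituting it undoes
  \<open>projs\<close> up to provable equality.\<close>

primrec tup :: "'g ty list \<Rightarrow> ('g, 'c) tm" where
  "tup [] = Star"
| "tup (A # \<Gamma>) = Pr (shift (tup \<Gamma>)) (Var 0)"

lemma wf_ctx_ty: "wf_ty T (ctx_ty \<Gamma>) \<longleftrightarrow> wf_ctx T \<Gamma>"
  by (induction \<Gamma>) auto

lemma inst_simps [simp]:
  "inst N (Pr M M') = Pr (inst N M) (inst N M')"
  "inst N (Pi1 A B M) = Pi1 A B (inst N M)"
  "inst N (Pi2 A B M) = Pi2 A B (inst N M)"
  "inst N (App A B M M') = App A B (inst N M) (inst N M')"
  "inst N (Ret X M) = Ret X (inst N M)"
  "inst N (Iota A M) = Iota A (inst N M)"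
  "inst N Star = Star"
  by (simp_all add: inst_eq)

lemma up_inst_sub_1 [simp]: "up_sub (inst_sub N) (Suc 0) = shift N"
  by (simp add: up_sub_def)

lemma inst_inst:
  assumes "typing T [A] M B" shows "inst N (inst K M) = inst (inst N K) M"
proof -
  have "inst N (inst K M) = subst (\<lambda>i. subst (inst_sub N) (inst_sub K i)) M"
    by (simp add: inst_eq subst_subst)
  also have "\<dots> = inst (inst N K) M"
    unfolding inst_eq by (rule subst_cong[OF assms]) simp
  finally show ?thesis .
qed

lemma rename_inst:
  assumes "typing T [A] M B" shows "rename r (inst K M) = inst (rename r K) M"
  unfolding inst_eq rename_subst by (rule subst_cong[OF assms]) simp

lemma shift_single:
  assumes "typing T [A] M B" shows "shift M = inst (Var (Suc 0)) M"
  unfolding inst_eq rename_eq_subst by (rule subst_cong[OF assms]) simp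

context theory_of
begin

lemma typing_projs: "wf_ctx T \<Gamma> \<Longrightarrow> i < length \<Gamma> \<Longrightarrow> typing T [ctx_ty \<Gamma>] (projs \<Gamma> i) (\<Gamma> ! i)"
proof (induction \<Gamma> arbitrary: i)
  case (Cons A \<Gamma>)
  have v: "typing T [ctx_ty (A # \<Gamma>)] (Var 0) (TProd (ctx_ty \<Gamma>) A)"
    using Cons.prems ty_Var0[of T "ctx_ty (A # \<Gamma>)" "[]"] by (simp add: wf_ctx_ty)
  show ?case
    using Cons ty_Pi1[OF v] ty_Pi2[OF v] by (cases i) (auto intro!: typing_inst1)
qed simp

lemma typing_subst_projs:
  "typing T \<Gamma> M A \<Longrightarrow> typing T [ctx_ty \<Gamma>] (subst (projs \<Gamma>) M) A"
  by (rule typing_subst, assumption)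
    (auto dest: typing_wf_ctx simp: wf_ctx_ty intro: typing_projs)

lemma typing_tup: "wf_ctx T \<Gamma> \<Longrightarrow> typing T \<Gamma> (tup \<Gamma>) (ctx_ty \<Gamma>)"
  by (induction \<Gamma>) (auto intro!: ty_Star ty_Pr typing_shift ty_Var0)

text \<open>One beta step reduces a projection at a successor index to the same claim for the
  shorter context, shifted.\<close>

lemma inst_tup_projs: "wf_ctx T \<Gamma> \<Longrightarrow> i < length \<Gamma> \<Longrightarrow>
    tm_eq T \<Gamma> (inst (tup \<Gamma>) (projs \<Gamma> i)) (Var i) (\<Gamma> ! i)"
proof (induction \<Gamma> arbitrary: i)
  case (Cons A \<Gamma>)
  then have t: "typing T (A # \<Gamma>) (shift (tup \<Gamma>)) (ctx_ty \<Gamma>)" "typing T (A # \<Gamma>) (Var 0) A"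
    by (auto intro: typing_shift typing_tup ty_Var0)
  show ?case
  proof (cases i)
    case 0
    then show ?thesis using eq_Pi2_beta[OF t] by simp
  next
    case (Suc j)
    then have p: "typing T [ctx_ty \<Gamma>] (projs \<Gamma> j) (\<Gamma> ! j)"
      using Cons.prems by (auto intro: typing_projs)
    have "tm_eq T (A # \<Gamma>) (inst (Pi1 (ctx_ty \<Gamma>) A (tup (A # \<Gamma>))) (projs \<Gamma> j))
       (inst (shift (tup \<Gamma>)) (projs \<Gamma> j)) (\<Gamma> ! j)"
      using eq_Pi1_beta[OF t] by (auto intro: tm_eq_inst1[OF eq_refl[OF p]])
    moreover have "tm_eq T (A # \<Gamma>) (inst (shift (tup \<Gamma>)) (projs \<Gamma> j)) (Var (Suc j)) (\<Gamma> ! j)"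
      using tm_eq_shift[OF Cons.IH[of j], of A] Cons.prems Suc by (simp add: rename_inst[OF p])
    ultimately show ?thesis
      using Suc inst_inst[OF p, of "tup (A # \<Gamma>)" "Pi1 (ctx_ty \<Gamma>) A (Var 0)"]
      by (auto intro: eq_trans)
  qed
qed simp

lemma inst_tup_subst_projs:
  assumes "typing T \<Gamma> M A" shows "tm_eq T \<Gamma> (inst (tup \<Gamma>) (subst (projs \<Gamma>) M)) M A"
proof -
  note w = typing_wf_ctx[OF assms]
  have "tm_eq T \<Gamma> (subst (\<lambda>i. inst (tup \<Gamma>) (projs \<Gamma> i)) M) (subst Var M) A"
    by (rule tm_eq_subst_cong[OF assms w inst_tup_projs[OF w]])
  then show ?thesis by (simp add: inst_eq subst_subst)
qed

text \<open>Substituting \<open>tup\<close> undoes the packing, so packing reflects provable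
  equality.\<close>

lemma subst_projs_inj:
  assumes "typing T \<Gamma> M A" "typing T \<Gamma> N A"
    "tm_eq T [ctx_ty \<Gamma>] (subst (projs \<Gamma>) M) (subst (projs \<Gamma>) N) A"
  shows "tm_eq T \<Gamma> M N A"
proof -
  have "tm_eq T \<Gamma> (inst (tup \<Gamma>) (subst (projs \<Gamma>) M)) (inst (tup \<Gamma>) (subst (projs \<Gamma>) N)) A"
    by (rule tm_eq_inst1[OF assms(3) eq_refl[OF typing_tup]]) (rule typing_wf_ctx[OF assms(1)])
  from eq_trans[OF eq_trans[OF eq_sym[OF inst_tup_subst_projs[OF assms(1)]] this]
      inst_tup_subst_projs[OF assms(2)]]
  show ?thesis .
qed

text \<open>At a binder the packed context is split again: pairing the packed
  \<open>\<Gamma>\<close> with the bound variable turns the projections out of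
  \<open>A # \<Gamma>\<close> into the lifted projections out of \<open>\<Gamma>\<close>. In this
  form the transpose and the binding of the model meet \<open>Lam\<close> and
  \<open>Do\<close>.\<close>

lemma inst_Pr_projs:
  assumes "typing T (A # \<Gamma>) M B"
  shows "tm_eq T [A, ctx_ty \<Gamma>] (inst (Pr (Var (Suc 0)) (Var 0)) (subst (projs (A # \<Gamma>)) M))
     (subst (up_sub (projs \<Gamma>)) M) B"
proof -
  have w: "wf_ty T A" "wf_ctx T \<Gamma>" using typing_wf_ctx[OF assms] by auto
  then have w': "wf_ctx T [A, ctx_ty \<Gamma>]" by (simp add: wf_ctx_ty)
  let ?P = "Pr (Var (Suc 0)) (Var 0) :: ('g, 'c) tm"
  have t: "typing T [A, ctx_ty \<Gamma>] (Var (Suc 0)) (ctx_ty \<Gamma>)" "typing T [A, ctx_ty \<Gamma>] (Var 0) A"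
    using ty_Var0[OF w'] ty_Var1[OF w'] by auto
  have "tm_eq T [A, ctx_ty \<Gamma>] (inst ?P (projs (A # \<Gamma>) i)) (up_sub (projs \<Gamma>) i) ((A # \<Gamma>) ! i)"
    if i: "i < length (A # \<Gamma>)" for i
  proof (cases i)
    case 0
    then show ?thesis using eq_Pi2_beta[OF t] by simp
  next
    case (Suc j)
    then have p: "typing T [ctx_ty \<Gamma>] (projs \<Gamma> j) (\<Gamma> ! j)"
      using i w by (auto intro: typing_projs)
    have "tm_eq T [A, ctx_ty \<Gamma>] (inst (Pi1 (ctx_ty \<Gamma>) A ?P) (projs \<Gamma> j))
       (inst (Var (Suc 0)) (projs \<Gamma> j)) (\<Gamma> ! j)"
      using eq_Pi1_beta[OF t] by (auto intro: tm_eq_inst1[OF eq_refl[OF p]])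
    then show ?thesis
      using Suc inst_inst[OF p, of ?P "Pi1 (ctx_ty \<Gamma>) A (Var 0)"] shift_single[OF p] by simp
  qed
  then have "tm_eq T [A, ctx_ty \<Gamma>] (subst (\<lambda>i. inst ?P (projs (A # \<Gamma>) i)) M)
     (subst (up_sub (projs \<Gamma>)) M) B"
    by (rule tm_eq_subst_cong[OF assms w'])
  then show ?thesis by (simp add: inst_eq subst_subst)
qed


section \<open>Interpretation of the internal language of the syntactic model\<close>

definition rep :: "'g ty set \<Rightarrow> 'g ty" where
  "rep a = (SOME A. wf_ty T A \<and> a = ty_class T A)"

text \<open>
  The value \<open>Star\<close> outside the arrows makes \<open>lam_rep f\<close> closed for every \<open>f\<close>, so that the translation
  commutes with substitution on all terms, including ill-typed ones.
\<close>

definition lam_rep :: "('g ty \<times> ('g, 'c) tm \<times> 'g ty) set \<Rightarrow> ('g, 'c) tm" where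
  "lam_rep f = (if f \<in> Arr (syn_model T)
     then case SOME (A, M, B). typing T [A] M B \<and> f = jdg_class T A M B of (A, M, B) \<Rightarrow> Lam A M
     else Star)"

lemma Obj_syn: "a \<in> Obj (syn_model T) \<longleftrightarrow> (\<exists>A. wf_ty T A \<and> a = ty_class T A)"
  by (auto simp: syn_model_def)

lemma Arr_syn: "f \<in> Arr (syn_model T) \<longleftrightarrow> (\<exists>A M B. typing T [A] M B \<and> f = jdg_class T A M B)"
  by (auto simp: syn_model_def)

lemma rep: "a \<in> Obj (syn_model T) \<Longrightarrow> wf_ty T (rep a) \<and> ty_class T (rep a) = a"
  unfolding Obj_syn rep_def by (drule someI_ex) simp

lemma rep_ty_class: "wf_ty T A \<Longrightarrow> ty_eq T (rep (ty_class T A)) A"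
  using rep[of "ty_class T A"] by (metis Obj_syn ty_class_eq_iff)

lemma lam_rep:
  assumes "f \<in> Arr (syn_model T)"
  obtains A M B where "typing T [A] M B" "f = jdg_class T A M B" "lam_rep f = Lam A M"
proof -
  let ?P = "\<lambda>p. case p of (A, M, B) \<Rightarrow> typing T [A] M B \<and> f = jdg_class T A M B"
  from assms have "\<exists>p. ?P p" unfolding Arr_syn by auto
  then have "?P (Eps ?P)" by (rule someI_ex)
  moreover obtain A M B where "Eps ?P = (A, M, B)" by (rule prod_cases3)
  ultimately show ?thesis using assms that[of A M B] by (simp add: lam_rep_def)
qed

abbreviation LS where "LS \<equiv> int_lang (syn_model T)"
abbreviation repTy :: "'g ty set ty \<Rightarrow> 'g ty" where "repTy \<equiv> bty rep"
abbreviation repTm where "repTm \<equiv> btm rep lam_rep"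

lemma syn_Dom_in_Obj: "f \<in> Arr (syn_model T) \<Longrightarrow> Dom (syn_model T) f \<in> Obj (syn_model T)"
  unfolding Arr_syn using typing_wf_ctx by (fastforce simp: syn_Dom Obj_syn)

lemma syn_Cod_in_Obj: "f \<in> Arr (syn_model T) \<Longrightarrow> Cod (syn_model T) f \<in> Obj (syn_model T)"
  unfolding Arr_syn using typing_wf_ty by (fastforce simp: syn_Cod Obj_syn)

lemma csc_theory_LS: "csc_theory LS"
  by (rule csc_theory_int_lang[OF syn_Dom_in_Obj syn_Cod_in_Obj])

text \<open>\<open>rep\<close> chooses a member of the class that a ground type names, and the
  object operations of the model act on members.\<close>

lemma ity_syn: "wf_ty LS A \<Longrightarrow>
    wf_ty T (repTy A) \<and> ity (syn_model T) A = ty_class T (repTy A)"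
  by (induction A) (simp_all add: rep syn_One syn_Exp syn_Prod syn_MObj)

lemma ity_syn_ty_eq:
  assumes "wf_ty LS A" "wf_ty LS B"
    "ity (syn_model T) A = ity (syn_model T) B"
  shows "ty_eq T (repTy A) (repTy B)"
  using ity_syn[OF assms(1)] ity_syn[OF assms(2)] assms(3) ty_class_eq_iff[of "repTy A" "repTy B"] by simp

lemma sig_morphism_rep: "sig_morphism LS T rep lam_rep"
proof
  show "csc_theory LS" by (rule csc_theory_LS)
next
  fix \<sigma> c show "subst \<sigma> (lam_rep c) = lam_rep c"
  proof (cases "c \<in> Arr (syn_model T)")
    case True
    then obtain A M B where "typing T [A] M B" "lam_rep c = Lam A M" by (rule lam_rep)
    then show ?thesis using subst_closed[OF ty_Lam] by simp
  qed (simp add: lam_rep_def)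
next
  fix f assume f: "f \<in> consts_of LS"
  then have "f \<in> Arr (syn_model T)" by simp
  then obtain A M B where *: "typing T [A] M B" "f = jdg_class T A M B" "lam_rep f = Lam A M"
    by (rule lam_rep)
  have w: "wf_ty T A" "wf_ty T B" using typing_wf_ctx[OF *(1)] typing_wf_ty[OF *(1)] by auto
  \<comment> \<open>The chosen judgement lives over \<open>A\<close> and \<open>B\<close>, while the
    type of the constant is built from \<open>rep\<close> of their classes; the two agree up to type
    equality.\<close>
  show "typing T [] (lam_rep f) (repTy (const_ty LS f))"
    using ty_conv[OF ty_Lam[OF *(1)] teq_Fun[OF teq_sym[OF rep_ty_class[OF w(1)]] teq_sym[OF rep_ty_class[OF w(2)]]]]
    by (simp add: *(3)) (simp add: *(2) syn_Dom[OF *(1)] syn_Cod[OF *(1)])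
next
  fix A B assume "(A, B) \<in> ty_axioms LS"
  then show "ty_eq T (repTy A) (repTy B)" by (simp add: int_lang_ty_axioms ity_syn_ty_eq)
qed (simp add: rep)

end


lemma subst_inst:
  assumes "typing T [A] M B" shows "subst \<sigma> (inst K M) = inst (subst \<sigma> K) M"
  unfolding inst_eq subst_subst by (rule subst_cong[OF assms]) simp

context theory_of
begin

text \<open>The composite that interprets \<open>do\<close> in the model collapses to one syntactic
  \<open>do\<close>. Beta turns the strength into \<open>?s1\<close>; associativity and the left
  unit law then absorb first the functorial action, giving \<open>?s2\<close>, and finally the
  multiplication.\<close>

lemma syn_bind:
  assumes P: "wf_ty T P" and M: "typing T [P] M (TM X A)" and N: "typing T [TProd P A] N (TM X B)"
  shows "Comp (syn_model T) (Mult (mon (syn_model T) X) (ty_class T B))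
     (Comp (syn_model T) (MArr (mon (syn_model T) X) (jdg_class T (TProd P A) N (TM X B)))
        (Comp (syn_model T) (Str (mon (syn_model T) X) (ty_class T P) (ty_class T A))
           (Tuple (syn_model T) (Ident (syn_model T) (ty_class T P)) (jdg_class T P M (TM X A)))))
     = jdg_class T P (Do X A B M (inst (Pr (Var (Suc 0)) (Var 0)) N)) (TM X B)"
proof -
  let ?PA = "TProd P A" and ?Q = "Pr (Var (Suc 0)) (Var 0) :: ('g, 'c) tm"
  let ?N = "inst ?Q N"
  let ?str = "Do X A ?PA (Pi2 P (TM X A) (Var 0)) (Ret X (Pr (Pi1 P (TM X A) (Var (Suc 0))) (Var 0)))"
  let ?s1 = "Do X A ?PA M (Ret X ?Q)" and ?s2 = "Do X A (TM X B) M (Ret X ?N)"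
  have A: "wf_ty T A" and B: "wf_ty T B" using typing_wf_ty[OF M] typing_wf_ty[OF N] by auto
  have Q: "typing T [A, P] ?Q ?PA" by (simp add: ty_Pr ty_Var0 ty_Var1 A P)
  have N': "typing T [A, P] ?N (TM X B)" by (rule typing_inst1[OF N Q])
  have s1: "typing T [P] ?s1 (TM X ?PA)" by (rule ty_Do[OF M ty_Ret[OF Q]])
  have s2: "typing T [P] ?s2 (TM X (TM X B))" by (rule ty_Do[OF M ty_Ret[OF N']])
  have v0: "typing T (D # \<Gamma>) (Var 0) D" if "wf_ty T D" "wf_ctx T \<Gamma>" for D \<Gamma>
    using that by (simp add: ty_Var0)
  have p: "typing T [P] (Pr (Var 0) M) (TProd P (TM X A))" by (rule ty_Pr[OF v0 M]) (simp_all add: P)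
  have str: "typing T [TProd P (TM X A)] ?str (TM X ?PA)"
    by (simp add: ty_Do ty_Pi2 ty_Ret ty_Pr ty_Pi1 v0 ty_Var1 A P)
  have marr: "typing T [TM X ?PA] (Do X ?PA (TM X B) (Var 0) (Ret X N)) (TM X (TM X B))"
    by (simp add: ty_Do ty_Ret v0 typing_extend[OF N] A P)
  have mult: "typing T [TM X (TM X B)] (Do X (TM X B) B (Var 0) (Var 0)) (TM X B)"
    by (simp add: ty_Do v0 B)
  have "tm_eq T [P] (inst (Pr (Var 0) M) ?str) ?s1 (TM X ?PA)"
  proof -
    have "tm_eq T [P] (Pi2 P (TM X A) (Pr (Var 0) M)) M (TM X A)"
      by (rule eq_Pi2_beta[OF v0 M]) (simp_all add: P)
    moreover have "tm_eq T [A, P] (Pi1 P (TM X A) (Pr (Var (Suc 0)) (shift M))) (Var (Suc 0)) P"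
      by (rule eq_Pi1_beta[OF ty_Var1 typing_shift[OF M]]) (simp_all add: A P)
    ultimately show ?thesis using A P
      by (simp add: inst_eq) (intro eq_Do eq_Ret eq_Pr eq_Var0 teq_refl; simp)
  qed
  then have 1: "jdg_class T P (inst (Pr (Var 0) M) ?str) (TM X ?PA) = jdg_class T P ?s1 (TM X ?PA)"
    by (intro jdg_class_eqI teq_refl) (simp_all add: A P)
  \<comment> \<open>The only variable of \<open>N\<close> is 0, which every lifted substitution
    fixes.\<close>
  have N_up: "subst (up_sub \<sigma>) N = N" "rename (up_ren r) N = N" for \<sigma> r
    using subst_cong[OF N, of "up_sub \<sigma>" Var]
      subst_cong[OF N, of "\<lambda>i. Var (up_ren r i)" Var] by (simp_all add: rename_eq_subst)
  have "tm_eq T [P] (inst ?s1 (Do X ?PA (TM X B) (Var 0) (Ret X N))) ?s2 (TM X (TM X B))"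
  proof -
    have "tm_eq T [P] (Do X ?PA (TM X B) ?s1 (Ret X N))
       (Do X A (TM X B) M (Do X ?PA (TM X B) (Ret X ?Q) (Ret X N))) (TM X (TM X B))"
      using eq_Do_assoc[OF M ty_Ret[OF Q] ty_Ret[OF typing_extend[OF N]]] A P by (simp add: N_up)
    moreover have "tm_eq T [A, P] (Do X ?PA (TM X B) (Ret X ?Q) (Ret X N)) (Ret X ?N) (TM X (TM X B))"
      using eq_Do_left_unit[OF Q ty_Ret[OF typing_extend[OF N]]] A P by simp
    then have "tm_eq T [P] (Do X A (TM X B) M (Do X ?PA (TM X B) (Ret X ?Q) (Ret X N)))
        ?s2 (TM X (TM X B))"
      by (intro eq_Do teq_refl eq_refl[OF M]) (simp_all add: A B)
    ultimately show ?thesis by (simp add: inst_eq N_up eq_trans)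
  qed
  then have 2: "jdg_class T P (inst ?s1 (Do X ?PA (TM X B) (Var 0) (Ret X N))) (TM X (TM X B))
      = jdg_class T P ?s2 (TM X (TM X B))"
    by (intro jdg_class_eqI teq_refl) (simp_all add: B P)
  have "tm_eq T [P] (inst ?s2 (Do X (TM X B) B (Var 0) (Var 0))) (Do X A B M ?N) (TM X B)"
  proof -
    have "tm_eq T [P] (Do X (TM X B) B ?s2 (Var 0))
       (Do X A B M (Do X (TM X B) B (Ret X ?N) (Var 0))) (TM X B)"
      using eq_Do_assoc[OF M ty_Ret[OF N'] v0] B P by simp
    moreover have "tm_eq T [A, P] (Do X (TM X B) B (Ret X ?N) (Var 0)) ?N (TM X B)"
      using eq_Do_left_unit[OF N' v0] A B P by simp
    then have "tm_eq T [P] (Do X A B M (Do X (TM X B) B (Ret X ?N) (Var 0)))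
        (Do X A B M ?N) (TM X B)"
      by (intro eq_Do teq_refl eq_refl[OF M]) (simp_all add: A B)
    ultimately show ?thesis by (simp add: inst_eq eq_trans)
  qed
  then have 3: "jdg_class T P (inst ?s2 (Do X (TM X B) B (Var 0) (Var 0))) (TM X B)
      = jdg_class T P (Do X A B M ?N) (TM X B)"
    by (intro jdg_class_eqI teq_refl) (simp_all add: B P)
  show ?thesis
    using 1 2 3 by (simp add: syn_Ident P syn_Tuple[OF v0 M] syn_Str A syn_Comp[OF p str] syn_MArr[OF N]
        syn_Comp[OF s1 marr] syn_Mult B syn_Comp[OF s2 mult])
qed

lemma ictx_syn: "wf_ctx LS \<Gamma> \<Longrightarrow>
    ictx (syn_model T) \<Gamma> = ty_class T (ctx_ty (map repTy \<Gamma>)) \<and> wf_ctx T (map repTy \<Gamma>)"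
  by (induction \<Gamma>) (simp_all add: ity_syn syn_One syn_Prod wf_ctx_ty)

lemma ivar_syn: "wf_ctx LS \<Gamma> \<Longrightarrow> i < length \<Gamma> \<Longrightarrow>
    ivar (syn_model T) \<Gamma> i =
      jdg_class T (ctx_ty (map repTy \<Gamma>)) (projs (map repTy \<Gamma>) i) (repTy (\<Gamma> ! i))"
proof (induction \<Gamma> arbitrary: i)
  case (Cons A \<Gamma>)
  let ?G = "map repTy \<Gamma>"
  have c: "ictx (syn_model T) \<Gamma> = ty_class T (ctx_ty ?G)" "wf_ty T (ctx_ty ?G)" "wf_ctx T ?G"
    using ictx_syn[of \<Gamma>] Cons.prems by (simp_all add: wf_ctx_ty)
  have a: "ity (syn_model T) A = ty_class T (repTy A)" "wf_ty T (repTy A)"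
    using ity_syn[of A] Cons.prems by simp_all
  show ?case
  proof (cases i)
    case 0
    then show ?thesis by (simp add: c a syn_Snd)
  next
    case (Suc j)
    then have j: "j < length \<Gamma>" using Cons.prems by simp
    have p: "typing T [ctx_ty ?G] (projs ?G j) (repTy (\<Gamma> ! j))"
      using typing_projs[OF c(3), of j] j by simp
    have f: "typing T [TProd (ctx_ty ?G) (repTy A)] (Pi1 (ctx_ty ?G) (repTy A) (Var 0)) (ctx_ty ?G)"
      using a c by (intro ty_Pi1 ty_Var0) simp
    show ?thesis using Cons.IH[of j] Cons.prems Suc j by (simp add: c a syn_Fst syn_Comp[OF f p])
  qed
qed simp

text \<open>Calculated on representatives, without appeal to the laws of a model. Equality of
  interpretations in \<open>syn_model T\<close> thereby becomes provable equality of packed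
  translations.\<close>

lemma itm_syn:
  "typing LS \<Gamma> M A \<Longrightarrow> itm (syn_model T) M \<Gamma> =
     jdg_class T (ctx_ty (map repTy \<Gamma>)) (subst (projs (map repTy \<Gamma>)) (repTm M)) (repTy A)"
proof (induction rule: typing.induct)
  interpret LS: theory_of LS by unfold_locales (rule csc_theory_LS)
  interpret W: sig_morphism LS T rep lam_rep by (rule sig_morphism_rep)
  let ?S = "syn_model T" and ?L = LS
  let ?o = "\<lambda>\<Gamma> M. subst (projs (map repTy \<Gamma>)) (repTm M)"
  let ?P = "\<lambda>\<Gamma>. ctx_ty (map repTy \<Gamma>)"
  have typd: "typing T [?P \<Gamma>] (?o \<Gamma> M) (repTy A)" if "typing ?L \<Gamma> M A" for \<Gamma> M A
    using typing_subst_projs[OF W.typing_btm[OF that]] .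
  have tyd: "ity ?S A = ty_class T (repTy A)" "wf_ty T (repTy A)" if "wf_ty ?L A" for A
    using ity_syn[OF that] by simp_all
  have ctxd: "ictx ?S \<Gamma> = ty_class T (?P \<Gamma>)" "wf_ty T (?P \<Gamma>)" if "wf_ctx ?L \<Gamma>" for \<Gamma>
    using ictx_syn[OF that] by (simp_all add: wf_ctx_ty)
  have jdg_eqI: "jdg_class T (?P \<Gamma>) M A = jdg_class T (?P \<Gamma>) N A"
    if "tm_eq T [?P \<Gamma>] M N A" for \<Gamma> M N A
    by (rule jdg_class_eqI[OF teq_refl teq_refl that])
      (use tm_eq_wf_ctx[OF that] typing_wf_ty[OF tm_eq_typing1[OF that]] in simp_all)
  {
    case (ty_Var \<Gamma> i) then show ?case by (simp add: ivar_syn)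
  next
    case (ty_Const \<Gamma> f)
    then have "f \<in> Arr ?S" by simp
    then obtain A M B where f: "typing T [A] M B" "f = jdg_class T A M B" "lam_rep f = Lam A M"
      by (rule lam_rep)
    have w: "wf_ty T A" "wf_ty T B" using typing_wf_ctx[OF f(1)] typing_wf_ty[OF f(1)] by auto
    note c = ctxd[OF ty_Const(1)]
    \<comment> \<open>A constant is interpreted as the transpose of \<open>f\<close> after the
      projection from \<open>1 x A\<close>, composed with the map to \<open>1\<close>. Product beta
      reduces the resulting term to the abstraction chosen by \<open>lam_rep\<close>.\<close>
    let ?m = "inst (Pr (Var (Suc 0)) (Var 0)) (inst (Pi2 TOne A (Var 0)) M)"
    have snd: "typing T [TProd TOne A] (Pi2 TOne A (Var 0)) A"
      by (rule ty_Pi2[of _ _ _ TOne], rule ty_Var0) (simp add: w)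
    have fs: "typing T [TProd TOne A] (inst (Pi2 TOne A (Var 0)) M) B"
      by (rule typing_inst1[OF f(1) snd])
    have star: "typing T [?P \<Gamma>] Star TOne" by (rule ty_Star) (simp add: c)
    have pr: "typing T [A, D] (Var (Suc 0)) D" "typing T [A, D] (Var 0) A" if "wf_ty T D" for D
      using that w by (auto intro!: ty_Var0 ty_Var1)
    have "typing T [A, TOne] ?m B"
      by (rule typing_inst1[OF fs ty_Pr[OF pr]]) simp_all
    then have lam: "typing T [TOne] (Lam A ?m) (TFun A B)" by (rule ty_Lam)
    have "Comp ?S f (Snd ?S (One ?S) (Dom ?S f)) = jdg_class T (TProd TOne A) (inst (Pi2 TOne A (Var 0)) M) B"
      unfolding f(2) syn_Dom[OF f(1)] syn_One syn_Snd[OF wf_One w(1)] by (rule syn_Comp[OF snd f(1)])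
    moreover have "Curry ?S (One ?S) (Dom ?S f) (jdg_class T (TProd TOne A) (inst (Pi2 TOne A (Var 0)) M) B) =
        jdg_class T TOne (Lam A ?m) (TFun A B)"
      unfolding f(2) syn_Dom[OF f(1)] syn_One syn_Curry[OF fs wf_One w(1)] by simp
    moreover have "Bang ?S (ictx ?S \<Gamma>) = jdg_class T (?P \<Gamma>) Star TOne"
      unfolding c(1) by (rule syn_Bang[OF c(2)])
    ultimately have "itm ?S (Const f) \<Gamma> = jdg_class T (?P \<Gamma>) (inst Star (Lam A ?m)) (TFun A B)"
      using syn_Comp[OF star lam] by simp
    also have "\<dots> = jdg_class T (?P \<Gamma>) (Lam A M) (TFun A B)"
    proof (rule jdg_eqI)
      have "inst Star (Lam A ?m) = Lam A (inst (Pr Star (Var 0)) (inst (Pi2 TOne A (Var 0)) M))"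
        using subst_inst[OF fs, of "up_sub (inst_sub Star)" "Pr (Var (Suc 0)) (Var 0)"]
        by (simp add: inst_eq[of Star])
      also have "\<dots> = Lam A (inst (Pi2 TOne A (Pr Star (Var 0))) M)"
        by (simp add: inst_inst[OF f(1)])
      finally have 1: "inst Star (Lam A ?m) = Lam A (inst (Pi2 TOne A (Pr Star (Var 0))) M)" .
      have "tm_eq T [A, ?P \<Gamma>] (Pi2 TOne A (Pr Star (Var 0))) (Var 0) A"
        by (rule eq_Pi2_beta[OF ty_Star pr(2)]) (simp_all add: w c)
      from tm_eq_inst1[OF eq_refl[OF f(1)] this]
      have "tm_eq T [A, ?P \<Gamma>] (inst (Pi2 TOne A (Pr Star (Var 0))) M) M B"
        by (simp add: inst_Var0_left[OF f(1)])
      then show "tm_eq T [?P \<Gamma>] (inst Star (Lam A ?m)) (Lam A M) (TFun A B)"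
        unfolding 1 by (rule eq_Lam[OF teq_refl[OF w(1)]])
    qed
    also have "\<dots> = jdg_class T (?P \<Gamma>) (Lam A M) (TFun (rep (Dom ?S f)) (rep (Cod ?S f)))"
    proof (rule jdg_class_eqI[OF teq_refl[OF c(2)]])
      show "ty_eq T (TFun A B) (TFun (rep (Dom ?S f)) (rep (Cod ?S f)))"
        using f w by (simp add: syn_Dom syn_Cod) (intro teq_Fun teq_sym[OF rep_ty_class])
      show "tm_eq T [?P \<Gamma>] (Lam A M) (Lam A M) (TFun A B)"
        using typing_extend[OF f(1), of "[?P \<Gamma>]"] c w by (intro eq_refl ty_Lam) simp
    qed
    finally show ?case using W.kappa_closed[of _ f] f(3) by simp
  next
    case (ty_Star \<Gamma>) then show ?case by (simp add: ctxd syn_Bang)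
  next
    case (ty_Lam A \<Gamma> M B)
    have w: "wf_ty ?L A" "wf_ctx ?L \<Gamma>" using typing_wf_ctx[OF ty_Lam.hyps] by simp_all
    note c = ctxd[OF w(2)] tyd[OF w(1)]
    have m: "typing T [TProd (?P \<Gamma>) (repTy A)] (?o (A # \<Gamma>) M) (repTy B)"
      using typd[OF ty_Lam.hyps] by simp
    have m': "typing T (repTy A # map repTy \<Gamma>) (repTm M) (repTy B)"
      using W.typing_btm[OF ty_Lam.hyps] by simp
    have "itm ?S (Lam A M) \<Gamma> = jdg_class T (?P \<Gamma>)
       (Lam (repTy A) (inst (Pr (Var (Suc 0)) (Var 0)) (?o (A # \<Gamma>) M))) (TFun (repTy A) (repTy B))"
      using ty_Lam.IH syn_Curry[OF m] by (simp add: c)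
    also have "\<dots> = jdg_class T (?P \<Gamma>) (Lam (repTy A) (subst (up_sub (projs (map repTy \<Gamma>))) (repTm M)))
       (TFun (repTy A) (repTy B))"
      using eq_Lam[OF teq_refl[OF c(4)] inst_Pr_projs[OF m']] by (intro jdg_eqI) simp
    finally show ?case by simp
  next
    case (ty_App \<Gamma> M A B N)
    have w: "wf_ty ?L A" "wf_ty ?L B" "wf_ctx ?L \<Gamma>"
      using LS.typing_wf_ty[OF ty_App.hyps(1)] typing_wf_ctx[OF ty_App.hyps(1)] by simp_all
    note c = ctxd[OF w(3)] tyd[OF w(1)] tyd[OF w(2)]
    let ?A = "repTy A" and ?B = "repTy B"
    have m: "typing T [?P \<Gamma>] (?o \<Gamma> M) (TFun ?A ?B)" using typd[OF ty_App.hyps(1)] by simp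
    have n: "typing T [?P \<Gamma>] (?o \<Gamma> N) ?A" using typd[OF ty_App.hyps(2)] .
    have ev: "typing T [TProd (TFun ?A ?B) ?A]
        (App ?A ?B (Pi1 (TFun ?A ?B) ?A (Var 0)) (Pi2 (TFun ?A ?B) ?A (Var 0))) ?B"
      using c by (intro typing.ty_App ty_Pi1 ty_Pi2 ty_Var0) simp_all
    have "itm ?S (App A B M N) \<Gamma> = jdg_class T (?P \<Gamma>) (App ?A ?B (Pi1 (TFun ?A ?B) ?A (Pr (?o \<Gamma> M) (?o \<Gamma> N)))
         (Pi2 (TFun ?A ?B) ?A (Pr (?o \<Gamma> M) (?o \<Gamma> N)))) ?B"
      using ty_App.IH by (simp add: c syn_Tuple[OF m n] syn_Ev syn_Comp[OF ty_Pr[OF m n] ev])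
    also have "\<dots> = jdg_class T (?P \<Gamma>) (App ?A ?B (?o \<Gamma> M) (?o \<Gamma> N)) ?B"
      by (intro jdg_eqI eq_App eq_Pi1_beta[OF m n] eq_Pi2_beta[OF m n] teq_refl c)
    finally show ?case by simp
  next
    case (ty_Pr \<Gamma> M A N B)
    show ?case using ty_Pr.IH syn_Tuple[OF typd[OF ty_Pr.hyps(1)] typd[OF ty_Pr.hyps(2)]] by simp
  next
    case (ty_Pi1 \<Gamma> M A B)
    have w: "wf_ty ?L A" "wf_ty ?L B" using LS.typing_wf_ty[OF ty_Pi1.hyps] by simp_all
    note c = tyd[OF w(1)] tyd[OF w(2)]
    have m: "typing T [?P \<Gamma>] (?o \<Gamma> M) (TProd (repTy A) (repTy B))" using typd[OF ty_Pi1.hyps] by simp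
    have p: "typing T [TProd (repTy A) (repTy B)] (Pi1 (repTy A) (repTy B) (Var 0)) (repTy A)"
      using c by (intro typing.ty_Pi1 ty_Var0) simp
    show ?case using ty_Pi1.IH by (simp add: c syn_Fst syn_Comp[OF m p])
  next
    case (ty_Pi2 \<Gamma> M A B)
    have w: "wf_ty ?L A" "wf_ty ?L B" using LS.typing_wf_ty[OF ty_Pi2.hyps] by simp_all
    note c = tyd[OF w(1)] tyd[OF w(2)]
    have m: "typing T [?P \<Gamma>] (?o \<Gamma> M) (TProd (repTy A) (repTy B))" using typd[OF ty_Pi2.hyps] by simp
    have p: "typing T [TProd (repTy A) (repTy B)] (Pi2 (repTy A) (repTy B) (Var 0)) (repTy B)"
      using c by (intro typing.ty_Pi2 ty_Var0) simp
    show ?case using ty_Pi2.IH by (simp add: c syn_Snd syn_Comp[OF m p])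
  next
    case (ty_Ret \<Gamma> M A X)
    note c = tyd[OF LS.typing_wf_ty[OF ty_Ret.hyps]]
    note m = typd[OF ty_Ret.hyps]
    have p: "typing T [repTy A] (Ret X (Var 0)) (TM X (repTy A))"
      using c by (intro typing.ty_Ret ty_Var0) simp
    show ?case using ty_Ret.IH by (simp add: c syn_Cod[OF m] syn_Unit syn_Comp[OF m p])
  next
    case (ty_Iota \<Gamma> M A)
    have w: "wf_ty ?L A" using LS.typing_wf_ty[OF ty_Iota.hyps] by simp
    note c = tyd[OF w]
    have m: "typing T [?P \<Gamma>] (?o \<Gamma> M) (TM SMon (repTy A))" using typd[OF ty_Iota.hyps] by simp
    have p: "typing T [TM SMon (repTy A)] (Iota (repTy A) (Var 0)) (TM TMon (repTy A))"
      using c by (intro typing.ty_Iota ty_Var0) simp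
    show ?case using ty_Iota.IH by (simp add: c syn_iota syn_Comp[OF m p])
  next
    case (ty_Do \<Gamma> M X A N B)
    have w: "wf_ty ?L A" "wf_ty ?L B" "wf_ctx ?L \<Gamma>"
      using LS.typing_wf_ty[OF ty_Do.hyps(1)] LS.typing_wf_ty[OF ty_Do.hyps(2)]
        typing_wf_ctx[OF ty_Do.hyps(1)] by simp_all
    note c = ctxd[OF w(3)] tyd[OF w(1)] tyd[OF w(2)]
    let ?A = "repTy A" and ?B = "repTy B"
    have m: "typing T [?P \<Gamma>] (?o \<Gamma> M) (TM X ?A)" using typd[OF ty_Do.hyps(1)] by simp
    have n: "typing T [TProd (?P \<Gamma>) ?A] (?o (A # \<Gamma>) N) (TM X ?B)"
      using typd[OF ty_Do.hyps(2)] by simp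
    have n': "typing T (?A # map repTy \<Gamma>) (repTm N) (TM X ?B)"
      using W.typing_btm[OF ty_Do.hyps(2)] by simp
    have "itm ?S (Do X A B M N) \<Gamma> = jdg_class T (?P \<Gamma>) (Do X ?A ?B (?o \<Gamma> M)
         (inst (Pr (Var (Suc 0)) (Var 0)) (?o (A # \<Gamma>) N))) (TM X ?B)"
      using ty_Do.IH syn_bind[OF c(2) m n] by (simp add: c)
    also have "\<dots> = jdg_class T (?P \<Gamma>) (Do X ?A ?B (?o \<Gamma> M)
         (subst (up_sub (projs (map repTy \<Gamma>))) (repTm N))) (TM X ?B)"
      using eq_Do[OF teq_refl[OF c(4)] teq_refl[OF c(6)] eq_refl[OF m] inst_Pr_projs[OF n']]
      by (intro jdg_eqI) simp
    finally show ?case by simp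
  next
    case (ty_conv \<Gamma> M A B)
    have "itm ?S M \<Gamma> = jdg_class T (?P \<Gamma>) (?o \<Gamma> M) (repTy B)"
      unfolding ty_conv.IH
      by (rule jdg_class_eqI[OF teq_refl W.ty_eq_bty[OF ty_conv.hyps(2)] eq_refl[OF typd[OF ty_conv.hyps(1)]]])
       (use typing_wf_ctx[OF ty_conv.hyps(1)] ctxd in simp)
    then show ?case .
  }
qed

end


section \<open>The internal language of the syntactic model\<close>

lemma csc_translation_comp:
  assumes "csc_translation T T' V" "csc_translation T' T'' W"
  shows "csc_translation T T'' (tr_comp W V)"
proof -
  interpret V: csc_translation T T' V by (rule assms(1))
  interpret W: csc_translation T' T'' W by (rule assms(2))
  show ?thesis
  proof
    show "csc_theory T" "csc_theory T''" by (rule V.source W.target)+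
    show "wf_ty T'' (trTy (tr_comp W V) A)" if "wf_ty T A" for A
      using W.pres_wf_ty[OF V.pres_wf_ty[OF that]] by (simp add: tr_comp_def)
    show "ty_eq T'' (trTy (tr_comp W V) A) (trTy (tr_comp W V) B)" if "ty_eq T A B" for A B
      using W.pres_ty_eq[OF V.pres_ty_eq[OF that]] by (simp add: tr_comp_def)
    show "typing T'' (map (trTy (tr_comp W V)) \<Gamma>) (trTm (tr_comp W V) M) (trTy (tr_comp W V) A)"
      if "typing T \<Gamma> M A" for \<Gamma> M A
      using W.pres_typing[OF V.pres_typing[OF that]] by (simp add: tr_comp_def)
    show "tm_eq T'' (map (trTy (tr_comp W V)) \<Gamma>) (trTm (tr_comp W V) M) (trTm (tr_comp W V) N)
        (trTy (tr_comp W V) A)" if "tm_eq T \<Gamma> M N A" for \<Gamma> M N A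
      using W.pres_tm_eq[OF V.pres_tm_eq[OF that]] by (simp add: tr_comp_def)
  qed (simp_all add: tr_comp_def V.tr_One V.tr_Fun V.tr_Prod V.tr_M V.tr_Var V.tr_Star V.tr_Lam
      V.tr_App V.tr_Pr V.tr_Pi1 V.tr_Pi2 V.tr_Ret V.tr_Iota V.tr_Do W.tr_One W.tr_Fun W.tr_Prod
      W.tr_M W.tr_Var W.tr_Star W.tr_Lam W.tr_App W.tr_Pr W.tr_Pi1 W.tr_Pi2 W.tr_Ret W.tr_Iota W.tr_Do)
qed

context theory_of
begin

section \<open>The translation of a theory into the internal language of its syntactic model, and
  the round trips\<close>

definition syn_ground :: "'g \<Rightarrow> 'g ty set ty" where
  "syn_ground g = Ground (ty_class T (Ground g))"

text \<open>A constant of \<open>LS\<close> names an arrow and has a function type, whereas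
  \<open>c\<close> may have any type. So \<open>c\<close> is sent to the name of the corresponding
  arrow out of \<open>1\<close>, applied to the point of \<open>1\<close>.\<close>

definition syn_const :: "'c \<Rightarrow> ('g ty set, ('g ty \<times> ('g, 'c) tm \<times> 'g ty) set) tm" where
  "syn_const c = (if c \<in> consts_of T
     then App TOne (bty syn_ground (const_ty T c))
            (Const (jdg_class T TOne (Const c) (const_ty T c))) Star
     else Star)"

abbreviation synTy where "synTy \<equiv> bty syn_ground"
abbreviation synTm where "synTm \<equiv> btm syn_ground syn_const"

lemma ty_class_in_Obj: "wf_ty T A \<Longrightarrow> ty_class T A \<in> Obj (syn_model T)"
  unfolding Obj_syn by blast

lemma ity_synTy: "wf_ty T A \<Longrightarrow>
    wf_ty LS (synTy A) \<and> ity (syn_model T) (synTy A) = ty_class T A"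
proof (induction A)
  case (Ground g)
  then show ?case by (simp add: syn_ground_def ty_class_in_Obj)
qed (simp_all add: syn_One syn_Exp syn_Prod syn_MObj)

lemma typing_Const:
  assumes "c \<in> consts_of T" "wf_ctx T \<Gamma>"
  shows "typing T \<Gamma> (Const c) (const_ty T c) \<and> wf_ty T (const_ty T c)"
  using ty_Const[OF assms(2,1)] typing_wf_ty[OF ty_Const[OF assms(2,1)]] ..

lemma sig_morphism_syn: "sig_morphism T LS syn_ground syn_const"
proof
  show "csc_theory LS" by (rule csc_theory_LS)
next
  fix g assume "g \<in> grounds T"
  then show "wf_ty LS (syn_ground g)"
    using ity_synTy[of "Ground g"] by simp
next
  fix \<sigma> c show "subst \<sigma> (syn_const c) = syn_const c" by (simp add: syn_const_def)
next
  fix c assume c: "c \<in> consts_of T"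
  let ?f = "jdg_class T TOne (Const c) (const_ty T c)"
  have t: "typing T [TOne] (Const c) (const_ty T c)" "wf_ty T (const_ty T c)"
    using typing_Const[OF c, of "[TOne]"] by simp_all
  have f: "?f \<in> Arr (syn_model T)" using t(1) by (auto simp: Arr_syn)
  have o: "ty_class T TOne \<in> Obj (syn_model T)" "ty_class T (const_ty T c) \<in> Obj (syn_model T)"
    using t by (simp_all add: ty_class_in_Obj)
  have "typing LS [] (Const ?f) (const_ty LS ?f)"
    by (rule ty_Const) (simp_all add: f)
  \<comment> \<open>The declared type is a function type between ground types of classes; the type
    axioms of \<open>LS\<close> identify these with \<open>TOne\<close> and the translated
    type.\<close>
  then have "typing LS [] (Const ?f) (TFun TOne (synTy (const_ty T c)))"
    by (rule ty_conv)
      (use ity_synTy[OF t(2)] o in \<open>simp add: int_lang_ty_eq_iff syn_Dom[OF t(1)] syn_Cod[OF t(1)] syn_One\<close>)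
  then show "typing LS [] (syn_const c) (synTy (const_ty T c))"
    using c by (auto simp: syn_const_def intro!: ty_App ty_Star)
next
  fix A B assume "(A, B) \<in> ty_axioms T"
  then have AB: "ty_eq T A B" by (rule teq_ax)
  then show "ty_eq LS (synTy A) (synTy B)"
    using ity_synTy[OF ty_eq_wf1[OF AB]] ity_synTy[OF ty_eq_wf2[OF AB]]
    by (simp add: int_lang_ty_eq_iff ty_class_eqI)
qed

text \<open>The abstraction chosen for the arrow of \<open>c\<close> is known only to be provably
  equal to the constant function with value \<open>c\<close>. That is enough, since applying it to
  the point gives back \<open>c\<close> by beta.\<close>

lemma rep_syn_const:
  assumes c: "c \<in> consts_of T"
  shows "tm_eq T [] (repTm (syn_const c)) (Const c) (const_ty T c)"
proof -
  interpret W: sig_morphism LS T rep lam_rep by (rule sig_morphism_rep)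
  let ?f = "jdg_class T TOne (Const c) (const_ty T c)" and ?C = "const_ty T c"
  have t: "typing T [TOne] (Const c) ?C" "wf_ty T ?C"
    using typing_Const[OF c, of "[TOne]"] by simp_all
  then have "?f \<in> Arr (syn_model T)" by (auto simp: Arr_syn)
  then obtain A M B where *: "typing T [A] M B" "?f = jdg_class T A M B" "lam_rep ?f = Lam A M"
    by (rule lam_rep)
  note ** = jdg_class_eqD[OF *(1,2)]
  have "ty_class T (repTy (synTy ?C)) = ty_class T ?C" "wf_ty T (repTy (synTy ?C))"
    using ity_syn[of "synTy ?C"] ity_synTy[OF t(2)] by simp_all
  then have C: "ty_eq T ?C (repTy (synTy ?C))" using t(2) by (simp add: ty_class_eq_iff[symmetric])
  have "tm_eq T [] (Lam TOne (Const c)) (Lam A M) (TFun TOne ?C)"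
    by (rule eq_Lam[OF **(1,3)])
  then have "tm_eq T [] (App TOne ?C (Lam TOne (Const c)) Star)
      (App TOne (repTy (synTy ?C)) (Lam A M) Star) ?C"
    by (intro eq_App C teq_refl eq_Star) simp_all
  moreover have "tm_eq T [] (App TOne ?C (Lam TOne (Const c)) Star) (Const c) ?C"
    using eq_Fun_beta[OF t(1) ty_Star] by (simp add: inst_eq)
  ultimately show ?thesis using c *(3) by (simp add: syn_const_def) (blast intro: eq_sym eq_trans)
qed

lemma rep_synTy: "wf_ty T A \<Longrightarrow> ty_eq T (repTy (synTy A)) A"
  unfolding bty_bty
  by (rule bty_near_identity) (simp_all add: syn_ground_def rep_ty_class)

lemma rep_synTm: "typing T \<Gamma> M A \<Longrightarrow> tm_eq T \<Gamma> (repTm (synTm M)) M A"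
  unfolding btm_btm
  by (rule btm_near_identity) (simp_all add: syn_ground_def rep_ty_class rep_syn_const)

text \<open>The criterion for term axioms of \<open>LS\<close>: packing preserves provable equality,
  and by \<open>itm_syn\<close> the interpretations are the classes of the packed
  translations.\<close>

lemma itm_syn_eqI:
  assumes "typing LS \<Gamma> M A" "typing LS \<Gamma> N A"
    "tm_eq T (map repTy \<Gamma>) (repTm M) (repTm N) (repTy A)"
  shows "itm (syn_model T) M \<Gamma> = itm (syn_model T) N \<Gamma>"
proof -
  have w: "wf_ctx T (map repTy \<Gamma>)" by (rule tm_eq_wf_ctx[OF assms(3)])
  then have "tm_eq T [ctx_ty (map repTy \<Gamma>)] (subst (projs (map repTy \<Gamma>)) (repTm M))
      (subst (projs (map repTy \<Gamma>)) (repTm N)) (repTy A)"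
    by (intro tm_eq_subst[OF assms(3)] typing_projs) (simp_all add: wf_ctx_ty)
  then show ?thesis unfolding itm_syn[OF assms(1)] itm_syn[OF assms(2)]
    by (rule jdg_class_eqI[rotated 2])
      (use w typing_wf_ty[OF tm_eq_typing1[OF assms(3)]] in \<open>auto intro: teq_refl simp: wf_ctx_ty\<close>)
qed

text \<open>An axiom of \<open>LS\<close> says that two classes coincide, so the packed translations
  are provably equal; \<open>subst_projs_inj\<close> removes the packing.\<close>

lemma translation_rep: "csc_translation LS T \<lparr>trTy = repTy, trTm = repTm\<rparr>"
proof -
  interpret W: sig_morphism LS T rep lam_rep by (rule sig_morphism_rep)
  show ?thesis
  proof (rule W.translation)
    fix \<Gamma> M N A assume "(\<Gamma>, M, N, A) \<in> tm_axioms LS"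
    then have t: "typing LS \<Gamma> M A" "typing LS \<Gamma> N A"
      and eq: "itm (syn_model T) M \<Gamma> = itm (syn_model T) N \<Gamma>" by (simp_all add: int_lang_tm_axioms)
    note M = W.typing_btm[OF t(1)] and N = W.typing_btm[OF t(2)]
    show "tm_eq T (map repTy \<Gamma>) (repTm M) (repTm N) (repTy A)"
      by (rule subst_projs_inj[OF M N jdg_class_eqD(3)[OF typing_subst_projs[OF N]]])
        (use eq itm_syn[OF t(1)] itm_syn[OF t(2)] in simp)
  qed
qed

text \<open>By \<open>itm_syn_eqI\<close> an axiom of \<open>T\<close> may be checked after
  translating it back to \<open>T\<close>, where the round trip is provably the identity.\<close>

lemma translation_syn: "csc_translation T LS \<lparr>trTy = synTy, trTm = synTm\<rparr>"
proof -
  interpret V: sig_morphism T LS syn_ground syn_const by (rule sig_morphism_syn)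
  show ?thesis
  proof (rule V.translation)
    fix \<Gamma> M N A assume ax: "(\<Gamma>, M, N, A) \<in> tm_axioms T"
    then have eq: "tm_eq T \<Gamma> M N A" by (rule eq_ax)
    note t = tm_eq_typing1[OF eq] tm_eq_typing2[OF eq]
    note M = V.typing_btm[OF t(1)] and N = V.typing_btm[OF t(2)]
    have "tm_eq T \<Gamma> (repTm (synTm M)) (repTm (synTm N)) A"
      using rep_synTm[OF t(1)] rep_synTm[OF t(2)] eq by (blast intro: eq_sym eq_trans)
    then have "tm_eq T \<Gamma> (repTm (synTm M)) (repTm (synTm N)) (repTy (synTy A))"
      by (rule eq_conv) (rule teq_sym[OF rep_synTy[OF typing_wf_ty[OF t(1)]]])
    then have "tm_eq T (map repTy (map synTy \<Gamma>)) (repTm (synTm M)) (repTm (synTm N)) (repTy (synTy A))"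
    proof (rule tm_eq_ctx_conv)
      have w: "wf_ctx T \<Gamma>" by (rule typing_wf_ctx[OF t(1)])
      show "list_all2 (ty_eq T) (map repTy (map synTy \<Gamma>)) \<Gamma>"
        using w by (auto simp: list_all2_conv_all_nth intro: rep_synTy wf_ctx_nth)
      show "wf_ctx T (map repTy (map synTy \<Gamma>))"
        using w rep_synTy ty_eq_wf1 by (auto simp: wf_ctx_def)
    qed
    then show "tm_eq LS (map synTy \<Gamma>) (synTm M) (synTm N) (synTy A)"
      by (rule int_lang_tm_eqI[OF M N itm_syn_eqI[OF M N]])
  qed
qed

theorem LS_equivalence:
  "\<exists>V W. csc_translation T LS V \<and>
         csc_translation LS T W \<and>
         (\<exists>\<epsilon>. invertible_transformation LS LS
                (tr_comp V W) tr_id \<epsilon>) \<and>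
         (\<exists>\<eta>. invertible_transformation T T tr_id (tr_comp W V) \<eta>)"
proof -
  interpret LS: theory_of LS by unfold_locales (rule csc_theory_LS)
  interpret W: sig_morphism LS T rep lam_rep by (rule sig_morphism_rep)
  interpret V: sig_morphism T LS syn_ground syn_const by (rule sig_morphism_syn)
  let ?L = LS
  let ?V = "\<lparr>trTy = synTy, trTm = synTm\<rparr>" and ?W = "\<lparr>trTy = repTy, trTm = repTm\<rparr>"
  note V = translation_syn and W = translation_rep
  have "invertible_transformation T T tr_id (tr_comp ?W ?V) (\<lambda>_. Var 0)"
    by (rule identity_transformation(2)[OF csc_translation_comp[OF V W]])
      (simp_all add: tr_comp_def rep_synTy rep_synTm)
  moreover have "invertible_transformation ?L ?L (tr_comp ?V ?W) tr_id (\<lambda>_. Var 0)"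
  proof (rule LS.identity_transformation(1)[OF csc_translation_comp[OF W V]])
    have ty: "ty_eq ?L (synTy (repTy A)) A" if "wf_ty ?L A" for A
      using ity_syn[OF that] ity_synTy[of "repTy A"] that by (simp add: int_lang_ty_eq_iff)
    then show "ty_eq ?L (trTy (tr_comp ?V ?W) A) A" if "wf_ty ?L A" for A
      using that by (simp add: tr_comp_def)
    \<comment> \<open>This round trip is not checked on generators. By \<open>itm_syn_eqI\<close> it
      is enough to compare both sides after a further \<open>repTm\<close>, and there
      \<open>rep_synTm\<close> applies to \<open>repTm M\<close>.\<close>
    have "tm_eq ?L \<Gamma> (synTm (repTm M)) M A" if t: "typing ?L \<Gamma> M A" for \<Gamma> M A
    proof (rule int_lang_tm_eqI[OF _ t itm_syn_eqI[OF _ t]])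
      have "typing ?L (map synTy (map repTy \<Gamma>)) (synTm (repTm M)) A"
        by (rule ty_conv[OF V.typing_btm[OF W.typing_btm[OF t]] ty[OF LS.typing_wf_ty[OF t]]])
      then show *: "typing ?L \<Gamma> (synTm (repTm M)) A"
      proof (rule typing_ctx_conv)
        show w: "wf_ctx ?L \<Gamma>" by (rule typing_wf_ctx[OF t])
        show "list_all2 (ty_eq ?L) \<Gamma> (map synTy (map repTy \<Gamma>))"
          using w by (auto simp: list_all2_conv_all_nth intro: teq_sym[OF ty] wf_ctx_nth)
      qed
      then show "typing ?L \<Gamma> (synTm (repTm M)) A" .
      show "tm_eq T (map repTy \<Gamma>) (repTm (synTm (repTm M))) (repTm M) (repTy A)"
        by (rule rep_synTm[OF W.typing_btm[OF t]])
    qed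
    then show "tm_eq ?L \<Gamma> (trTm (tr_comp ?V ?W) M) M A" if "typing ?L \<Gamma> M A" for \<Gamma> M A
      using that by (simp add: tr_comp_def)
  qed
  ultimately show ?thesis using V W by blast
qed

end


section \<open>Equational reasoning in cartesian closed categories\<close>

text \<open>The simplifier can compute the endpoints of an arrow as values of \<open>Dom\<close> and
  \<open>Cod\<close>, but would have to guess them in a hom-set membership; the laws are therefore
  restated in this form.\<close>

lemma in_hom: "f \<in> hom C A B \<longleftrightarrow> f \<in> Arr C \<and> Dom C f = A \<and> Cod C f = B"
  by (auto simp: hom_def)

context category
begin

lemma comp_arr [simp]:
  assumes "f \<in> Arr C" "g \<in> Arr C" "Dom C g = Cod C f"
  shows "g \<cdot> f \<in> Arr C" "Dom C (g \<cdot> f) = Dom C f" "Cod C (g \<cdot> f) = Cod C g"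
  using Comp_in_hom[of f "Dom C f" "Cod C f" g "Cod C g"] assms by (simp_all add: in_hom)

lemma ident_arr [simp]:
  assumes "A \<in> Obj C"
  shows "Ident C A \<in> Arr C" "Dom C (Ident C A) = A" "Cod C (Ident C A) = A"
  using Ident_in_hom[OF assms] by (simp_all add: in_hom)

lemma obj [simp]: "f \<in> Arr C \<Longrightarrow> Dom C f \<in> Obj C" "f \<in> Arr C \<Longrightarrow> Cod C f \<in> Obj C"
  by (simp_all add: Dom_in_Obj Cod_in_Obj)

text \<open>Here and below an object is a variable constrained by an equation, so that the rule
  fires in whatever form the object is written.\<close>

lemma comp_ident [simp]: "f \<in> Arr C \<Longrightarrow> A = Dom C f \<Longrightarrow> f \<cdot> Ident C A = f"
  using Comp_Ident[of f "Dom C f" "Cod C f"] by (simp add: in_hom)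

lemma ident_comp [simp]: "f \<in> Arr C \<Longrightarrow> A = Cod C f \<Longrightarrow> Ident C A \<cdot> f = f"
  using Ident_Comp[of f "Dom C f" "Cod C f"] by (simp add: in_hom)

lemma assoc [simp]:
  assumes "f \<in> Arr C" "g \<in> Arr C" "h \<in> Arr C" "Dom C g = Cod C f" "Dom C h = Cod C g"
  shows "(h \<cdot> g) \<cdot> f = h \<cdot> (g \<cdot> f)"
  by (rule Comp_assoc[of f "Dom C f" "Cod C f" g "Cod C g" h "Cod C h"]) (simp_all add: in_hom assms)

lemma hom_obj: "f \<in> hom C A B \<Longrightarrow> A \<in> Obj C \<and> B \<in> Obj C"
  by (auto simp: in_hom)

end

context cartesian_closed_category
begin

lemma ccc_obj [simp]:
  "One C \<in> Obj C" "A \<in> Obj C \<Longrightarrow> B \<in> Obj C \<Longrightarrow> Prod C A B \<in> Obj C"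
  "A \<in> Obj C \<Longrightarrow> B \<in> Obj C \<Longrightarrow> Exp C A B \<in> Obj C"
  by (simp_all add: One_in_Obj Prod_in_Obj Exp_in_Obj)

lemma bang_arr [simp]:
  assumes "A \<in> Obj C"
  shows "Bang C A \<in> Arr C" "Dom C (Bang C A) = A" "Cod C (Bang C A) = One C"
  using Bang_in_hom[OF assms] by (simp_all add: in_hom)

lemma bang_comp [simp]: "f \<in> Arr C \<Longrightarrow> A = Cod C f \<Longrightarrow> Bang C A \<cdot> f = Bang C (Dom C f)"
  by (rule Bang_unique) (simp add: in_hom)

lemma fst_arr [simp]:
  assumes "A \<in> Obj C" "B \<in> Obj C"
  shows "Fst C A B \<in> Arr C" "Dom C (Fst C A B) = Prod C A B" "Cod C (Fst C A B) = A"
  using Fst_in_hom[OF assms] by (simp_all add: in_hom)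

lemma snd_arr [simp]:
  assumes "A \<in> Obj C" "B \<in> Obj C"
  shows "Snd C A B \<in> Arr C" "Dom C (Snd C A B) = Prod C A B" "Cod C (Snd C A B) = B"
  using Snd_in_hom[OF assms] by (simp_all add: in_hom)

lemma tuple_arr [simp]:
  assumes "f \<in> Arr C" "g \<in> Arr C" "Dom C f = Dom C g"
  shows "Tuple C f g \<in> Arr C" "Dom C (Tuple C f g) = Dom C g"
    "Cod C (Tuple C f g) = Prod C (Cod C f) (Cod C g)"
  using Tuple_in_hom[of f "Dom C g" "Cod C f" g "Cod C g"] assms by (simp_all add: in_hom)

lemma fst_tuple [simp]:
  "f \<in> Arr C \<Longrightarrow> g \<in> Arr C \<Longrightarrow> Dom C f = Dom C g \<Longrightarrow> A = Cod C f \<Longrightarrow> B = Cod C g \<Longrightarrow>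
    Fst C A B \<cdot> Tuple C f g = f"
  using Fst_Tuple[of f "Dom C g" "Cod C f" g "Cod C g"] by (simp_all add: in_hom)

lemma snd_tuple [simp]:
  "f \<in> Arr C \<Longrightarrow> g \<in> Arr C \<Longrightarrow> Dom C f = Dom C g \<Longrightarrow> A = Cod C f \<Longrightarrow> B = Cod C g \<Longrightarrow>
    Snd C A B \<cdot> Tuple C f g = g"
  using Snd_Tuple[of f "Dom C g" "Cod C f" g "Cod C g"] by (simp_all add: in_hom)

lemma tuple_eta [simp]:
  "h \<in> Arr C \<Longrightarrow> A \<in> Obj C \<Longrightarrow> B \<in> Obj C \<Longrightarrow> Cod C h = Prod C A B \<Longrightarrow>
    Tuple C (Fst C A B \<cdot> h) (Snd C A B \<cdot> h) = h"
  using Tuple_unique[of A B h "Dom C h"] by (simp add: in_hom)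

lemma tuple_fst_snd [simp]:
  "A \<in> Obj C \<Longrightarrow> B \<in> Obj C \<Longrightarrow> Tuple C (Fst C A B) (Snd C A B) = Ident C (Prod C A B)"
  using tuple_eta[of "Ident C (Prod C A B)" A B] by simp

lemma tuple_comp [simp]:
  assumes "f \<in> Arr C" "g \<in> Arr C" "h \<in> Arr C" "Dom C f = Dom C g" "Dom C g = Cod C h"
  shows "Tuple C f g \<cdot> h = Tuple C (f \<cdot> h) (g \<cdot> h)"
proof -
  have "Tuple C (Fst C (Cod C f) (Cod C g) \<cdot> (Tuple C f g \<cdot> h)) (Snd C (Cod C f) (Cod C g) \<cdot> (Tuple C f g \<cdot> h))
     = Tuple C f g \<cdot> h"
    by (rule tuple_eta) (use assms in simp_all)
  moreover have "Fst C (Cod C f) (Cod C g) \<cdot> (Tuple C f g \<cdot> h) = f \<cdot> h"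
    "Snd C (Cod C f) (Cod C g) \<cdot> (Tuple C f g \<cdot> h) = g \<cdot> h"
    by (subst assoc[symmetric]; use assms in simp)+
  ultimately show ?thesis by simp
qed

lemma ev_arr [simp]:
  assumes "A \<in> Obj C" "B \<in> Obj C"
  shows "Ev C A B \<in> Arr C" "Dom C (Ev C A B) = Prod C (Exp C A B) A" "Cod C (Ev C A B) = B"
  using Ev_in_hom[OF assms] by (simp_all add: in_hom)

lemma curry_arr [simp]:
  assumes "X \<in> Obj C" "A \<in> Obj C" "f \<in> Arr C" "Dom C f = Prod C X A"
  shows "Curry C X A f \<in> Arr C" "Dom C (Curry C X A f) = X" "Cod C (Curry C X A f) = Exp C A (Cod C f)"
  using Curry_in_hom[of X A f "Cod C f"] assms by (simp_all add: in_hom)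

text \<open>Beta for exponentials at a generalized element, in the shape to which
  \<open>tuple_comp\<close> brings it.\<close>

lemma ev_curry:
  assumes "X \<in> Obj C" "A \<in> Obj C" "f \<in> Arr C" "Dom C f = Prod C X A" "B = Cod C f"
    "u \<in> Arr C" "a \<in> Arr C" "Cod C u = X" "Cod C a = A" "Dom C u = Dom C a"
  shows "Ev C A B \<cdot> Tuple C (Curry C X A f \<cdot> u) a = f \<cdot> Tuple C u a"
proof -
  have "Ev C A B \<cdot> Tuple C (Curry C X A f \<cdot> Fst C X A) (Snd C X A) = f"
    using Ev_Curry[of X A f B] assms by (simp add: in_hom)
  then have "(Ev C A B \<cdot> Tuple C (Curry C X A f \<cdot> Fst C X A) (Snd C X A)) \<cdot> Tuple C u a = f \<cdot> Tuple C u a"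
    by simp
  then show ?thesis using assms by simp
qed

lemma curry_ev:
  assumes "X \<in> Obj C" "A \<in> Obj C" "B \<in> Obj C" "g \<in> Arr C" "Dom C g = X" "Cod C g = Exp C A B"
  shows "Curry C X A (Ev C A B \<cdot> Tuple C (g \<cdot> Fst C X A) (Snd C X A)) = g"
  using Curry_unique[of A B g X] assms by (simp add: in_hom)

text \<open>Substitution under an abstraction: eta-expand the composite, then reduce inside.\<close>

lemma curry_comp:
  assumes "X \<in> Obj C" "A \<in> Obj C" "f \<in> Arr C" "Dom C f = Prod C X A" "h \<in> Arr C" "Cod C h = X"
  shows "Curry C X A f \<cdot> h = Curry C (Dom C h) A (f \<cdot> Tuple C (h \<cdot> Fst C (Dom C h) A) (Snd C (Dom C h) A))"
proof -
  let ?Y = "Dom C h" and ?B = "Cod C f"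
  have "Curry C ?Y A (Ev C A ?B \<cdot> Tuple C ((Curry C X A f \<cdot> h) \<cdot> Fst C ?Y A) (Snd C ?Y A)) = Curry C X A f \<cdot> h"
    by (rule curry_ev) (use assms in simp_all)
  then show ?thesis using assms by (simp add: ev_curry)
qed

end


section \<open>The binding operation of a strong monad\<close>

text \<open>\<open>bind P A B f m\<close> is the interpretation of \<open>do x \<leftarrow> m; f\<close> in the context \<open>P\<close>.\<close>

definition (in strong_monad) bind :: "'o \<Rightarrow> 'o \<Rightarrow> 'o \<Rightarrow> 'm \<Rightarrow> 'm \<Rightarrow> 'm" where
  "bind P A B f m = Mult M B \<cdot> (MArr M f \<cdot> (Str M P A \<cdot> Tuple C (Ident C P) m))"

context strong_monad
begin

lemma mobj [simp]: "A \<in> Obj C \<Longrightarrow> MObj M A \<in> Obj C"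
  using cat_functor.FObj_in_Obj[OF endofunctor] by simp

lemma marr_arr [simp]:
  assumes "f \<in> Arr C"
  shows "MArr M f \<in> Arr C" "Dom C (MArr M f) = MObj M (Dom C f)" "Cod C (MArr M f) = MObj M (Cod C f)"
  using cat_functor.FArr_in_hom[OF endofunctor, of f "Dom C f" "Cod C f"] assms by (simp_all add: in_hom)

lemma marr_ident [simp]: "A \<in> Obj C \<Longrightarrow> MArr M (Ident C A) = Ident C (MObj M A)"
  using cat_functor.FArr_Ident[OF endofunctor] by simp

lemma marr_comp:
  "f \<in> Arr C \<Longrightarrow> g \<in> Arr C \<Longrightarrow> Dom C g = Cod C f \<Longrightarrow> MArr M (g \<cdot> f) = MArr M g \<cdot> MArr M f"
  using cat_functor.FArr_Comp[OF endofunctor, of f "Dom C f" "Cod C f" g "Cod C g"] by (simp add: in_hom)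

lemma marr_comp_tail:
  "f \<in> Arr C \<Longrightarrow> g \<in> Arr C \<Longrightarrow> z \<in> Arr C \<Longrightarrow> Dom C g = Cod C f \<Longrightarrow> Cod C z = MObj M (Dom C f) \<Longrightarrow>
    MArr M g \<cdot> (MArr M f \<cdot> z) = MArr M (g \<cdot> f) \<cdot> z"
  by (simp add: marr_comp)

lemma unit_arr [simp]:
  assumes "A \<in> Obj C"
  shows "Unit M A \<in> Arr C" "Dom C (Unit M A) = A" "Cod C (Unit M A) = MObj M A"
  using Unit_in_hom[OF assms] by (simp_all add: in_hom)

lemma mult_arr [simp]:
  assumes "A \<in> Obj C"
  shows "Mult M A \<in> Arr C" "Dom C (Mult M A) = MObj M (MObj M A)" "Cod C (Mult M A) = MObj M A"
  using Mult_in_hom[OF assms] by (simp_all add: in_hom)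

lemma str_arr [simp]:
  assumes "A \<in> Obj C" "B \<in> Obj C"
  shows "Str M A B \<in> Arr C" "Dom C (Str M A B) = Prod C A (MObj M B)"
    "Cod C (Str M A B) = MObj M (Prod C A B)"
  using Str_in_hom[OF assms] by (simp_all add: in_hom)

text \<open>Composites are kept nested to the right, so a law applies inside one only if it carries
  a tail \<open>z\<close>. The laws of the multiplication are restated likewise.\<close>

lemma unit_nat:
  assumes "f \<in> Arr C" "z \<in> Arr C" "A = Dom C f" "Cod C z = A"
  shows "MArr M f \<cdot> (Unit M A \<cdot> z) = Unit M (Cod C f) \<cdot> (f \<cdot> z)"
proof -
  have "(MArr M f \<cdot> Unit M A) \<cdot> z = (Unit M (Cod C f) \<cdot> f) \<cdot> z"
    using Unit_natural[of f "Dom C f" "Cod C f"] assms by (simp add: in_hom)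
  then show ?thesis using assms by simp
qed

lemma mult_nat:
  assumes "f \<in> Arr C" "z \<in> Arr C" "A = Dom C f" "Cod C z = MObj M (MObj M A)"
  shows "MArr M f \<cdot> (Mult M A \<cdot> z) = Mult M (Cod C f) \<cdot> (MArr M (MArr M f) \<cdot> z)"
proof -
  have "(MArr M f \<cdot> Mult M A) \<cdot> z = (Mult M (Cod C f) \<cdot> MArr M (MArr M f)) \<cdot> z"
    using Mult_natural[of f "Dom C f" "Cod C f"] assms by (simp add: in_hom)
  then show ?thesis using assms by simp
qed

lemma mult_unit:
  assumes "A \<in> Obj C" "z \<in> Arr C" "Cod C z = MObj M A" "B = MObj M A"
  shows "Mult M A \<cdot> (Unit M B \<cdot> z) = z"
proof -
  have "(Mult M A \<cdot> Unit M (MObj M A)) \<cdot> z = z" using Mult_Unit[of A] assms by simp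
  then show ?thesis using assms by simp
qed

lemma mult_marr_unit:
  assumes "A \<in> Obj C" "z \<in> Arr C" "Cod C z = MObj M A"
  shows "Mult M A \<cdot> (MArr M (Unit M A) \<cdot> z) = z"
proof -
  have "(Mult M A \<cdot> MArr M (Unit M A)) \<cdot> z = z" using Mult_MArr_Unit[of A] assms by simp
  then show ?thesis using assms by simp
qed

lemma mult_mult:
  assumes "A \<in> Obj C" "z \<in> Arr C" "Cod C z = MObj M (MObj M (MObj M A))" "B = MObj M A"
  shows "Mult M A \<cdot> (Mult M B \<cdot> z) = Mult M A \<cdot> (MArr M (Mult M A) \<cdot> z)"
proof -
  have "(Mult M A \<cdot> Mult M (MObj M A)) \<cdot> z = (Mult M A \<cdot> MArr M (Mult M A)) \<cdot> z"
    using Mult_assoc[of A] assms by simp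
  then show ?thesis using assms by simp
qed

text \<open>In \<open>bind\<close> the strength always meets a tuple, so its laws are evaluated at
  generalized elements instead of being stated with \<open>cross\<close>.\<close>

lemma str_nat:
  assumes "h \<in> Arr C" "g \<in> Arr C" "u \<in> Arr C" "y \<in> Arr C" "P = Dom C h" "Cod C u = P"
    "A = Dom C g" "Cod C y = MObj M A" "Dom C u = Dom C y"
  shows "Str M (Cod C h) (Cod C g) \<cdot> Tuple C (h \<cdot> u) (MArr M g \<cdot> y) =
    MArr M (Tuple C (h \<cdot> Fst C P A) (g \<cdot> Snd C P A)) \<cdot> (Str M P A \<cdot> Tuple C u y)"
proof -
  have "(Str M (Cod C h) (Cod C g) \<cdot> cross C h (MArr M g)) \<cdot> Tuple C u y =
      (MArr M (cross C h g) \<cdot> Str M P A) \<cdot> Tuple C u y"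
    using Str_natural[of h "Dom C h" "Cod C h" g "Dom C g" "Cod C g"] assms by (simp add: in_hom)
  then show ?thesis using assms by (simp add: cross_def)
qed

lemma str_nat_left:
  assumes "h \<in> Arr C" "u \<in> Arr C" "y \<in> Arr C" "A \<in> Obj C" "P = Dom C h" "Cod C u = P"
    "Cod C y = MObj M A" "Dom C u = Dom C y"
  shows "Str M (Cod C h) A \<cdot> Tuple C (h \<cdot> u) y =
    MArr M (Tuple C (h \<cdot> Fst C P A) (Snd C P A)) \<cdot> (Str M P A \<cdot> Tuple C u y)"
  using str_nat[of h "Ident C A" u y P A] assms by simp

lemma str_nat_right:
  assumes "g \<in> Arr C" "u \<in> Arr C" "y \<in> Arr C" "Cod C u = P" "B = Cod C g"
    "A = Dom C g" "Cod C y = MObj M A" "Dom C u = Dom C y"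
  shows "Str M P B \<cdot> Tuple C u (MArr M g \<cdot> y) =
    MArr M (Tuple C (Fst C P A) (g \<cdot> Snd C P A)) \<cdot> (Str M P A \<cdot> Tuple C u y)"
proof -
  have "P \<in> Obj C" using assms(2,4) by auto
  then show ?thesis using str_nat[of "Ident C P" g u y P A] assms by simp
qed

lemma str_unit:
  assumes "u \<in> Arr C" "a \<in> Arr C" "Cod C u = P" "Cod C a = A" "Dom C u = Dom C a"
  shows "Str M P A \<cdot> Tuple C u (Unit M A \<cdot> a) = Unit M (Prod C P A) \<cdot> Tuple C u a"
proof -
  have PA: "P \<in> Obj C" "A \<in> Obj C" using assms by auto
  have "(Str M P A \<cdot> cross C (Ident C P) (Unit M A)) \<cdot> Tuple C u a = Unit M (Prod C P A) \<cdot> Tuple C u a"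
    using Str_Unit[of P A] PA by simp
  then show ?thesis using assms PA by (simp add: cross_def)
qed

lemma str_mult:
  assumes "u \<in> Arr C" "x \<in> Arr C" "Cod C u = P" "A \<in> Obj C" "Cod C x = MObj M (MObj M A)" "Dom C u = Dom C x"
  shows "Str M P A \<cdot> Tuple C u (Mult M A \<cdot> x) =
    Mult M (Prod C P A) \<cdot> (MArr M (Str M P A) \<cdot> (Str M P (MObj M A) \<cdot> Tuple C u x))"
proof -
  have PA: "P \<in> Obj C" "A \<in> Obj C" using assms by auto
  have "(Str M P A \<cdot> cross C (Ident C P) (Mult M A)) \<cdot> Tuple C u x =
      (Mult M (Prod C P A) \<cdot> MArr M (Str M P A) \<cdot> Str M P (MObj M A)) \<cdot> Tuple C u x"
    using Str_Mult[of P A] PA by simp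
  then show ?thesis using assms PA by (simp add: cross_def)
qed

lemma str_assoc:
  assumes "u \<in> Arr C" "v \<in> Arr C" "y \<in> Arr C" "Cod C u = P" "Cod C v = Q" "A \<in> Obj C"
    "Cod C y = MObj M A" "Dom C u = Dom C y" "Dom C v = Dom C y"
  shows "Str M P (Prod C Q A) \<cdot> Tuple C u (Str M Q A \<cdot> Tuple C v y) =
    MArr M (prod_assoc C P Q A) \<cdot> (Str M (Prod C P Q) A \<cdot> Tuple C (Tuple C u v) y)"
proof -
  have PA: "P \<in> Obj C" "Q \<in> Obj C" "A \<in> Obj C" using assms by auto
  have "(MArr M (prod_assoc C P Q A) \<cdot> Str M (Prod C P Q) A) \<cdot> Tuple C (Tuple C u v) y =
     (Str M P (Prod C Q A) \<cdot> cross C (Ident C P) (Str M Q A) \<cdot> prod_assoc C P Q (MObj M A))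
       \<cdot> Tuple C (Tuple C u v) y"
    using Str_assoc[of P Q A] PA by simp
  then show ?thesis using assms PA by (simp add: cross_def prod_assoc_def)
qed

text \<open>\<open>Str_One\<close> treats the context \<open>1\<close> only; an arbitrary
  \<open>P\<close> is reached by naturality along \<open>Bang C P\<close>.\<close>

lemma str_snd:
  assumes "u \<in> Arr C" "y \<in> Arr C" "Cod C u = P" "A \<in> Obj C" "Cod C y = MObj M A" "Dom C u = Dom C y"
  shows "MArr M (Snd C P A) \<cdot> (Str M P A \<cdot> Tuple C u y) = y"
proof -
  have P: "P \<in> Obj C" using assms by auto
  \<comment> \<open>Collapsing \<open>Bang C P \<cdot> u\<close> would hide the factor along which
    \<open>str_nat_left\<close> is applied, hence the deleted rule.\<close>
  have "(MArr M (Snd C (One C) A) \<cdot> Str M (One C) A) \<cdot> Tuple C (Bang C P \<cdot> u) y = y"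
    using Str_One[of A] assms P by (simp del: bang_comp)
  then have F: "MArr M (Snd C (One C) A) \<cdot> (Str M (Cod C (Bang C P)) A \<cdot> Tuple C (Bang C P \<cdot> u) y) = y"
    using assms P by (simp del: bang_comp)
  have "Str M (Cod C (Bang C P)) A \<cdot> Tuple C (Bang C P \<cdot> u) y =
      MArr M (Tuple C (Bang C P \<cdot> Fst C P A) (Snd C P A)) \<cdot> (Str M P A \<cdot> Tuple C u y)"
    by (rule str_nat_left) (use assms P in simp_all)
  note F = F[unfolded this]
  have "MArr M (Snd C (One C) A) \<cdot> (MArr M (Tuple C (Bang C P \<cdot> Fst C P A) (Snd C P A))
      \<cdot> (Str M P A \<cdot> Tuple C u y)) =
      MArr M (Snd C (One C) A \<cdot> Tuple C (Bang C P \<cdot> Fst C P A) (Snd C P A)) \<cdot> (Str M P A \<cdot> Tuple C u y)"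
    by (rule marr_comp_tail) (use assms P in simp_all)
  with F show ?thesis using assms P by simp
qed

lemma bind_arr [simp]:
  assumes "P \<in> Obj C" "A \<in> Obj C" "B \<in> Obj C" "f \<in> Arr C" "Dom C f = Prod C P A" "Cod C f = MObj M B"
    "m \<in> Arr C" "Dom C m = P" "Cod C m = MObj M A"
  shows "bind P A B f m \<in> Arr C" "Dom C (bind P A B f m) = P" "Cod C (bind P A B f m) = MObj M B"
  using assms by (simp_all add: bind_def)

text \<open>Substitution into a \<open>do\<close>, by naturality of the strength in the
  context.\<close>

lemma bind_comp:
  assumes "P \<in> Obj C" "A \<in> Obj C" "B \<in> Obj C" "f \<in> Arr C" "Dom C f = Prod C P A" "Cod C f = MObj M B"
    "m \<in> Arr C" "Dom C m = P" "Cod C m = MObj M A" "h \<in> Arr C" "Cod C h = P"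
  shows "bind P A B f m \<cdot> h =
    bind (Dom C h) A B (f \<cdot> Tuple C (h \<cdot> Fst C (Dom C h) A) (Snd C (Dom C h) A)) (m \<cdot> h)"
proof -
  have "Str M (Cod C h) A \<cdot> Tuple C (h \<cdot> Ident C (Dom C h)) (m \<cdot> h) =
    MArr M (Tuple C (h \<cdot> Fst C (Dom C h) A) (Snd C (Dom C h) A)) \<cdot>
      (Str M (Dom C h) A \<cdot> Tuple C (Ident C (Dom C h)) (m \<cdot> h))"
    by (rule str_nat_left) (use assms in simp_all)
  then show ?thesis using assms by (simp add: bind_def marr_comp)
qed

lemma bind_unit_left:
  assumes "P \<in> Obj C" "B \<in> Obj C" "f \<in> Arr C" "Dom C f = Prod C P A" "Cod C f = MObj M B"
    "a \<in> Arr C" "Dom C a = P" "Cod C a = A"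
  shows "bind P A B f (Unit M A \<cdot> a) = f \<cdot> Tuple C (Ident C P) a"
  unfolding bind_def by (subst str_unit, (use assms in simp)+, subst unit_nat, (use assms in \<open>simp; fail\<close>)+)
    (subst mult_unit, (use assms in \<open>simp; fail\<close>)+)

lemma bind_unit_right:
  assumes "P \<in> Obj C" "A \<in> Obj C" "m \<in> Arr C" "Dom C m = P" "Cod C m = MObj M A"
  shows "bind P A A (Unit M A \<cdot> Snd C P A) m = m"
proof -
  have "bind P A A (Unit M A \<cdot> Snd C P A) m =
    Mult M A \<cdot> (MArr M (Unit M A) \<cdot> (MArr M (Snd C P A) \<cdot> (Str M P A \<cdot> Tuple C (Ident C P) m)))"
    using assms by (simp add: bind_def marr_comp)
  also have "\<dots> = MArr M (Snd C P A) \<cdot> (Str M P A \<cdot> Tuple C (Ident C P) m)"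
    by (rule mult_marr_unit) (use assms in simp_all)
  also have "\<dots> = m" by (rule str_snd) (use assms in simp_all)
  finally show ?thesis .
qed

text \<open>With \<open>bind_str\<close>, this evaluates a bound term that is an image under the
  functor or a strength: the map moves into the body.\<close>

lemma bind_marr:
  assumes "P \<in> Obj C" "B \<in> Obj C" "f \<in> Arr C" "Dom C f = Prod C P A'" "Cod C f = MObj M B"
    "k \<in> Arr C" "Dom C k = A" "Cod C k = A'" "m \<in> Arr C" "Dom C m = P" "Cod C m = MObj M A"
  shows "bind P A' B f (MArr M k \<cdot> m) = bind P A B (f \<cdot> Tuple C (Fst C P A) (k \<cdot> Snd C P A)) m"
proof -
  have "Str M P A' \<cdot> Tuple C (Ident C P) (MArr M k \<cdot> m) =
    MArr M (Tuple C (Fst C P A) (k \<cdot> Snd C P A)) \<cdot> (Str M P A \<cdot> Tuple C (Ident C P) m)"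
    by (rule str_nat_right) (use assms in simp_all)
  moreover have "A \<in> Obj C" using assms by auto
  ultimately show ?thesis using assms by (simp add: bind_def marr_comp)
qed

lemma bind_str:
  assumes "P \<in> Obj C" "B \<in> Obj C" "D \<in> Obj C" "f \<in> Arr C" "Dom C f = Prod C P (Prod C A B)"
    "Cod C f = MObj M D" "a \<in> Arr C" "Dom C a = P" "Cod C a = A"
    "m \<in> Arr C" "Dom C m = P" "Cod C m = MObj M B"
  shows "bind P (Prod C A B) D f (Str M A B \<cdot> Tuple C a m) =
    bind P B D (f \<cdot> Tuple C (Fst C P B) (Tuple C (a \<cdot> Fst C P B) (Snd C P B))) m"
proof -
  have A: "A \<in> Obj C" using assms by auto
  have "Str M P (Prod C A B) \<cdot> Tuple C (Ident C P) (Str M A B \<cdot> Tuple C a m) =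
    MArr M (prod_assoc C P A B) \<cdot> (Str M (Prod C P A) B \<cdot> Tuple C (Tuple C (Ident C P) a) m)"
    by (rule str_assoc) (use assms in simp_all)
  \<comment> \<open>The identity is inserted to produce the shape of
    \<open>str_nat_left\<close>.\<close>
  also have "Str M (Prod C P A) B \<cdot> Tuple C (Tuple C (Ident C P) a) m =
     Str M (Cod C (Tuple C (Ident C P) a)) B \<cdot> Tuple C (Tuple C (Ident C P) a \<cdot> Ident C P) m"
    using assms by simp
  also have "\<dots> = MArr M (Tuple C (Tuple C (Ident C P) a \<cdot> Fst C P B) (Snd C P B)) \<cdot>
      (Str M P B \<cdot> Tuple C (Ident C P) m)"
    by (rule str_nat_left) (use assms in simp_all)
  also have "MArr M (prod_assoc C P A B) \<cdot> \<dots> =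
     MArr M (Tuple C (Fst C P B) (Tuple C (a \<cdot> Fst C P B) (Snd C P B))) \<cdot>
      (Str M P B \<cdot> Tuple C (Ident C P) m)"
    by (subst marr_comp_tail) (use assms A in \<open>simp_all add: prod_assoc_def\<close>)
  finally show ?thesis using assms A by (simp add: bind_def marr_comp)
qed

text \<open>Both \<open>n\<close> and \<open>p\<close> use the context \<open>P\<close>. The
  strength in front of \<open>n\<close> keeps a copy of it, by \<open>str_assoc\<close> along the
  diagonal of \<open>P\<close>; \<open>str_mult\<close> then brings out the inner multiplication,
  and \<open>mult_mult\<close> rearranges the two.\<close>

lemma bind_assoc:
  assumes "P \<in> Obj C" "A \<in> Obj C" "B \<in> Obj C" "D \<in> Obj C"
    "m \<in> Arr C" "Dom C m = P" "Cod C m = MObj M A"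
    "n \<in> Arr C" "Dom C n = Prod C P A" "Cod C n = MObj M B"
    "p \<in> Arr C" "Dom C p = Prod C P B" "Cod C p = MObj M D"
  shows "bind P B D p (bind P A B n m) = bind P A D (bind (Prod C P A) B D
     (p \<cdot> Tuple C (Fst C P A \<cdot> Fst C (Prod C P A) B) (Snd C (Prod C P A) B)) n) m"
proof -
  let ?y = "Str M P A \<cdot> Tuple C (Ident C P) m"
  let ?w = "MArr M p \<cdot> (Str M P B \<cdot> Tuple C (Fst C P A) n)"
  have "Str M P (MObj M B) \<cdot> Tuple C (Ident C P) (MArr M n \<cdot> ?y) =
    MArr M (Tuple C (Fst C P (Prod C P A)) (n \<cdot> Snd C P (Prod C P A))) \<cdot>
      (Str M P (Prod C P A) \<cdot> Tuple C (Ident C P) ?y)"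
    by (rule str_nat_right) (use assms in simp_all)
  also have "Str M P (Prod C P A) \<cdot> Tuple C (Ident C P) ?y =
    MArr M (prod_assoc C P P A) \<cdot> (Str M (Prod C P P) A \<cdot> Tuple C (Tuple C (Ident C P) (Ident C P)) m)"
    by (rule str_assoc) (use assms in simp_all)
  also have "Str M (Prod C P P) A \<cdot> Tuple C (Tuple C (Ident C P) (Ident C P)) m =
     Str M (Cod C (Tuple C (Ident C P) (Ident C P))) A \<cdot> Tuple C (Tuple C (Ident C P) (Ident C P) \<cdot> Ident C P) m"
    using assms by simp
  also have "\<dots> = MArr M (Tuple C (Tuple C (Ident C P) (Ident C P) \<cdot> Fst C P A) (Snd C P A)) \<cdot> ?y"
    by (rule str_nat_left) (use assms in simp_all)
  also have "MArr M (prod_assoc C P P A) \<cdot> \<dots> =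
     MArr M (Tuple C (Fst C P A) (Ident C (Prod C P A))) \<cdot> ?y"
    by (subst marr_comp_tail) (use assms in \<open>simp_all add: prod_assoc_def\<close>)
  also have "MArr M (Tuple C (Fst C P (Prod C P A)) (n \<cdot> Snd C P (Prod C P A))) \<cdot> \<dots> =
     MArr M (Tuple C (Fst C P A) n) \<cdot> ?y"
    by (subst marr_comp_tail) (use assms in simp_all)
  finally have 1: "Str M P (MObj M B) \<cdot> Tuple C (Ident C P) (MArr M n \<cdot> ?y) =
     MArr M (Tuple C (Fst C P A) n) \<cdot> ?y" .
  have "bind P B D p (bind P A B n m) =
     Mult M D \<cdot> (MArr M p \<cdot> (Str M P B \<cdot> Tuple C (Ident C P) (Mult M B \<cdot> (MArr M n \<cdot> ?y))))"
    by (simp add: bind_def)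
  also have "Str M P B \<cdot> Tuple C (Ident C P) (Mult M B \<cdot> (MArr M n \<cdot> ?y)) =
     Mult M (Prod C P B) \<cdot> (MArr M (Str M P B) \<cdot> (MArr M (Tuple C (Fst C P A) n) \<cdot> ?y))"
    unfolding 1[symmetric] by (rule str_mult) (use assms in simp_all)
  also have "MArr M p \<cdot> \<dots> = Mult M (MObj M D) \<cdot> (MArr M (MArr M p) \<cdot>
     (MArr M (Str M P B) \<cdot> (MArr M (Tuple C (Fst C P A) n) \<cdot> ?y)))"
    by (subst mult_nat) (use assms in simp_all)
  also have "\<dots> = Mult M (MObj M D) \<cdot> (MArr M ?w \<cdot> ?y)"
    using assms by (simp add: marr_comp)
  also have "Mult M D \<cdot> \<dots> = Mult M D \<cdot> (MArr M (Mult M D) \<cdot> (MArr M ?w \<cdot> ?y))"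
    by (rule mult_mult) (use assms in simp_all)
  also have "\<dots> = Mult M D \<cdot> (MArr M (Mult M D \<cdot> ?w) \<cdot> ?y)"
    using assms by (simp add: marr_comp)
  also have "Mult M D \<cdot> ?w = bind (Prod C P A) B D
     (p \<cdot> Tuple C (Fst C P A \<cdot> Fst C (Prod C P A) B) (Snd C (Prod C P A) B)) n"
  proof -
    have "Str M (Cod C (Fst C P A)) B \<cdot> Tuple C (Fst C P A \<cdot> Ident C (Prod C P A)) n =
      MArr M (Tuple C (Fst C P A \<cdot> Fst C (Prod C P A) B) (Snd C (Prod C P A) B)) \<cdot>
        (Str M (Prod C P A) B \<cdot> Tuple C (Ident C (Prod C P A)) n)"
      by (rule str_nat_left) (use assms in simp_all)
    then show ?thesis using assms by (simp add: bind_def marr_comp)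
  qed
  finally show ?thesis by (simp add: bind_def)
qed

text \<open>
  The two orders of binding are obtained by binding \<open>q\<close>, which is \<open>f\<close> with its two bound variables
  paired, to the two sides \<open>d1\<close> and \<open>d2\<close> of the identity that defines a central cone.
\<close>

lemma bind_central:
  assumes "P \<in> Obj C" "A \<in> Obj C" "B \<in> Obj C" "D \<in> Obj C" and cone: "central_cone C M A Z i"
    and "m \<in> Arr C" "Dom C m = P" "Cod C m = Z"
    and "n \<in> Arr C" "Dom C n = P" "Cod C n = MObj M B"
    and "f \<in> Arr C" "Dom C f = Prod C (Prod C P A) B" "Cod C f = MObj M D"
  shows "bind P A D (bind (Prod C P A) B D f (n \<cdot> Fst C P A)) (i \<cdot> m) =
    bind P B D (bind (Prod C P B) A D
      (f \<cdot> Tuple C (Tuple C (Fst C P B \<cdot> Fst C (Prod C P B) A) (Snd C (Prod C P B) A))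
         (Snd C P B \<cdot> Fst C (Prod C P B) A)) ((i \<cdot> m) \<cdot> Fst C P B)) n"
proof -
  define x where "x = i \<cdot> m"
  have i: "i \<in> Arr C" "Dom C i = Z" "Cod C i = MObj M A"
    using cone by (simp_all add: central_cone_def in_hom)
  then have Z: "Z \<in> Obj C" by auto
  have x: "x \<in> Arr C" "Dom C x = P" "Cod C x = MObj M A" using assms i by (simp_all add: x_def)
  let ?PA = "Prod C P A" and ?PB = "Prod C P B" and ?AB = "Prod C A B"
  define q where "q = f \<cdot> Tuple C (Tuple C (Fst C P ?AB) (Fst C A B \<cdot> Snd C P ?AB)) (Snd C A B \<cdot> Snd C P ?AB)"
  have q: "q \<in> Arr C" "Dom C q = Prod C P ?AB" "Cod C q = MObj M D" using assms by (simp_all add: q_def)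
  have rs: "right_str C M A B = MArr M (prod_swap C B A) \<cdot> (Str M B A \<cdot> prod_swap C (MObj M A) B)"
    "right_str C M A (MObj M B) =
       MArr M (prod_swap C (MObj M B) A) \<cdot> (Str M (MObj M B) A \<cdot> prod_swap C (MObj M A) (MObj M B))"
    by (simp_all add: right_str_def)
  have rs_arr: "right_str C M A B \<in> Arr C" "Dom C (right_str C M A B) = Prod C (MObj M A) B"
     "Cod C (right_str C M A B) = MObj M ?AB"
    using assms by (simp_all add: rs prod_swap_def)
  let ?d1 = "bind P A ?AB (Str M A B \<cdot> Tuple C (Snd C P A) (n \<cdot> Fst C P A)) x"
  let ?d2 = "bind P B ?AB (right_str C M A B \<cdot> Tuple C (x \<cdot> Fst C P B) (Snd C P B)) n"
  have d2: "Mult M ?AB \<cdot> (MArr M (right_str C M A B) \<cdot> (Str M (MObj M A) B \<cdot> Tuple C x n)) = ?d2"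
  proof -
    have "Str M (Cod C x) B \<cdot> Tuple C (x \<cdot> Ident C P) n =
       MArr M (Tuple C (x \<cdot> Fst C P B) (Snd C P B)) \<cdot> (Str M P B \<cdot> Tuple C (Ident C P) n)"
      by (rule str_nat_left) (use assms x in simp_all)
    then show ?thesis using assms x rs_arr by (simp add: bind_def marr_comp)
  qed
  have d1: "Mult M ?AB \<cdot> (MArr M (Str M A B) \<cdot> (right_str C M A (MObj M B) \<cdot> Tuple C x n)) = ?d1"
  proof -
    have "right_str C M A (MObj M B) \<cdot> Tuple C x n =
        MArr M (prod_swap C (MObj M B) A) \<cdot> (Str M (Cod C n) A \<cdot> Tuple C (n \<cdot> Ident C P) x)"
      using assms x by (simp add: rs prod_swap_def)
    also have "Str M (Cod C n) A \<cdot> Tuple C (n \<cdot> Ident C P) x =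
       MArr M (Tuple C (n \<cdot> Fst C P A) (Snd C P A)) \<cdot> (Str M P A \<cdot> Tuple C (Ident C P) x)"
      by (rule str_nat_left) (use assms x in simp_all)
    also have "MArr M (prod_swap C (MObj M B) A) \<cdot> \<dots> =
       MArr M (Tuple C (Snd C P A) (n \<cdot> Fst C P A)) \<cdot> (Str M P A \<cdot> Tuple C (Ident C P) x)"
      by (subst marr_comp_tail) (use assms x in \<open>simp_all add: prod_swap_def\<close>)
    finally show ?thesis using assms x by (simp add: bind_def marr_comp)
  qed
  \<comment> \<open>The identity of the central cone, precomposed with the pair of \<open>m\<close>
    and \<open>n\<close>.\<close>
  have "(Mult M ?AB \<cdot> (MArr M (right_str C M A B) \<cdot> (Str M (MObj M A) B \<cdot> cross C i (Ident C (MObj M B)))))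
      \<cdot> Tuple C m n
    = (Mult M ?AB \<cdot> (MArr M (Str M A B) \<cdot> (right_str C M A (MObj M B) \<cdot> cross C i (Ident C (MObj M B)))))
      \<cdot> Tuple C m n"
    using cone assms by (simp add: central_cone_def)
  moreover have "right_str C M A (MObj M B) \<in> Arr C" "Dom C (right_str C M A (MObj M B)) =
      Prod C (MObj M A) (MObj M B)" "Cod C (right_str C M A (MObj M B)) = MObj M (Prod C A (MObj M B))"
    using assms by (simp_all add: rs prod_swap_def)
  moreover have "cross C i (Ident C (MObj M B)) \<in> Arr C"
    "Dom C (cross C i (Ident C (MObj M B))) = Prod C Z (MObj M B)"
    "Cod C (cross C i (Ident C (MObj M B))) = Prod C (MObj M A) (MObj M B)"
    "cross C i (Ident C (MObj M B)) \<cdot> Tuple C m n = Tuple C x n"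
    using assms i Z by (simp_all add: cross_def x_def)
  ultimately have d: "?d1 = ?d2" unfolding d1[symmetric] d2[symmetric] using assms i Z rs_arr
    by (simp del: tuple_comp)
  have "bind P ?AB D q ?d1 = bind P A D (bind ?PA ?AB D
      (q \<cdot> Tuple C (Fst C P A \<cdot> Fst C ?PA ?AB) (Snd C ?PA ?AB))
      (Str M A B \<cdot> Tuple C (Snd C P A) (n \<cdot> Fst C P A))) x"
    by (rule bind_assoc) (use assms x q in simp_all)
  also have "bind ?PA ?AB D (q \<cdot> Tuple C (Fst C P A \<cdot> Fst C ?PA ?AB) (Snd C ?PA ?AB))
      (Str M A B \<cdot> Tuple C (Snd C P A) (n \<cdot> Fst C P A)) = bind ?PA B D f (n \<cdot> Fst C P A)"
    by (subst bind_str) (use assms q in \<open>simp_all add: q_def\<close>)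
  finally have 1: "bind P ?AB D q ?d1 = bind P A D (bind ?PA B D f (n \<cdot> Fst C P A)) x" .
  have e2: "right_str C M A B \<cdot> Tuple C (x \<cdot> Fst C P B) (Snd C P B) =
      MArr M (prod_swap C B A) \<cdot> (Str M B A \<cdot> Tuple C (Snd C P B) (x \<cdot> Fst C P B))"
    using assms x by (simp add: rs prod_swap_def)
  have "bind P ?AB D q ?d2 = bind P B D (bind ?PB ?AB D
      (q \<cdot> Tuple C (Fst C P B \<cdot> Fst C ?PB ?AB) (Snd C ?PB ?AB))
      (right_str C M A B \<cdot> Tuple C (x \<cdot> Fst C P B) (Snd C P B))) n"
    by (rule bind_assoc) (use assms x q rs_arr in simp_all)
  also have "bind ?PB ?AB D (q \<cdot> Tuple C (Fst C P B \<cdot> Fst C ?PB ?AB) (Snd C ?PB ?AB))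
      (right_str C M A B \<cdot> Tuple C (x \<cdot> Fst C P B) (Snd C P B)) =
      bind ?PB (Prod C B A) D (q \<cdot> Tuple C (Fst C P B \<cdot> Fst C ?PB (Prod C B A))
         (prod_swap C B A \<cdot> Snd C ?PB (Prod C B A))) (Str M B A \<cdot> Tuple C (Snd C P B) (x \<cdot> Fst C P B))"
    unfolding e2
    by (subst bind_marr[where A = "Prod C B A"]) (use assms x q in \<open>simp_all add: prod_swap_def\<close>)
  also have "\<dots> = bind ?PB A D
      (f \<cdot> Tuple C (Tuple C (Fst C P B \<cdot> Fst C ?PB A) (Snd C ?PB A)) (Snd C P B \<cdot> Fst C ?PB A)) (x \<cdot> Fst C P B)"
    by (subst bind_str) (use assms x q in \<open>simp_all add: prod_swap_def q_def\<close>)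
  finally have 2: "bind P ?AB D q ?d2 = bind P B D (bind ?PB A D
      (f \<cdot> Tuple C (Tuple C (Fst C P B \<cdot> Fst C ?PB A) (Snd C ?PB A)) (Snd C P B \<cdot> Fst C ?PB A))
      (x \<cdot> Fst C P B)) n" .
  show ?thesis unfolding x_def[symmetric] using 1 2 d by simp
qed

end

context central_submonad
begin

lemma iota_arr [simp]:
  assumes "A \<in> Obj C"
  shows "\<iota> A \<in> Arr C" "Dom C (\<iota> A) = MObj S A" "Cod C (\<iota> A) = MObj T A"
  using iota_in_hom[OF assms] by (simp_all add: in_hom)

text \<open>The inclusion passes through the ingredients of \<open>bind\<close> in turn, by
  \<open>iota_Mult\<close>, naturality and \<open>iota_Str\<close>.\<close>

lemma iota_bind:
  assumes "P \<in> Obj C" "A \<in> Obj C" "B \<in> Obj C" "n \<in> Arr C" "Dom C n = Prod C P A" "Cod C n = MObj S B"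
    "m \<in> Arr C" "Dom C m = P" "Cod C m = MObj S A"
  shows "T.bind P A B (\<iota> B \<cdot> n) (\<iota> A \<cdot> m) = \<iota> B \<cdot> S.bind P A B n m"
proof -
  let ?y = "Str S P A \<cdot> Tuple C (Ident C P) m"
  have "\<iota> B \<cdot> S.bind P A B n m = (\<iota> B \<cdot> Mult S B) \<cdot> (MArr S n \<cdot> ?y)"
    using assms by (simp add: S.bind_def)
  also have "\<dots> = Mult T B \<cdot> (MArr T (\<iota> B) \<cdot> ((\<iota> (MObj S B) \<cdot> MArr S n) \<cdot> ?y))"
    using iota_Mult[of B] assms by simp
  also have "\<iota> (MObj S B) \<cdot> MArr S n = MArr T n \<cdot> \<iota> (Prod C P A)"
    using iota_natural[of n "Prod C P A" "MObj S B"] assms by (simp add: in_hom)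
  also have "(MArr T n \<cdot> \<iota> (Prod C P A)) \<cdot> ?y = MArr T n \<cdot> ((\<iota> (Prod C P A) \<cdot> Str S P A) \<cdot> Tuple C (Ident C P) m)"
    using assms by simp
  also have "\<iota> (Prod C P A) \<cdot> Str S P A = Str T P A \<cdot> cross C (Ident C P) (\<iota> A)"
    using iota_Str[of P A] assms by simp
  also have "(Str T P A \<cdot> cross C (Ident C P) (\<iota> A)) \<cdot> Tuple C (Ident C P) m =
     Str T P A \<cdot> Tuple C (Ident C P) (\<iota> A \<cdot> m)"
    using assms by (simp add: cross_def)
  finally show ?thesis using assms by (simp add: T.bind_def T.marr_comp)
qed

end


section \<open>Models\<close>

locale model = fixes C :: "('o, 'm) csc_structure" (structure) assumes model: "csc_model C"

sublocale model \<subseteq> central_submonad C "mon C SMon" "mon C TMon" "iota C"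
  using model by (simp add: csc_model_def)

text \<open>Gives the laws for both monads at once, with the name \<open>X\<close> as a parameter,
  as in the rules of the calculus.\<close>

sublocale model \<subseteq> M: strong_monad C "mon C X" for X
  by (cases X) (simp_all add: S.strong_monad_axioms T.strong_monad_axioms)


section \<open>Transport of models along isomorphisms\<close>

text \<open>No law of \<open>D\<close> is assumed, and no domain or codomain of its structure maps:
  only that the operations stay within the carriers and correspond to those of \<open>C\<close>.
  Endpoints and laws follow because \<open>go\<close> and \<open>ga\<close> are injective
  there.\<close>

locale structure_iso = C: model C for C :: "('o, 'm) csc_structure" +
  fixes D :: "('p, 'n) csc_structure"
    and go :: "'p \<Rightarrow> 'o" and ga :: "'n \<Rightarrow> 'm" and fo :: "'o \<Rightarrow> 'p" and fa :: "'m \<Rightarrow> 'n"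
  assumes go [simp]: "a \<in> Obj D \<Longrightarrow> go a \<in> Obj C" "a \<in> Obj D \<Longrightarrow> fo (go a) = a"
    and fo [simp]: "A \<in> Obj C \<Longrightarrow> fo A \<in> Obj D" "A \<in> Obj C \<Longrightarrow> go (fo A) = A"
    and ga [simp]: "f \<in> Arr D \<Longrightarrow> ga f \<in> Arr C" "f \<in> Arr D \<Longrightarrow> fa (ga f) = f"
    and fa [simp]: "h \<in> Arr C \<Longrightarrow> fa h \<in> Arr D" "h \<in> Arr C \<Longrightarrow> ga (fa h) = h"
    and Dom [simp]: "f \<in> Arr D \<Longrightarrow> Dom D f \<in> Obj D" "f \<in> Arr D \<Longrightarrow> Dom C (ga f) = go (Dom D f)"
    and Cod [simp]: "f \<in> Arr D \<Longrightarrow> Cod D f \<in> Obj D" "f \<in> Arr D \<Longrightarrow> Cod C (ga f) = go (Cod D f)"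
    and Ident [simp]: "a \<in> Obj D \<Longrightarrow> Ident D a \<in> Arr D"
      "a \<in> Obj D \<Longrightarrow> ga (Ident D a) = Ident C (go a)"
    and Comp [simp]: "f \<in> Arr D \<Longrightarrow> g \<in> Arr D \<Longrightarrow> Dom D g = Cod D f \<Longrightarrow> Comp D g f \<in> Arr D"
      "f \<in> Arr D \<Longrightarrow> g \<in> Arr D \<Longrightarrow> Dom D g = Cod D f \<Longrightarrow> ga (Comp D g f) = Comp C (ga g) (ga f)"
    and One [simp]: "One D \<in> Obj D" "go (One D) = One C"
    and Bang [simp]: "a \<in> Obj D \<Longrightarrow> Bang D a \<in> Arr D" "a \<in> Obj D \<Longrightarrow> ga (Bang D a) = Bang C (go a)"
    and Prod [simp]: "a \<in> Obj D \<Longrightarrow> b \<in> Obj D \<Longrightarrow> Prod D a b \<in> Obj D"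
      "a \<in> Obj D \<Longrightarrow> b \<in> Obj D \<Longrightarrow> go (Prod D a b) = Prod C (go a) (go b)"
    and Fst [simp]: "a \<in> Obj D \<Longrightarrow> b \<in> Obj D \<Longrightarrow> Fst D a b \<in> Arr D"
      "a \<in> Obj D \<Longrightarrow> b \<in> Obj D \<Longrightarrow> ga (Fst D a b) = Fst C (go a) (go b)"
    and Snd [simp]: "a \<in> Obj D \<Longrightarrow> b \<in> Obj D \<Longrightarrow> Snd D a b \<in> Arr D"
      "a \<in> Obj D \<Longrightarrow> b \<in> Obj D \<Longrightarrow> ga (Snd D a b) = Snd C (go a) (go b)"
    and Tuple [simp]: "f \<in> Arr D \<Longrightarrow> g \<in> Arr D \<Longrightarrow> Dom D f = Dom D g \<Longrightarrow> Tuple D f g \<in> Arr D"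
      "f \<in> Arr D \<Longrightarrow> g \<in> Arr D \<Longrightarrow> Dom D f = Dom D g \<Longrightarrow> ga (Tuple D f g) = Tuple C (ga f) (ga g)"
    and Exp [simp]: "a \<in> Obj D \<Longrightarrow> b \<in> Obj D \<Longrightarrow> Exp D a b \<in> Obj D"
      "a \<in> Obj D \<Longrightarrow> b \<in> Obj D \<Longrightarrow> go (Exp D a b) = Exp C (go a) (go b)"
    and Ev [simp]: "a \<in> Obj D \<Longrightarrow> b \<in> Obj D \<Longrightarrow> Ev D a b \<in> Arr D"
      "a \<in> Obj D \<Longrightarrow> b \<in> Obj D \<Longrightarrow> ga (Ev D a b) = Ev C (go a) (go b)"
    and Curry [simp]:
      "x \<in> Obj D \<Longrightarrow> a \<in> Obj D \<Longrightarrow> f \<in> Arr D \<Longrightarrow> Dom D f = Prod D x a \<Longrightarrow> Curry D x a f \<in> Arr D"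
      "x \<in> Obj D \<Longrightarrow> a \<in> Obj D \<Longrightarrow> f \<in> Arr D \<Longrightarrow> Dom D f = Prod D x a \<Longrightarrow>
         ga (Curry D x a f) = Curry C (go x) (go a) (ga f)"
    and MObj [simp]: "a \<in> Obj D \<Longrightarrow> MObj (mon D X) a \<in> Obj D"
      "a \<in> Obj D \<Longrightarrow> go (MObj (mon D X) a) = MObj (mon C X) (go a)"
    and MArr [simp]: "f \<in> Arr D \<Longrightarrow> MArr (mon D X) f \<in> Arr D"
      "f \<in> Arr D \<Longrightarrow> ga (MArr (mon D X) f) = MArr (mon C X) (ga f)"
    and Unit [simp]: "a \<in> Obj D \<Longrightarrow> Unit (mon D X) a \<in> Arr D"
      "a \<in> Obj D \<Longrightarrow> ga (Unit (mon D X) a) = Unit (mon C X) (go a)"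
    and Mult [simp]: "a \<in> Obj D \<Longrightarrow> Mult (mon D X) a \<in> Arr D"
      "a \<in> Obj D \<Longrightarrow> ga (Mult (mon D X) a) = Mult (mon C X) (go a)"
    and Str [simp]: "a \<in> Obj D \<Longrightarrow> b \<in> Obj D \<Longrightarrow> Str (mon D X) a b \<in> Arr D"
      "a \<in> Obj D \<Longrightarrow> b \<in> Obj D \<Longrightarrow> ga (Str (mon D X) a b) = Str (mon C X) (go a) (go b)"
    and iota [simp]: "a \<in> Obj D \<Longrightarrow> iota D a \<in> Arr D"
      "a \<in> Obj D \<Longrightarrow> ga (iota D a) = iota C (go a)"
begin

lemma obj_eqI: "go a = go b \<Longrightarrow> a \<in> Obj D \<Longrightarrow> b \<in> Obj D \<Longrightarrow> a = b"
  using go(2) by metis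

text \<open>The transport principle: applying \<open>ga\<close> to both sides turns a law of
  \<open>D\<close> into the same law of \<open>C\<close>.\<close>

lemma arr_eqI: "ga f = ga g \<Longrightarrow> f \<in> Arr D \<Longrightarrow> g \<in> Arr D \<Longrightarrow> f = g"
  using ga(2) by metis

lemma go_eq_iff [simp]: "a \<in> Obj D \<Longrightarrow> b \<in> Obj D \<Longrightarrow> go a = go b \<longleftrightarrow> a = b"
  using obj_eqI by blast

lemma DomI: "Dom C (ga f) = go a \<Longrightarrow> f \<in> Arr D \<Longrightarrow> a \<in> Obj D \<Longrightarrow> Dom D f = a"
  by simp

lemma CodI: "Cod C (ga f) = go a \<Longrightarrow> f \<in> Arr D \<Longrightarrow> a \<in> Obj D \<Longrightarrow> Cod D f = a"
  by simp

lemma ga_hom: "f \<in> hom D a b \<Longrightarrow> ga f \<in> hom C (go a) (go b)"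
  by (auto simp: in_hom)

lemma fa_dom_cod [simp]:
  "h \<in> Arr C \<Longrightarrow> Dom D (fa h) = fo (Dom C h)" "h \<in> Arr C \<Longrightarrow> Cod D (fa h) = fo (Cod C h)"
  by (rule DomI CodI; simp del: Dom Cod)+

lemma dom_cod [simp]:
  "a \<in> Obj D \<Longrightarrow> Dom D (Ident D a) = a" "a \<in> Obj D \<Longrightarrow> Cod D (Ident D a) = a"
  "a \<in> Obj D \<Longrightarrow> Dom D (Bang D a) = a" "a \<in> Obj D \<Longrightarrow> Cod D (Bang D a) = One D"
  "a \<in> Obj D \<Longrightarrow> b \<in> Obj D \<Longrightarrow> Dom D (Fst D a b) = Prod D a b"
  "a \<in> Obj D \<Longrightarrow> b \<in> Obj D \<Longrightarrow> Cod D (Fst D a b) = a"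
  "a \<in> Obj D \<Longrightarrow> b \<in> Obj D \<Longrightarrow> Dom D (Snd D a b) = Prod D a b"
  "a \<in> Obj D \<Longrightarrow> b \<in> Obj D \<Longrightarrow> Cod D (Snd D a b) = b"
  "a \<in> Obj D \<Longrightarrow> b \<in> Obj D \<Longrightarrow> Dom D (Ev D a b) = Prod D (Exp D a b) a"
  "a \<in> Obj D \<Longrightarrow> b \<in> Obj D \<Longrightarrow> Cod D (Ev D a b) = b"
  "a \<in> Obj D \<Longrightarrow> Dom D (Unit (mon D X) a) = a"
  "a \<in> Obj D \<Longrightarrow> Cod D (Unit (mon D X) a) = MObj (mon D X) a"
  "a \<in> Obj D \<Longrightarrow> Dom D (Mult (mon D X) a) = MObj (mon D X) (MObj (mon D X) a)"
  "a \<in> Obj D \<Longrightarrow> Cod D (Mult (mon D X) a) = MObj (mon D X) a"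
  "a \<in> Obj D \<Longrightarrow> b \<in> Obj D \<Longrightarrow> Dom D (Str (mon D X) a b) = Prod D a (MObj (mon D X) b)"
  "a \<in> Obj D \<Longrightarrow> b \<in> Obj D \<Longrightarrow> Cod D (Str (mon D X) a b) = MObj (mon D X) (Prod D a b)"
  "a \<in> Obj D \<Longrightarrow> Dom D (iota D a) = MObj (mon D SMon) a"
  "a \<in> Obj D \<Longrightarrow> Cod D (iota D a) = MObj (mon D TMon) a"
  by (rule DomI CodI; simp del: Dom(2) Cod(2))+

lemma dom_cod_arr [simp]:
  "f \<in> Arr D \<Longrightarrow> g \<in> Arr D \<Longrightarrow> Dom D g = Cod D f \<Longrightarrow> Dom D (Comp D g f) = Dom D f"
  "f \<in> Arr D \<Longrightarrow> g \<in> Arr D \<Longrightarrow> Dom D g = Cod D f \<Longrightarrow> Cod D (Comp D g f) = Cod D g"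
  "f \<in> Arr D \<Longrightarrow> g \<in> Arr D \<Longrightarrow> Dom D f = Dom D g \<Longrightarrow> Dom D (Tuple D f g) = Dom D g"
  "f \<in> Arr D \<Longrightarrow> g \<in> Arr D \<Longrightarrow> Dom D f = Dom D g \<Longrightarrow> Cod D (Tuple D f g) = Prod D (Cod D f) (Cod D g)"
  "x \<in> Obj D \<Longrightarrow> a \<in> Obj D \<Longrightarrow> f \<in> Arr D \<Longrightarrow> Dom D f = Prod D x a \<Longrightarrow> Dom D (Curry D x a f) = x"
  "x \<in> Obj D \<Longrightarrow> a \<in> Obj D \<Longrightarrow> f \<in> Arr D \<Longrightarrow> Dom D f = Prod D x a \<Longrightarrow>
     Cod D (Curry D x a f) = Exp D a (Cod D f)"
  "f \<in> Arr D \<Longrightarrow> Dom D (MArr (mon D X) f) = MObj (mon D X) (Dom D f)"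
  "f \<in> Arr D \<Longrightarrow> Cod D (MArr (mon D X) f) = MObj (mon D X) (Cod D f)"
  by (rule DomI CodI; simp)+

lemma cross_iso [simp]:
  assumes "f \<in> Arr D" "g \<in> Arr D"
  shows "cross D f g \<in> Arr D" "Dom D (cross D f g) = Prod D (Dom D f) (Dom D g)"
    "Cod D (cross D f g) = Prod D (Cod D f) (Cod D g)" "ga (cross D f g) = cross C (ga f) (ga g)"
  using assms by (simp_all add: cross_def)

lemma prod_assoc_iso [simp]:
  assumes "a \<in> Obj D" "b \<in> Obj D" "d \<in> Obj D"
  shows "prod_assoc D a b d \<in> Arr D" "Dom D (prod_assoc D a b d) = Prod D (Prod D a b) d"
    "Cod D (prod_assoc D a b d) = Prod D a (Prod D b d)"
    "ga (prod_assoc D a b d) = prod_assoc C (go a) (go b) (go d)"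
  using assms by (simp_all add: prod_assoc_def)

lemma prod_swap_iso [simp]:
  assumes "a \<in> Obj D" "b \<in> Obj D"
  shows "prod_swap D a b \<in> Arr D" "Dom D (prod_swap D a b) = Prod D a b"
    "Cod D (prod_swap D a b) = Prod D b a" "ga (prod_swap D a b) = prod_swap C (go a) (go b)"
  using assms by (simp_all add: prod_swap_def)

lemma right_str_iso [simp]:
  assumes "a \<in> Obj D" "b \<in> Obj D"
  shows "right_str D (mon D X) a b \<in> Arr D"
    "Dom D (right_str D (mon D X) a b) = Prod D (MObj (mon D X) a) b"
    "Cod D (right_str D (mon D X) a b) = MObj (mon D X) (Prod D a b)"
    "ga (right_str D (mon D X) a b) = right_str C (mon C X) (go a) (go b)"
  using assms by (simp_all add: right_str_def)

section \<open>The laws of a model and the two morphisms, transported\<close>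

lemma category_iso: "category D"
  by unfold_locales (auto simp: in_hom intro!: arr_eqI)

lemma ccc_iso: "cartesian_closed_category D"
proof -
  interpret D: category D by (rule category_iso)
  show ?thesis
  proof
    show "f = Bang D A" if "f \<in> hom D A (One D)" for f A
      using that C.S.Bang_unique[of "ga f" "go A"] ga_hom[OF that] D.hom_obj[OF that]
      by (intro arr_eqI) (auto simp: in_hom)
    show "h = Tuple D (Comp D (Fst D A B) h) (Comp D (Snd D A B) h)"
      if "A \<in> Obj D" "B \<in> Obj D" "h \<in> hom D X (Prod D A B)" for A B h X
      using that by (intro arr_eqI) (auto simp: in_hom)
    show "Comp D (Ev D A B) (Tuple D (Comp D (Curry D X A f) (Fst D X A)) (Snd D X A)) = f"
      if "X \<in> Obj D" "A \<in> Obj D" "f \<in> hom D (Prod D X A) B" for X A f B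
      using that by (intro arr_eqI) (auto simp: in_hom C.S.ev_curry)
    show "g = Curry D X A (Comp D (Ev D A B) (Tuple D (Comp D g (Fst D X A)) (Snd D X A)))"
      if "A \<in> Obj D" "B \<in> Obj D" "g \<in> hom D X (Exp D A B)" for A B g X
      using that by (intro arr_eqI) (auto simp: in_hom C.S.curry_ev)
  qed (auto simp: in_hom intro!: arr_eqI)
qed

lemma strong_monad_iso: "strong_monad D (mon D X)"
proof -
  interpret D: cartesian_closed_category D by (rule ccc_iso)
  show ?thesis
  proof
    fix f g A A' B B' assume "f \<in> hom D A A'" "g \<in> hom D B B'"
    then show "Comp D (Str (mon D X) A' B') (cross D f (MArr (mon D X) g)) =
       Comp D (MArr (mon D X) (cross D f g)) (Str (mon D X) A B)"
      using C.M.Str_natural[of "ga f" "go A" "go A'" "ga g" "go B" "go B'" X, OF ga_hom ga_hom]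
      by (intro arr_eqI) (auto simp: in_hom)
  next
    fix f A B assume "f \<in> hom D A B"
    then show "Comp D (Unit (mon D X) B) f = Comp D (MArr (mon D X) f) (Unit (mon D X) A)"
      using C.M.Unit_natural[of "ga f" "go A" "go B" X, OF ga_hom]
      by (intro arr_eqI) (auto simp: in_hom)
  next
    fix f A B assume "f \<in> hom D A B"
    then show "Comp D (Mult (mon D X) B) (MArr (mon D X) (MArr (mon D X) f)) =
        Comp D (MArr (mon D X) f) (Mult (mon D X) A)"
      using C.M.Mult_natural[of "ga f" "go A" "go B" X, OF ga_hom]
      by (intro arr_eqI) (auto simp: in_hom)
  qed (auto simp: in_hom C.M.marr_comp C.M.Mult_Unit C.M.Mult_MArr_Unit C.M.Mult_assoc C.M.Str_One C.M.Str_assoc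
        C.M.Str_Unit C.M.Str_Mult intro!: arr_eqI)
qed

lemma csc_model_iso: "csc_model D"
  unfolding csc_model_def
proof -
  interpret S: strong_monad D "mon D SMon" by (rule strong_monad_iso)
  interpret T: strong_monad D "mon D TMon" by (rule strong_monad_iso)
  show "central_submonad D (mon D SMon) (mon D TMon) (iota D)"
  proof
    fix f A B assume f: "f \<in> hom D A B"
    then have AB: "A \<in> Obj D" "B \<in> Obj D" by (auto simp: in_hom)
    show "Comp D (iota D B) (MArr (mon D SMon) f) = Comp D (MArr (mon D TMon) f) (iota D A)"
      using C.iota_natural[of "ga f" "go A" "go B", OF ga_hom[OF f]] f AB
      by (intro arr_eqI) (auto simp: in_hom)
  next
    fix A assume A: "A \<in> Obj D"
    show "monic D (iota D A)" unfolding monic_def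
    proof (intro conjI allI impI)
      show "iota D A \<in> Arr D" using A by simp
      fix B f g assume f: "f \<in> hom D B (Dom D (iota D A))" and g: "g \<in> hom D B (Dom D (iota D A))"
        and eq: "Comp D (iota D A) f = Comp D (iota D A) g"
      have "Comp C (iota C (go A)) (ga f) = Comp C (iota C (go A)) (ga g)"
        using arg_cong[OF eq, of ga] f g A by (simp add: in_hom)
      then have "ga f = ga g"
        using C.iota_monic[of "go A"] ga_hom[OF f] ga_hom[OF g] A unfolding monic_def by simp
      then show "f = g" using f g by (intro arr_eqI) (auto simp: in_hom)
    qed
    have *: "central_cone C (mon C TMon) (go A) (MObj (mon C SMon) (go A)) (iota C (go A))"
      using C.iota_central[of "go A"] A by simp
    show "central_cone D (mon D TMon) A (MObj (mon D SMon) A) (iota D A)"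
      unfolding central_cone_def
    proof (intro conjI ballI)
      fix Y assume Y: "Y \<in> Obj D"
      show "Comp D (Mult (mon D TMon) (Prod D A Y)) (Comp D (MArr (mon D TMon) (right_str D (mon D TMon) A Y))
              (Comp D (Str (mon D TMon) (MObj (mon D TMon) A) Y) (cross D (iota D A) (Ident D (MObj (mon D TMon) Y)))))
        = Comp D (Mult (mon D TMon) (Prod D A Y)) (Comp D (MArr (mon D TMon) (Str (mon D TMon) A Y))
              (Comp D (right_str D (mon D TMon) A (MObj (mon D TMon) Y))
                (cross D (iota D A) (Ident D (MObj (mon D TMon) Y)))))"
        using * A Y by (intro arr_eqI) (simp_all add: central_cone_def)
    qed (use A in \<open>simp add: in_hom\<close>)
  qed (auto simp: in_hom C.iota_Unit C.iota_Mult C.iota_Str intro!: arr_eqI)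
qed

lemma functor_G: "cat_functor D C \<lparr>FObj = go, FArr = ga\<rparr>"
proof -
  interpret D: model D by unfold_locales (rule csc_model_iso)
  show ?thesis by unfold_locales (auto simp: in_hom)
qed

lemma morphism_G: "csc_model_morphism D C \<lparr>FObj = go, FArr = ga\<rparr>"
proof -
  interpret cat_functor D C "\<lparr>FObj = go, FArr = ga\<rparr>" by (rule functor_G)
  show ?thesis by unfold_locales (simp_all add: csc_model_iso C.model)
qed

lemma morphism_F: "csc_model_morphism C D \<lparr>FObj = fo, FArr = fa\<rparr>"
proof -
  interpret D: model D by unfold_locales (rule csc_model_iso)
  show ?thesis
    by unfold_locales (auto simp: in_hom C.model D.model intro!: arr_eqI intro: obj_eqI)
qed

lemma natural_isomorphism_G_F:
  "natural_isomorphism C C funct_id (funct_comp \<lparr>FObj = go, FArr = ga\<rparr> \<lparr>FObj = fo, FArr = fa\<rparr>) (Ident C)"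
  unfolding natural_isomorphism_def natural_transformation_def funct_comp_def funct_id_def iso_def
    cat_functor_def cat_functor_axioms_def
  by (auto simp: in_hom C.S.category_axioms intro!: bexI[of _ "Ident C _"])

lemma natural_isomorphism_F_G:
  "natural_isomorphism D D (funct_comp \<lparr>FObj = fo, FArr = fa\<rparr> \<lparr>FObj = go, FArr = ga\<rparr>) funct_id (Ident D)"
proof -
  interpret D: model D by unfold_locales (rule csc_model_iso)
  have [simp]: "fa (Comp C (ga g) (ga f)) = Comp D g f"
    if "f \<in> Arr D" "g \<in> Arr D" "Dom D g = Cod D f" for f g
    using that by (intro arr_eqI) simp_all
  have [simp]: "fa (Ident C (go a)) = Ident D a" if "a \<in> Obj D" for a
    using that by (intro arr_eqI) simp_all
  show ?thesis
  unfolding natural_isomorphism_def natural_transformation_def funct_comp_def funct_id_def iso_def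
    cat_functor_def cat_functor_axioms_def
  by (auto simp: in_hom D.S.category_axioms intro!: bexI[of _ "Ident D _"])
qed

end


section \<open>Soundness of the interpretation in a model\<close>

context model
begin

abbreviation L where "L \<equiv> int_lang C"

lemma theory_L: "theory_of L"
  by unfold_locales (rule csc_theory_int_lang; simp)

lemma ity_obj [simp]: "wf_ty L A \<Longrightarrow> ity C A \<in> Obj C"
  by (induction A) simp_all

lemma ictx_obj [simp]: "wf_ctx L \<Gamma> \<Longrightarrow> ictx C \<Gamma> \<in> Obj C"
  by (induction \<Gamma>) simp_all

lemma ivar_arr: "wf_ctx L \<Gamma> \<Longrightarrow> i < length \<Gamma> \<Longrightarrow>
    ivar C \<Gamma> i \<in> Arr C \<and> Dom C (ivar C \<Gamma> i) = ictx C \<Gamma> \<and> Cod C (ivar C \<Gamma> i) = ity C (\<Gamma> ! i)"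
proof (induction \<Gamma> arbitrary: i)
  case (Cons A \<Gamma>) then show ?case by (cases i) simp_all
qed simp

text \<open>Takes the place of the defining equation of \<open>itm\<close>, so that the rules for
  \<open>do\<close> meet the laws of \<open>bind\<close>.\<close>

lemma itm_Do: "itm C (Do X A B M N) \<Gamma> =
    M.bind X (ictx C \<Gamma>) (ity C A) (ity C B) (itm C N (A # \<Gamma>)) (itm C M \<Gamma>)"
  by (simp add: M.bind_def)

declare itm.simps(11) [simp del]
declare itm_Do [simp]

text \<open>Conversion does no harm, because equal types of \<open>L\<close> denote the same
  object.\<close>

lemma itm_arr: "typing L \<Gamma> M A \<Longrightarrow>
    itm C M \<Gamma> \<in> Arr C \<and> Dom C (itm C M \<Gamma>) = ictx C \<Gamma> \<and> Cod C (itm C M \<Gamma>) = ity C A"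
proof (induction rule: typing.induct)
  interpret L: theory_of L by (rule theory_L)
  {
    case (ty_Var \<Gamma> i) then show ?case by (simp add: ivar_arr)
  next
    case (ty_Lam A \<Gamma> M B)
    with typing_wf_ctx[OF ty_Lam.hyps] show ?case by simp
  next
    case (ty_App \<Gamma> M A B N)
    with L.typing_wf_ty[OF ty_App.hyps(1)] show ?case by simp
  next
    case (ty_Pi1 \<Gamma> M A B)
    with L.typing_wf_ty[OF ty_Pi1.hyps] show ?case by simp
  next
    case (ty_Pi2 \<Gamma> M A B)
    with L.typing_wf_ty[OF ty_Pi2.hyps] show ?case by simp
  next
    case (ty_Ret \<Gamma> M A X)
    with L.typing_wf_ty[OF ty_Ret.hyps] show ?case by simp
  next
    case (ty_Iota \<Gamma> M A)
    with L.typing_wf_ty[OF ty_Iota.hyps] show ?case by simp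
  next
    case (ty_Do \<Gamma> M X A N B)
    with L.typing_wf_ty[OF ty_Do.hyps(1)] L.typing_wf_ty[OF ty_Do.hyps(2)] typing_wf_ctx[OF ty_Do.hyps(1)]
    show ?case by simp
  next
    case (ty_conv \<Gamma> M A B) then show ?case by (simp add: int_lang_ty_eq_iff)
  }
qed simp_all

text \<open>\<open>itm\<close> sees a context only through its objects. This is needed when a
  congruence rule changes the annotation of a binder and with it the context of the body.\<close>

lemma itm_ctx_cong: "list_all2 (\<lambda>A B. ity C A = ity C B) \<Gamma> \<Delta> \<Longrightarrow> itm C M \<Gamma> = itm C M \<Delta>"
proof (induction M arbitrary: \<Gamma> \<Delta>)
  have ictx: "ictx C \<Gamma> = ictx C \<Delta>" if "list_all2 (\<lambda>A B. ity C A = ity C B) \<Gamma> \<Delta>" for \<Gamma> \<Delta>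
    using that by (induction rule: list_all2_induct) simp_all
  {
    case (Var i)
    then show ?case
      by (induction arbitrary: i rule: list_all2_induct) (simp_all add: ictx split: nat.split)
  next
    case (Lam A M)
    from Lam.IH[of "A # \<Gamma>" "A # \<Delta>"] Lam.prems show ?case by (simp add: ictx[OF Lam.prems])
  next
    case (Do X A B M N)
    from Do.IH(2)[of "A # \<Gamma>" "A # \<Delta>"] Do.IH(1)[OF Do.prems] Do.prems
    show ?case by (simp add: ictx[OF Do.prems])
  next
    case (App A B M N) from App.IH[OF App.prems] show ?case by simp
  next
    case (Pr M N) from Pr.IH[OF Pr.prems] show ?case by simp
  next
    case (Pi1 A B M) from Pi1.IH[OF Pi1.prems] show ?case by simp
  next
    case (Pi2 A B M) from Pi2.IH[OF Pi2.prems] show ?case by simp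
  next
    case (Ret X M) from Ret.IH[OF Ret.prems] show ?case by simp
  next
    case (Iota A M) from Iota.IH[OF Iota.prems] show ?case by simp
  next
    case (Const f) then show ?case by (simp add: ictx)
  next
    case Star then show ?case by (simp add: ictx)
  }
qed

text \<open>
  \<open>realizes h \<Delta> \<sigma> \<Gamma>\<close>: the morphism \<open>h\<close> interprets the substitution \<open>\<sigma>\<close>, given by its components.
\<close>

definition realizes :: "'m \<Rightarrow> 'o ty list \<Rightarrow> (nat \<Rightarrow> ('o, 'm) tm) \<Rightarrow> 'o ty list \<Rightarrow> bool" where
  "realizes h \<Delta> \<sigma> \<Gamma> \<longleftrightarrow> h \<in> hom C (ictx C \<Delta>) (ictx C \<Gamma>) \<and> wf_ctx L \<Delta> \<and>
     (\<forall>i < length \<Gamma>. typing L \<Delta> (\<sigma> i) (\<Gamma> ! i) \<and> itm C (\<sigma> i) \<Delta> = ivar C \<Gamma> i \<cdot> h)"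

text \<open>The assumption \<open>shift\<close> is the substitution lemma for the weakening of each
  component. It has to be an assumption, since the proof of the substitution lemma goes through this
  one.\<close>

lemma realizes_up:
  assumes h: "realizes h \<Delta> \<sigma> \<Gamma>" and w: "wf_ctx L (A # \<Gamma>)"
    and shift: "\<And>i. i < length \<Gamma> \<Longrightarrow> itm C (shift (\<sigma> i)) (A # \<Delta>) = itm C (\<sigma> i) \<Delta> \<cdot> Fst C (ictx C \<Delta>) (ity C A)"
  shows "realizes (Tuple C (h \<cdot> Fst C (ictx C \<Delta>) (ity C A)) (Snd C (ictx C \<Delta>) (ity C A)))
    (A # \<Delta>) (up_sub \<sigma>) (A # \<Gamma>)"
  unfolding realizes_def
proof (intro conjI allI impI)
  have h': "h \<in> Arr C" "Dom C h = ictx C \<Delta>" "Cod C h = ictx C \<Gamma>" "wf_ctx L \<Delta>"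
    using h by (simp_all add: realizes_def in_hom)
  show "Tuple C (h \<cdot> Fst C (ictx C \<Delta>) (ity C A)) (Snd C (ictx C \<Delta>) (ity C A)) \<in>
      hom C (ictx C (A # \<Delta>)) (ictx C (A # \<Gamma>))"
    using h' w by (simp add: in_hom)
  show w': "wf_ctx L (A # \<Delta>)" using h' w by simp
  fix i assume i: "i < length (A # \<Gamma>)"
  show "typing L (A # \<Delta>) (up_sub \<sigma> i) ((A # \<Gamma>) ! i)"
    using i h w ty_Var0[OF w'] by (cases i) (auto simp: realizes_def intro: typing_shift)
  show "itm C (up_sub \<sigma> i) (A # \<Delta>) = ivar C (A # \<Gamma>) i \<cdot>
     Tuple C (h \<cdot> Fst C (ictx C \<Delta>) (ity C A)) (Snd C (ictx C \<Delta>) (ity C A))"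
  proof (cases i)
    case 0 then show ?thesis using h' w by simp
  next
    case (Suc j)
    then have "ivar C \<Gamma> j \<in> Arr C" "Dom C (ivar C \<Gamma> j) = ictx C \<Gamma>"
      "itm C (\<sigma> j) \<Delta> = ivar C \<Gamma> j \<cdot> h"
      using ivar_arr[of \<Gamma> j] w i h by (simp_all add: realizes_def)
    then show ?thesis using Suc i h' w shift[of j] by simp
  qed
qed

text \<open>
  Used twice: with \<open>Q\<close> the predicate of being a renaming, where \<open>shift\<close> is a computation with
  variables, and then for all substitutions, where \<open>shift\<close> is an instance of the first use.
\<close>

lemma itm_subst_step:
  assumes "typing L \<Gamma> M A" "realizes h \<Delta> \<sigma> \<Gamma>"
    and shift: "\<And>\<Delta> \<sigma> \<Gamma> h i A. Q \<sigma> \<Longrightarrow> realizes h \<Delta> \<sigma> \<Gamma> \<Longrightarrow> i < length \<Gamma> \<Longrightarrow> wf_ty L A \<Longrightarrow>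
       itm C (shift (\<sigma> i)) (A # \<Delta>) = itm C (\<sigma> i) \<Delta> \<cdot> Fst C (ictx C \<Delta>) (ity C A)"
    and Q: "\<And>\<sigma>. Q \<sigma> \<Longrightarrow> Q (up_sub \<sigma>)" "Q \<sigma>"
  shows "itm C (subst \<sigma> M) \<Delta> = itm C M \<Gamma> \<cdot> h"
  using assms(1,2) Q(2)
proof (induction arbitrary: \<Delta> \<sigma> h rule: typing.induct)
  interpret L: theory_of L by (rule theory_L)
  have hom: "h \<in> Arr C" "Dom C h = ictx C \<Delta>" "Cod C h = ictx C \<Gamma>" "wf_ctx L \<Delta>"
    if "realizes h \<Delta> \<sigma> \<Gamma>" for h \<Delta> \<sigma> \<Gamma>
    using that by (simp_all add: realizes_def in_hom)
  {
    case (ty_Var \<Gamma> i) then show ?case by (simp add: realizes_def)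
  next
    case (ty_Const \<Gamma> c) then show ?case using hom[OF ty_Const.prems(1)] by simp
  next
    case (ty_Star \<Gamma>) then show ?case using hom[OF ty_Star.prems(1)] by simp
  next
    case (ty_Lam A \<Gamma> M B)
    have w: "wf_ctx L (A # \<Gamma>)" by (rule typing_wf_ctx[OF ty_Lam.hyps])
    note r = realizes_up[OF ty_Lam.prems(1) w shift[OF ty_Lam.prems(2,1)]]
    note h = hom[OF ty_Lam.prems(1)]
    show ?case using ty_Lam.IH[OF r Q(1)[OF ty_Lam.prems(2)]] w h itm_arr[OF ty_Lam.hyps]
      by (simp add: S.curry_comp)
  next
    case (ty_App \<Gamma> M A B N)
    show ?case
      using ty_App.IH(1)[OF ty_App.prems] ty_App.IH(2)[OF ty_App.prems] hom[OF ty_App.prems(1)]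
        itm_arr[OF ty_App.hyps(1)] itm_arr[OF ty_App.hyps(2)] L.typing_wf_ty[OF ty_App.hyps(1)]
      by simp
  next
    case (ty_Pr \<Gamma> M A N B)
    show ?case
      using ty_Pr.IH(1)[OF ty_Pr.prems] ty_Pr.IH(2)[OF ty_Pr.prems] hom[OF ty_Pr.prems(1)]
        itm_arr[OF ty_Pr.hyps(1)] itm_arr[OF ty_Pr.hyps(2)]
      by simp
  next
    case (ty_Pi1 \<Gamma> M A B)
    show ?case
      using ty_Pi1.IH[OF ty_Pi1.prems] hom[OF ty_Pi1.prems(1)] itm_arr[OF ty_Pi1.hyps]
        L.typing_wf_ty[OF ty_Pi1.hyps] by simp
  next
    case (ty_Pi2 \<Gamma> M A B)
    show ?case
      using ty_Pi2.IH[OF ty_Pi2.prems] hom[OF ty_Pi2.prems(1)] itm_arr[OF ty_Pi2.hyps]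
        L.typing_wf_ty[OF ty_Pi2.hyps] by simp
  next
    case (ty_Ret \<Gamma> M A X)
    show ?case
      using ty_Ret.IH[OF ty_Ret.prems] hom[OF ty_Ret.prems(1)] itm_arr[OF ty_Ret.hyps]
        L.typing_wf_ty[OF ty_Ret.hyps] by simp
  next
    case (ty_Iota \<Gamma> M A)
    show ?case
      using ty_Iota.IH[OF ty_Iota.prems] hom[OF ty_Iota.prems(1)] itm_arr[OF ty_Iota.hyps]
        L.typing_wf_ty[OF ty_Iota.hyps] by simp
  next
    case (ty_Do \<Gamma> M X A N B)
    have w: "wf_ctx L (A # \<Gamma>)" by (rule typing_wf_ctx[OF ty_Do.hyps(2)])
    note r = realizes_up[OF ty_Do.prems(1) w shift[OF ty_Do.prems(2,1)]]
    note h = hom[OF ty_Do.prems(1)]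
    show ?case using ty_Do.IH(2)[OF r Q(1)[OF ty_Do.prems(2)]] ty_Do.IH(1)[OF ty_Do.prems] w h
        itm_arr[OF ty_Do.hyps(1)] itm_arr[OF ty_Do.hyps(2)] L.typing_wf_ty[OF ty_Do.hyps(2)]
      by (simp add: M.bind_comp)
  next
    case (ty_conv \<Gamma> M A B) show ?case by (rule ty_conv.IH[OF ty_conv.prems])
  }
qed

lemma itm_rename:
  assumes "typing L \<Gamma> M A" "realizes h \<Delta> (\<lambda>i. Var (r i)) \<Gamma>"
  shows "itm C (rename r M) \<Delta> = itm C M \<Gamma> \<cdot> h"
  unfolding rename_eq_subst
proof (rule itm_subst_step[OF assms, of "\<lambda>\<sigma>. \<exists>r. \<sigma> = (\<lambda>i. Var (r i))"])
  show "\<exists>r. up_sub \<sigma> = (\<lambda>i. Var (r i))" if "\<exists>r. \<sigma> = (\<lambda>i. Var (r i))" for \<sigma> :: "nat \<Rightarrow> ('o, 'm) tm"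
    using that up_sub_ren by blast
  show "\<exists>r'. (\<lambda>i. Var (r i)) = (\<lambda>i. Var (r' i))" by blast
qed auto

lemma realizes_shift:
  assumes "wf_ctx L (B # \<Gamma>)"
  shows "realizes (Fst C (ictx C \<Gamma>) (ity C B)) (B # \<Gamma>) (\<lambda>i. Var (Suc i)) \<Gamma>"
  using assms ty_Var[OF assms] by (fastforce simp: realizes_def in_hom)

lemma itm_shift:
  assumes "typing L \<Gamma> M A" "wf_ty L B"
  shows "itm C (shift M) (B # \<Gamma>) = itm C M \<Gamma> \<cdot> Fst C (ictx C \<Gamma>) (ity C B)"
  by (rule itm_rename[OF assms(1) realizes_shift]) (use assms typing_wf_ctx in auto)

lemma itm_subst:
  assumes "typing L \<Gamma> M A" "realizes h \<Delta> \<sigma> \<Gamma>"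
  shows "itm C (subst \<sigma> M) \<Delta> = itm C M \<Gamma> \<cdot> h"
proof (rule itm_subst_step[OF assms, of "\<lambda>_. True"])
  fix \<Delta> \<sigma> \<Gamma> h i A assume "realizes h \<Delta> \<sigma> \<Gamma>" "i < length \<Gamma>" "wf_ty L A"
  then show "itm C (shift (\<sigma> i)) (A # \<Delta>) = itm C (\<sigma> i) \<Delta> \<cdot> Fst C (ictx C \<Delta>) (ity C A)"
    unfolding realizes_def by (blast intro: itm_shift)
qed simp_all

text \<open>The morphism is the tuple of the interpreted components. The substitution rule gives
  only the terms, so a morphism has to be built for it.\<close>

lemma realizes_exists:
  assumes "wf_ctx L \<Delta>" "wf_ctx L \<Gamma>" "\<And>i. i < length \<Gamma> \<Longrightarrow> typing L \<Delta> (\<sigma> i) (\<Gamma> ! i)"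
  shows "\<exists>h. realizes h \<Delta> \<sigma> \<Gamma>"
  using assms(2,3)
proof (induction \<Gamma> arbitrary: \<sigma>)
  case Nil
  then show ?case using assms(1) by (auto simp: realizes_def in_hom intro!: exI[of _ "Bang C (ictx C \<Delta>)"])
next
  case (Cons A \<Gamma>)
  have "\<exists>h. realizes h \<Delta> (\<lambda>i. \<sigma> (Suc i)) \<Gamma>"
  proof (rule Cons.IH)
    show "typing L \<Delta> (\<sigma> (Suc i)) (\<Gamma> ! i)" if "i < length \<Gamma>" for i
      using Cons.prems(2)[of "Suc i"] that by simp
  qed (use Cons.prems in simp)
  then obtain h where h: "realizes h \<Delta> (\<lambda>i. \<sigma> (Suc i)) \<Gamma>" ..
  have s: "typing L \<Delta> (\<sigma> 0) A" using Cons.prems(2)[of 0] by simp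
  have "realizes (Tuple C h (itm C (\<sigma> 0) \<Delta>)) \<Delta> \<sigma> (A # \<Gamma>)"
    unfolding realizes_def
  proof (intro conjI allI impI)
    show "Tuple C h (itm C (\<sigma> 0) \<Delta>) \<in> hom C (ictx C \<Delta>) (ictx C (A # \<Gamma>))"
      using h itm_arr[OF s] by (simp add: realizes_def in_hom)
    fix i assume i: "i < length (A # \<Gamma>)"
    show "typing L \<Delta> (\<sigma> i) ((A # \<Gamma>) ! i)" using Cons.prems(2)[OF i] .
    show "itm C (\<sigma> i) \<Delta> = ivar C (A # \<Gamma>) i \<cdot> Tuple C h (itm C (\<sigma> 0) \<Delta>)"
      using i h itm_arr[OF s] Cons.prems(1) ivar_arr[of \<Gamma> "i - 1"] by (cases i) (auto simp: realizes_def in_hom)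
  qed (rule assms(1))
  then show ?case ..
qed

lemma itm_inst:
  assumes "typing L (A # \<Gamma>) M B" "typing L \<Gamma> N A"
  shows "itm C (inst N M) \<Gamma> = itm C M (A # \<Gamma>) \<cdot> Tuple C (Ident C (ictx C \<Gamma>)) (itm C N \<Gamma>)"
  unfolding inst_eq
proof (rule itm_subst[OF assms(1)])
  have w: "wf_ctx L (A # \<Gamma>)" by (rule typing_wf_ctx[OF assms(1)])
  show "realizes (Tuple C (Ident C (ictx C \<Gamma>)) (itm C N \<Gamma>)) \<Gamma> (inst_sub N) (A # \<Gamma>)"
    unfolding realizes_def
  proof (intro conjI allI impI)
    show "Tuple C (Ident C (ictx C \<Gamma>)) (itm C N \<Gamma>) \<in> hom C (ictx C \<Gamma>) (ictx C (A # \<Gamma>))"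
      using w itm_arr[OF assms(2)] by (simp add: in_hom)
    show "wf_ctx L \<Gamma>" using w by simp
    fix i assume i: "i < length (A # \<Gamma>)"
    show "typing L \<Gamma> (inst_sub N i) ((A # \<Gamma>) ! i)"
      using i assms w ty_Var[of L \<Gamma>] by (cases i) auto
    show "itm C (inst_sub N i) \<Gamma> = ivar C (A # \<Gamma>) i \<cdot> Tuple C (Ident C (ictx C \<Gamma>)) (itm C N \<Gamma>)"
      using i w itm_arr[OF assms(2)] ivar_arr[of \<Gamma> "i - 1"] by (cases i) auto
  qed
qed

lemma realizes_up_ren:
  assumes "realizes h \<Delta> (\<lambda>i. Var (r i)) \<Gamma>" "wf_ctx L (A # \<Gamma>)"
  shows "realizes (Tuple C (h \<cdot> Fst C (ictx C \<Delta>) (ity C A)) (Snd C (ictx C \<Delta>) (ity C A)))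
    (A # \<Delta>) (\<lambda>i. Var (up_ren r i)) (A # \<Gamma>)"
  unfolding up_sub_ren[symmetric]
  by (rule realizes_up[OF assms]) (use assms in \<open>auto simp: realizes_def intro!: itm_shift\<close>)

text \<open>The exchange of the two innermost variables, realized by the very tuple that occurs in
  \<open>bind_central\<close>.\<close>

lemma realizes_swap:
  assumes "wf_ctx L (B # A # \<Gamma>)"
  defines "PB \<equiv> Prod C (ictx C \<Gamma>) (ity C B)"
  shows "realizes (Tuple C (Tuple C (Fst C (ictx C \<Gamma>) (ity C B) \<cdot> Fst C PB (ity C A)) (Snd C PB (ity C A)))
      (Snd C (ictx C \<Gamma>) (ity C B) \<cdot> Fst C PB (ity C A))) (A # B # \<Gamma>) (\<lambda>i. Var (swap_ren i)) (B # A # \<Gamma>)"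
  unfolding realizes_def
proof (intro conjI allI impI)
  have w: "wf_ty L A" "wf_ty L B" "wf_ctx L \<Gamma>" using assms by simp_all
  show "Tuple C (Tuple C (Fst C (ictx C \<Gamma>) (ity C B) \<cdot> Fst C PB (ity C A)) (Snd C PB (ity C A)))
      (Snd C (ictx C \<Gamma>) (ity C B) \<cdot> Fst C PB (ity C A)) \<in> hom C (ictx C (A # B # \<Gamma>)) (ictx C (B # A # \<Gamma>))"
    using w by (simp add: in_hom PB_def)
  show w': "wf_ctx L (A # B # \<Gamma>)" using w by simp
  fix i assume i: "i < length (B # A # \<Gamma>)"
  consider "i = 0" | "i = 1" | j where "i = Suc (Suc j)" by (cases i; cases "i - 1") auto
  note cases = this
  show "typing L (A # B # \<Gamma>) (Var (swap_ren i)) ((B # A # \<Gamma>) ! i)"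
    using ty_Var[OF w', of "swap_ren i"] i by (cases rule: cases) (auto simp: swap_ren_def)
  show "itm C (Var (swap_ren i)) (A # B # \<Gamma>) = ivar C (B # A # \<Gamma>) i \<cdot>
     Tuple C (Tuple C (Fst C (ictx C \<Gamma>) (ity C B) \<cdot> Fst C PB (ity C A)) (Snd C PB (ity C A)))
      (Snd C (ictx C \<Gamma>) (ity C B) \<cdot> Fst C PB (ity C A))"
    using w i ivar_arr[of \<Gamma> "i - 2"] by (cases rule: cases) (simp_all add: swap_ren_def PB_def)
qed

theorem soundness: "tm_eq L \<Gamma> M N A \<Longrightarrow> itm C M \<Gamma> = itm C N \<Gamma>"
proof (induction rule: tm_eq.induct)
  interpret L: theory_of L by (rule theory_L)
  {
    case eq_ax then show ?case by (simp add: int_lang_tm_axioms)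
  next
    case (eq_subst \<Gamma> M N A \<Delta> \<sigma> \<tau>)
    then have t: "typing L \<Gamma> M A" "typing L \<Gamma> N A" by (auto dest: L.tm_eq_typing)
    have \<sigma>: "typing L \<Delta> (\<sigma> i) (\<Gamma> ! i)" "typing L \<Delta> (\<tau> i) (\<Gamma> ! i)" "itm C (\<sigma> i) \<Delta> = itm C (\<tau> i) \<Delta>"
      if "i < length \<Gamma>" for i
      using that eq_subst by (auto dest: L.tm_eq_typing)
    obtain h where h: "realizes h \<Delta> \<sigma> \<Gamma>"
      using realizes_exists[OF eq_subst.hyps(2) typing_wf_ctx[OF t(1)] \<sigma>(1)] by blast
    \<comment> \<open>\<open>realizes\<close> depends on a substitution only through its typing and
      interpretations, so one \<open>h\<close> serves both.\<close>
    then have "realizes h \<Delta> \<tau> \<Gamma>" using \<sigma> by (simp add: realizes_def)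
    with h show ?case using itm_subst[OF t(1)] itm_subst[OF t(2)] eq_subst.IH by simp
  next
    case (eq_Lam A A' \<Gamma> M M' B)
    then have "ity C A = ity C A'" by (simp add: int_lang_ty_eq_iff)
    then show ?case using eq_Lam.IH itm_ctx_cong[of "A # \<Gamma>" "A' # \<Gamma>" M'] by (simp add: list_all2_same)
  next
    case (eq_Do A A' B B' \<Gamma> M M' X N N')
    then have "ity C A = ity C A'" "ity C B = ity C B'" by (simp_all add: int_lang_ty_eq_iff)
    then show ?case using eq_Do.IH itm_ctx_cong[of "A # \<Gamma>" "A' # \<Gamma>" N'] by (simp add: list_all2_same)
  next
    case (eq_One_eta \<Gamma> M)
    have "itm C M \<Gamma> \<in> hom C (ictx C \<Gamma>) (One C)" using itm_arr[OF eq_One_eta] by (simp add: in_hom)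
    from S.Bang_unique[OF this] show ?case by simp
  next
    case (eq_Pi1_beta \<Gamma> M A N B)
    then show ?case using itm_arr[OF eq_Pi1_beta(1)] itm_arr[OF eq_Pi1_beta(2)] by simp
  next
    case (eq_Pi2_beta \<Gamma> M A N B)
    then show ?case using itm_arr[OF eq_Pi2_beta(1)] itm_arr[OF eq_Pi2_beta(2)] by simp
  next
    case (eq_Prod_eta \<Gamma> M A B)
    then show ?case using itm_arr[OF eq_Prod_eta] L.typing_wf_ty[OF eq_Prod_eta] by simp
  next
    case (eq_Fun_beta A \<Gamma> M B N)
    have w: "wf_ctx L (A # \<Gamma>)" "wf_ty L B"
      using typing_wf_ctx[OF eq_Fun_beta(1)] L.typing_wf_ty[OF eq_Fun_beta(1)] by simp_all
    note m = itm_arr[OF eq_Fun_beta(1)] and n = itm_arr[OF eq_Fun_beta(2)]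
    have "Ev C (ity C A) (ity C B) \<cdot> Tuple C (Curry C (ictx C \<Gamma>) (ity C A) (itm C M (A # \<Gamma>))
        \<cdot> Ident C (ictx C \<Gamma>)) (itm C N \<Gamma>) =
       itm C M (A # \<Gamma>) \<cdot> Tuple C (Ident C (ictx C \<Gamma>)) (itm C N \<Gamma>)"
      by (rule S.ev_curry) (use w m n in simp_all)
    then show ?case using itm_inst[OF eq_Fun_beta] w m by simp
  next
    case (eq_Fun_eta \<Gamma> M A B)
    have w: "wf_ctx L \<Gamma>" "wf_ty L A" "wf_ty L B"
      using typing_wf_ctx[OF eq_Fun_eta] L.typing_wf_ty[OF eq_Fun_eta] by simp_all
    show ?case using itm_arr[OF eq_Fun_eta] itm_shift[OF eq_Fun_eta w(2)] w by (simp add: S.curry_ev)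
  next
    case (eq_Do_left_unit \<Gamma> M A N X B)
    have w: "wf_ctx L \<Gamma>" "wf_ty L A" "wf_ty L B"
      using typing_wf_ctx[OF eq_Do_left_unit(2)] L.typing_wf_ty[OF eq_Do_left_unit(2)] by simp_all
    show ?case using itm_arr[OF eq_Do_left_unit(1)] itm_arr[OF eq_Do_left_unit(2)] w
        itm_inst[OF eq_Do_left_unit(2,1)] by (simp add: M.bind_unit_left)
  next
    case (eq_Do_right_unit \<Gamma> M X A)
    have w: "wf_ctx L \<Gamma>" "wf_ty L A"
      using typing_wf_ctx[OF eq_Do_right_unit] L.typing_wf_ty[OF eq_Do_right_unit] by simp_all
    show ?case using itm_arr[OF eq_Do_right_unit] w by (simp add: M.bind_unit_right)
  next
    case (eq_Do_assoc \<Gamma> M X A N B P D)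
    have w: "wf_ctx L \<Gamma>" "wf_ty L A" "wf_ty L B" "wf_ty L D"
      using typing_wf_ctx[OF eq_Do_assoc(2)] typing_wf_ctx[OF eq_Do_assoc(3)]
        L.typing_wf_ty[OF eq_Do_assoc(3)] by simp_all
    then have "realizes (Tuple C (Fst C (ictx C \<Gamma>) (ity C A) \<cdot> Fst C (ictx C (A # \<Gamma>)) (ity C B))
        (Snd C (ictx C (A # \<Gamma>)) (ity C B))) (B # A # \<Gamma>) (\<lambda>i. Var (up_ren Suc i)) (B # \<Gamma>)"
      by (intro realizes_up_ren realizes_shift) simp_all
    from itm_rename[OF eq_Do_assoc(3) this]
    show ?case using itm_arr[OF eq_Do_assoc(1)] itm_arr[OF eq_Do_assoc(2)] itm_arr[OF eq_Do_assoc(3)] w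
      by (simp add: M.bind_assoc)
  next
    case (eq_centrality \<Gamma> M A N B P D)
    have w: "wf_ctx L \<Gamma>" "wf_ty L A" "wf_ty L B" "wf_ty L D"
      using typing_wf_ctx[OF eq_centrality(3)] L.typing_wf_ty[OF eq_centrality(3)] by simp_all
    note m = itm_arr[OF eq_centrality(1)] and n = itm_arr[OF eq_centrality(2)] and p = itm_arr[OF eq_centrality(3)]
    have "central_cone C (mon C TMon) (ity C A) (MObj (mon C SMon) (ity C A)) (iota C (ity C A))"
      using w by (simp add: iota_central)
    from M.bind_central[OF _ _ _ _ this, of "ictx C \<Gamma>" "ity C B" "ity C D" "itm C M \<Gamma>" "itm C N \<Gamma>" "itm C P (B # A # \<Gamma>)"]
    show ?case using m n p w itm_shift[OF eq_centrality(1) w(3)] itm_shift[OF eq_centrality(2) w(2)]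
       itm_rename[OF eq_centrality(3) realizes_swap]
      by simp
  next
    case (eq_Iota_inj \<Gamma> A M N)
    have "wf_ty L A" using L.typing_wf_ty[OF eq_Iota_inj.hyps(2)] by simp
    with iota_monic[of "ity C A"] itm_arr[OF eq_Iota_inj.hyps(2)] itm_arr[OF eq_Iota_inj.hyps(3)] eq_Iota_inj.IH
    show ?case by (auto simp: monic_def in_hom)
  next
    case (eq_Iota_Do \<Gamma> M A N B)
    have w: "wf_ctx L \<Gamma>" "wf_ty L A" "wf_ty L B"
      using typing_wf_ctx[OF eq_Iota_Do(2)] L.typing_wf_ty[OF eq_Iota_Do(2)] by simp_all
    show ?case using itm_arr[OF eq_Iota_Do(1)] itm_arr[OF eq_Iota_Do(2)] w by (simp add: iota_bind)
  next
    case (eq_Iota_Ret \<Gamma> M A)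
    have w: "wf_ty L A" using L.typing_wf_ty[OF eq_Iota_Ret] by simp
    note m = itm_arr[OF eq_Iota_Ret]
    have "(iota C (ity C A) \<cdot> Unit (mon C SMon) (ity C A)) \<cdot> itm C M \<Gamma> = Unit (mon C TMon) (ity C A) \<cdot> itm C M \<Gamma>"
      using iota_Unit[of "ity C A"] w by simp
    then show ?case using m w by simp
  }
qed (simp_all add: int_lang_ty_eq_iff)

end


section \<open>The syntactic model of the internal language of a model\<close>

text \<open>The type representing the domain can be prescribed, so that composable or parallel
  arrows are given by judgements whose types match literally.\<close>

lemma (in theory_of) Arr_syn_Dom:
  assumes "f \<in> Arr (syn_model T)" "Dom (syn_model T) f = ty_class T A"
  obtains M B where "typing T [A] M B" "f = jdg_class T A M B"
proof -
  obtain A' M B where f: "typing T [A'] M B" "f = jdg_class T A' M B" using assms(1) Arr_syn by blast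
  have w: "wf_ty T A'" "wf_ty T B" using typing_wf_ctx[OF f(1)] typing_wf_ty[OF f(1)] by simp_all
  have e: "ty_eq T A' A" using assms(2) f w by (simp add: syn_Dom ty_class_eq_iff)
  have "jdg_class T A' M B = jdg_class T A M B"
    by (rule jdg_class_eqI[OF e teq_refl[OF w(2)] eq_refl[OF f(1)]])
  with that[OF typing_head_conv[OF f(1) e]] f(2) show ?thesis by simp
qed

context model
begin

section \<open>Interpretation of classes and naming, mutually inverse\<close>

interpretation L: theory_of L by (rule theory_L)

text \<open>The context \<open>[A]\<close> denotes \<open>1 x A\<close>; the tuple is the canonical
  isomorphism that removes the factor \<open>1\<close>.\<close>

definition sem :: "'o ty \<Rightarrow> ('o, 'm) tm \<Rightarrow> 'm" where
  "sem A M = itm C M [A] \<cdot> Tuple C (Bang C (ity C A)) (Ident C (ity C A))"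

definition sem_obj :: "'o ty set \<Rightarrow> 'o" where
  "sem_obj a = ity C (SOME A. wf_ty L A \<and> a = ty_class L A)"

definition sem_arr :: "('o ty \<times> ('o, 'm) tm \<times> 'o ty) set \<Rightarrow> 'm" where
  "sem_arr f = (case SOME (A, M, B). typing L [A] M B \<and> f = jdg_class L A M B of (A, M, B) \<Rightarrow> sem A M)"

definition name_obj :: "'o \<Rightarrow> 'o ty set" where
  "name_obj A = ty_class L (Ground A)"

text \<open>The constant of \<open>f\<close> is a closed function; applied to the variable it
  becomes a judgement, hence an arrow.\<close>

definition name_arr :: "'m \<Rightarrow> ('o ty \<times> ('o, 'm) tm \<times> 'o ty) set" where
  "name_arr f = jdg_class L (Ground (Dom C f))
     (App (Ground (Dom C f)) (Ground (Cod C f)) (Const f) (Var 0)) (Ground (Cod C f))"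

lemma wf_single: "typing L [A] M B \<Longrightarrow> wf_ty L A \<and> wf_ty L B"
  using typing_wf_ctx[of L "[A]" M B] L.typing_wf_ty[of "[A]" M B] by simp

lemma sem_in_hom [simp]:
  assumes "typing L [A] M B"
  shows "sem A M \<in> Arr C" "Dom C (sem A M) = ity C A" "Cod C (sem A M) = ity C B"
  using itm_arr[OF assms] wf_single[OF assms] by (simp_all add: sem_def)

text \<open>For a one-variable \<open>\<Gamma>\<close> this makes \<open>sem\<close> preserve
  composition; for longer contexts it lets an interpretation be expressed through
  \<open>sem\<close>.\<close>

lemma itm_inst1:
  assumes N: "typing L [B] N D" and M: "typing L \<Gamma> M B"
  shows "itm C (inst M N) \<Gamma> = sem B N \<cdot> itm C M \<Gamma>"
proof -
  have w: "wf_ctx L \<Gamma>" "wf_ty L B" using typing_wf_ctx[OF M] wf_single[OF N] by simp_all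
  have "realizes (Tuple C (Bang C (ictx C \<Gamma>)) (itm C M \<Gamma>)) \<Gamma> (\<lambda>_. M) [B]"
    using itm_arr[OF M] w M by (simp add: realizes_def in_hom)
  then have "itm C (inst M N) \<Gamma> = itm C N [B] \<cdot> Tuple C (Bang C (ictx C \<Gamma>)) (itm C M \<Gamma>)"
    unfolding inst_single[OF N] by (rule itm_subst[OF N])
  then show ?thesis using itm_arr[OF M] itm_arr[OF N] w by (simp add: sem_def)
qed

lemma itm_extend:
  assumes "typing L [A] M B" "wf_ctx L \<Gamma>"
  shows "itm C M (A # \<Gamma>) = sem A M \<cdot> Snd C (ictx C \<Gamma>) (ity C A)"
  using itm_inst1[OF assms(1) ty_Var0[of L A \<Gamma>]] assms wf_single[OF assms(1)]
  by (simp add: inst_Var0_left[OF assms(1)])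

lemma itm_single:
  assumes "typing L [A] M B"
  shows "itm C M [A] = sem A M \<cdot> Snd C (One C) (ity C A)"
  using itm_extend[OF assms, of "[]"] by simp

lemma sem_obj [simp]: assumes "wf_ty L A" shows "sem_obj (ty_class L A) = ity C A"
proof -
  let ?P = "\<lambda>B. wf_ty L B \<and> ty_class L A = ty_class L B"
  have "?P (Eps ?P)" by (rule someI[of ?P A]) (simp add: assms)
  then have "ty_eq L A (Eps ?P)" using L.ty_class_eq_iff[OF assms] by blast
  then show ?thesis by (simp add: sem_obj_def int_lang_ty_eq_iff)
qed

text \<open>The chosen representative is provably equal to the given one, and soundness makes the
  value independent of the choice.\<close>

lemma sem_arr:
  assumes "typing L [A] M B" shows "sem_arr (jdg_class L A M B) = sem A M"
proof -
  let ?P = "\<lambda>p. case p of (A', M', B') \<Rightarrow> typing L [A'] M' B' \<and> jdg_class L A M B = jdg_class L A' M' B'"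
  have "?P (Eps ?P)" by (rule someI[of ?P "(A, M, B)"]) (simp add: assms)
  moreover obtain A' M' B' where p: "Eps ?P = (A', M', B')" by (rule prod_cases3)
  ultimately have *: "typing L [A'] M' B'" "jdg_class L A M B = jdg_class L A' M' B'" by simp_all
  note ** = L.jdg_class_eqD[OF *]
  have "ity C A = ity C A'" using **(1) by (simp add: int_lang_ty_eq_iff)
  then have "sem A M = sem A' M'"
    using soundness[OF **(3)] itm_ctx_cong[of "[A]" "[A']" M'] by (simp add: sem_def)
  then show ?thesis by (simp add: sem_arr_def p)
qed

lemma jdg_Arr:
  assumes "typing L [A] M B"
  shows "jdg_class L A M B \<in> Arr (syn_model L)" "sem_arr (jdg_class L A M B) = sem A M"
  using assms L.Arr_syn sem_arr by blast+

lemma typing_name: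
  assumes "f \<in> Arr C"
  shows "typing L [Ground (Dom C f)] (App (Ground (Dom C f)) (Ground (Cod C f)) (Const f) (Var 0)) (Ground (Cod C f))"
  using assms ty_Const[of L "[Ground (Dom C f)]" f] by (auto intro!: ty_App ty_Var0)

lemma sem_name:
  assumes "f \<in> Arr C"
  shows "sem (Ground (Dom C f)) (App (Ground (Dom C f)) (Ground (Cod C f)) (Const f) (Var 0)) = f"
proof -
  let ?D = "Dom C f" and ?g = "f \<cdot> Snd C (One C) (Dom C f)"
  have "Ev C ?D (Cod C f) \<cdot> Tuple C (Curry C (One C) ?D ?g \<cdot> Bang C ?D) (Ident C ?D) =
     ?g \<cdot> Tuple C (Bang C ?D) (Ident C ?D)"
    by (rule S.ev_curry) (use assms in simp_all)
  also have "\<dots> = f" using assms by simp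
  finally show ?thesis using assms by (simp add: sem_def)
qed

lemma structure_iso: "structure_iso C (syn_model L) sem_obj sem_arr name_obj name_arr"
proof -
  let ?D = "syn_model L"
  have ty: "\<exists>A. wf_ty L A \<and> a = ty_class L A" if "a \<in> Obj ?D" for a using that L.Obj_syn by blast
  have arr: "\<exists>A M B. typing L [A] M B \<and> f = jdg_class L A M B" if "f \<in> Arr ?D" for f
    using that L.Arr_syn by blast
  have v0: "typing L (A # \<Gamma>) (Var 0) A" if "wf_ty L A" "wf_ctx L \<Gamma>" for A \<Gamma>
    using that by (simp add: ty_Var0)
  note obj = L.ty_class_in_Obj
  show ?thesis
  proof
    fix a assume "a \<in> Obj ?D"
    then obtain A where A: "wf_ty L A" "a = ty_class L A" using ty by blast
    show "sem_obj a \<in> Obj C" using A by simp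
    \<comment> \<open>The type axioms of \<open>L\<close> equate every type with the ground type of
      its object, so naming undoes the interpretation.\<close>
    have "ty_eq L (Ground (ity C A)) A" using A by (simp add: int_lang_ty_eq_iff)
    then show "name_obj (sem_obj a) = a" using A by (simp add: name_obj_def L.ty_class_eqI)
    have "typing L [A] (Var 0) A" using A v0 by simp
    then show "Ident ?D a \<in> Arr ?D" "sem_arr (Ident ?D a) = Ident C (sem_obj a)"
      using A by (simp_all add: L.syn_Ident jdg_Arr sem_def)
    have "typing L [A] Star TOne" using A by (simp add: ty_Star)
    then show "Bang ?D a \<in> Arr ?D" "sem_arr (Bang ?D a) = Bang C (sem_obj a)"
      using A by (simp_all add: L.syn_Bang jdg_Arr sem_def)
    show "MObj (mon ?D X) a \<in> Obj ?D" "sem_obj (MObj (mon ?D X) a) = MObj (mon C X) (sem_obj a)" for X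
      using A by (simp_all add: L.syn_MObj obj)
    have "typing L [A] (Ret X (Var 0)) (TM X A)" for X using A v0 by (simp add: ty_Ret)
    then show "Unit (mon ?D X) a \<in> Arr ?D" "sem_arr (Unit (mon ?D X) a) = Unit (mon C X) (sem_obj a)" for X
      using A by (simp_all add: L.syn_Unit jdg_Arr sem_def)
    have "typing L [TM SMon A] (Iota A (Var 0)) (TM TMon A)" using A v0 by (simp add: ty_Iota)
    then show "iota ?D a \<in> Arr ?D" "sem_arr (iota ?D a) = iota C (sem_obj a)"
      using A by (simp_all add: L.syn_iota jdg_Arr sem_def)
    fix X
    have t: "typing L [TM X (TM X A)] (Do X (TM X A) A (Var 0) (Var 0)) (TM X A)" using A v0 by (simp add: ty_Do)
    show "Mult (mon ?D X) a \<in> Arr ?D" using A t by (simp add: L.syn_Mult jdg_Arr)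
    \<comment> \<open>The bound term is the variable of the judgement and the body is the bound
      variable, so \<open>str_snd\<close> removes the strength and leaves the
      multiplication.\<close>
    let ?TTA = "MObj (mon C X) (MObj (mon C X) (ity C A))"
    let ?P = "Prod C (One C) ?TTA" and ?TA = "MObj (mon C X) (ity C A)"
    have "MArr (mon C X) (Snd C ?P ?TA) \<cdot> (Str (mon C X) ?P ?TA \<cdot>
       Tuple C (Tuple C (Bang C ?TTA) (Ident C ?TTA)) (Ident C ?TTA)) = Ident C ?TTA"
      by (rule M.str_snd) (use A in simp_all)
    then show "sem_arr (Mult (mon ?D X) a) = Mult (mon C X) (sem_obj a)"
      using A by (simp add: L.syn_Mult jdg_Arr[OF t] sem_def M.bind_def)
  next
    fix A assume "A \<in> Obj C"
    then show "name_obj A \<in> Obj ?D" "sem_obj (name_obj A) = A" by (simp_all add: name_obj_def obj)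
  next
    fix f assume "f \<in> Arr ?D"
    then obtain A M B where f: "typing L [A] M B" "f = jdg_class L A M B" using arr by blast
    have w: "wf_ty L A" "wf_ty L B" using wf_single[OF f(1)] by simp_all
    show "sem_arr f \<in> Arr C" using f by (simp add: jdg_Arr)
    show "Dom ?D f \<in> Obj ?D" "Dom C (sem_arr f) = sem_obj (Dom ?D f)"
      "Cod ?D f \<in> Obj ?D" "Cod C (sem_arr f) = sem_obj (Cod ?D f)"
      using f w by (simp_all add: L.syn_Dom L.syn_Cod obj jdg_Arr)
    have n: "typing L [Ground (ity C A)] (App (Ground (ity C A)) (Ground (ity C B)) (Const (sem A M)) (Var 0))
       (Ground (ity C B))" (is "typing L [?A] ?n ?B")
      using typing_name[of "sem A M"] f(1) by simp
    have e: "ty_eq L ?A A" "ty_eq L ?B B" using w by (simp_all add: int_lang_ty_eq_iff)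
    \<comment> \<open>Both terms have the same interpretation, so an axiom of \<open>L\<close>
      equates them; this makes the interpretation injective on arrows.\<close>
    have "tm_eq L [?A] ?n M ?B"
    proof (rule int_lang_tm_eqI[OF n])
      show "typing L [?A] M ?B" by (rule ty_conv[OF L.typing_head_conv[OF f(1) teq_sym[OF e(1)]] teq_sym[OF e(2)]])
      have "itm C ?n [?A] = sem A M \<cdot> Snd C (One C) (ity C A)"
        using itm_single[OF n] sem_name[of "sem A M"] f(1) by simp
      also have "\<dots> = itm C M [?A]"
        using itm_single[OF f(1)] itm_ctx_cong[of "[A]" "[?A]" M] by simp
      finally show "itm C ?n [?A] = itm C M [?A]" .
    qed
    then have "jdg_class L ?A ?n ?B = jdg_class L A M B" by (rule L.jdg_class_eqI[OF e])
    then show "name_arr (sem_arr f) = f" using f by (simp add: name_arr_def jdg_Arr)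
    fix X
    have t: "typing L [TM X A] (Do X A B (Var 0) (Ret X M)) (TM X B)"
      using L.typing_extend[OF f(1)] w v0 by (simp add: ty_Do ty_Ret)
    show "MArr (mon ?D X) f \<in> Arr ?D" using f t by (simp add: L.syn_MArr jdg_Arr)
    let ?P = "Prod C (One C) (MObj (mon C X) (ity C A))" and ?s = "sem A M"
    let ?m = "Snd C (One C) (MObj (mon C X) (ity C A))"
    \<comment> \<open>Read backwards, \<open>bind_marr\<close> moves \<open>?s\<close> from the body
      to the bound term; the right unit law then removes the remaining \<open>ret\<close>.\<close>
    have "M.bind X ?P (ity C A) (ity C B) (Unit (mon C X) (ity C B) \<cdot> (?s \<cdot> Snd C ?P (ity C A))) ?m =
        MArr (mon C X) ?s \<cdot> ?m"
      using M.bind_marr[of ?P "ity C B" "Unit (mon C X) (ity C B) \<cdot> Snd C ?P (ity C B)" "ity C B" X ?s "ity C A" ?m]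
        M.bind_unit_right[of ?P "ity C B" "MArr (mon C X) ?s \<cdot> ?m" X] f(1) w by simp
    then have "sem (TM X A) (Do X A B (Var 0) (Ret X M)) = MArr (mon C X) ?s"
      using f(1) w itm_extend[OF f(1), of "[TM X A]"] by (simp add: sem_def[of "TM X A"])
    then show "sem_arr (MArr (mon ?D X) f) = MArr (mon C X) (sem_arr f)"
      using f by (simp add: L.syn_MArr jdg_Arr[OF t] jdg_Arr)
  next
    fix f assume f: "f \<in> Arr C"
    show "name_arr f \<in> Arr ?D" "sem_arr (name_arr f) = f"
      using jdg_Arr[OF typing_name[OF f]] sem_name[OF f] by (simp_all add: name_arr_def)
  next
    fix f g assume "f \<in> Arr ?D" and g: "g \<in> Arr ?D" "Dom ?D g = Cod ?D f"
    then obtain A M B where f: "typing L [A] M B" "f = jdg_class L A M B" using arr by blast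
    then have "Dom ?D g = ty_class L B" using g by (simp add: L.syn_Cod)
    with g(1) obtain N E where g: "typing L [B] N E" "g = jdg_class L B N E" by (rule L.Arr_syn_Dom)
    have "sem A (inst M N) = sem B N \<cdot> sem A M"
      using itm_inst1[OF g(1) f(1)] itm_arr[OF f(1)] g(1) wf_single[OF f(1)] by (simp add: sem_def[of A])
    then show "Comp ?D g f \<in> Arr ?D" "sem_arr (Comp ?D g f) = sem_arr g \<cdot> sem_arr f"
      using jdg_Arr[OF typing_inst1[OF g(1) f(1)]] f g by (simp_all add: L.syn_Comp sem_arr)
  next
    show "One ?D \<in> Obj ?D" "sem_obj (One ?D) = One C" by (simp_all add: L.syn_One obj)
  next
    fix a b assume "a \<in> Obj ?D" "b \<in> Obj ?D"
    then obtain A B where A: "wf_ty L A" "a = ty_class L A" and B: "wf_ty L B" "b = ty_class L B"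
      using ty by blast
    show "Prod ?D a b \<in> Obj ?D" "sem_obj (Prod ?D a b) = Prod C (sem_obj a) (sem_obj b)"
      "Exp ?D a b \<in> Obj ?D" "sem_obj (Exp ?D a b) = Exp C (sem_obj a) (sem_obj b)"
      using A B by (simp_all add: L.syn_Prod L.syn_Exp obj)
    have "typing L [TProd A B] (Pi1 A B (Var 0)) A" using A B v0 by (simp add: ty_Pi1)
    then show "Fst ?D a b \<in> Arr ?D" "sem_arr (Fst ?D a b) = Fst C (sem_obj a) (sem_obj b)"
      using A B by (simp_all add: L.syn_Fst jdg_Arr sem_def)
    have "typing L [TProd A B] (Pi2 A B (Var 0)) B" using A B v0 by (simp add: ty_Pi2)
    then show "Snd ?D a b \<in> Arr ?D" "sem_arr (Snd ?D a b) = Snd C (sem_obj a) (sem_obj b)"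
      using A B by (simp_all add: L.syn_Snd jdg_Arr sem_def)
    have "typing L [TProd (TFun A B) A] (App A B (Pi1 (TFun A B) A (Var 0)) (Pi2 (TFun A B) A (Var 0))) B"
      using A B v0 by (simp add: ty_Pi1 ty_Pi2 ty_App)
    then show "Ev ?D a b \<in> Arr ?D" "sem_arr (Ev ?D a b) = Ev C (sem_obj a) (sem_obj b)"
      using A B by (simp_all add: L.syn_Ev jdg_Arr sem_def)
    fix X
    let ?M = "Do X B (TProd A B) (Pi2 A (TM X B) (Var 0)) (Ret X (Pr (Pi1 A (TM X B) (Var (Suc 0))) (Var 0)))"
    have t: "typing L [TProd A (TM X B)] ?M (TM X (TProd A B))"
      using A B v0 ty_Var1[of L B "TProd A (TM X B)" "[]"] by (simp add: ty_Do ty_Pi2 ty_Ret ty_Pr ty_Pi1)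
    show "Str (mon ?D X) a b \<in> Arr ?D" using A B by (simp add: L.syn_Str jdg_Arr[OF t])
    let ?TB = "MObj (mon C X) (ity C B)" and ?AB = "Prod C (ity C A) (ity C B)"
    let ?ATB = "Prod C (ity C A) ?TB"
    let ?P = "Prod C (One C) ?ATB"
    let ?a = "Fst C (ity C A) ?TB \<cdot> Snd C (One C) ?ATB" and ?m = "Snd C (ity C A) ?TB \<cdot> Snd C (One C) ?ATB"
    \<comment> \<open>The pairing in the body is, by \<open>bind_str\<close> read backwards, a
      strength in the bound term; the right unit law leaves just that strength.\<close>
    have "M.bind X ?P ?AB ?AB (Unit (mon C X) ?AB \<cdot> Snd C ?P ?AB) (Str (mon C X) (ity C A) (ity C B) \<cdot> Tuple C ?a ?m)
      = Str (mon C X) (ity C A) (ity C B) \<cdot> Tuple C ?a ?m"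
      by (rule M.bind_unit_right) (use A B in simp_all)
    moreover have "M.bind X ?P ?AB ?AB (Unit (mon C X) ?AB \<cdot> Snd C ?P ?AB) (Str (mon C X) (ity C A) (ity C B) \<cdot> Tuple C ?a ?m)
      = M.bind X ?P (ity C B) ?AB ((Unit (mon C X) ?AB \<cdot> Snd C ?P ?AB) \<cdot>
           Tuple C (Fst C ?P (ity C B)) (Tuple C (?a \<cdot> Fst C ?P (ity C B)) (Snd C ?P (ity C B)))) ?m"
      by (rule M.bind_str) (use A B in simp_all)
    ultimately have "itm C ?M [TProd A (TM X B)] = Str (mon C X) (ity C A) (ity C B) \<cdot> Tuple C ?a ?m"
      using A B by simp
    then have "sem (TProd A (TM X B)) ?M = Str (mon C X) (ity C A) (ity C B)"
      using A B by (simp add: sem_def del: itm.simps itm_Do)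
    then show "sem_arr (Str (mon ?D X) a b) = Str (mon C X) (sem_obj a) (sem_obj b)"
      using A B by (simp add: L.syn_Str jdg_Arr[OF t])
  next
    fix f g assume "f \<in> Arr ?D" and g: "g \<in> Arr ?D" "Dom ?D f = Dom ?D g"
    then obtain A M B where f: "typing L [A] M B" "f = jdg_class L A M B" using arr by blast
    then have "Dom ?D g = ty_class L A" using g by (simp add: L.syn_Dom)
    with g(1) obtain N E where g: "typing L [A] N E" "g = jdg_class L A N E" by (rule L.Arr_syn_Dom)
    have "sem A (Pr M N) = Tuple C (sem A M) (sem A N)"
      using itm_arr[OF f(1)] itm_arr[OF g(1)] wf_single[OF f(1)] by (simp add: sem_def)
    then show "Tuple ?D f g \<in> Arr ?D" "sem_arr (Tuple ?D f g) = Tuple C (sem_arr f) (sem_arr g)"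
      using jdg_Arr[OF ty_Pr[OF f(1) g(1)]] f g by (simp_all add: L.syn_Tuple sem_arr)
  next
    fix x a f assume "x \<in> Obj ?D" "a \<in> Obj ?D" and f: "f \<in> Arr ?D" "Dom ?D f = Prod ?D x a"
    then obtain X A where X: "wf_ty L X" "x = ty_class L X" and A: "wf_ty L A" "a = ty_class L A"
      using ty by blast
    then have "Dom ?D f = ty_class L (TProd X A)" using f by (simp add: L.syn_Prod)
    with f(1) obtain M B where f: "typing L [TProd X A] M B" "f = jdg_class L (TProd X A) M B"
      by (rule L.Arr_syn_Dom)
    have p: "typing L [A, X] (Pr (Var (Suc 0)) (Var 0)) (TProd X A)"
      using X A v0 ty_Var1[of L A X "[]"] by (simp add: ty_Pr)
    have t: "typing L [X] (Lam A (inst (Pr (Var (Suc 0)) (Var 0)) M)) (TFun A B)"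
      by (rule ty_Lam[OF typing_inst1[OF f(1) p]])
    \<comment> \<open>\<open>curry_comp\<close> moves the isomorphism of \<open>X\<close> with
      \<open>1 x X\<close> inside the transpose, where the pair of variables cancels it.\<close>
    have "sem X (Lam A (inst (Pr (Var (Suc 0)) (Var 0)) M)) = Curry C (ity C X) (ity C A) (sem (TProd X A) M)"
      using itm_inst1[OF f(1) p] X A f(1) by (simp add: sem_def[of X] S.curry_comp)
    then show "Curry ?D x a f \<in> Arr ?D"
      "sem_arr (Curry ?D x a f) = Curry C (sem_obj x) (sem_obj a) (sem_arr f)"
      using jdg_Arr[OF t] X A f by (simp_all add: L.syn_Curry sem_arr)
  qed
qed

theorem SL_equivalence:
  "\<exists>F G. csc_model_morphism C (syn_model L) F \<and> csc_model_morphism (syn_model L) C G \<and>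
     (\<exists>\<epsilon>. natural_isomorphism (syn_model L) (syn_model L) (funct_comp F G) funct_id \<epsilon>) \<and>
     (\<exists>\<eta>. natural_isomorphism C C funct_id (funct_comp G F) \<eta>)"
proof -
  interpret structure_iso C "syn_model L" sem_obj sem_arr name_obj name_arr by (rule structure_iso)
  show ?thesis
    using morphism_F morphism_G natural_isomorphism_F_G natural_isomorphism_G_F by blast
qed

end


theorem mainTheorem15:
  shows "(\<forall>C :: ('o, 'm) csc_structure. csc_model C \<longrightarrow>
            (\<exists>F G. csc_model_morphism C (syn_model (int_lang C)) F \<and>
                   csc_model_morphism (syn_model (int_lang C)) C G \<and>
                   (\<exists>\<epsilon>. natural_isomorphism (syn_model (int_lang C)) (syn_model (int_lang C))
                          (funct_comp F G) funct_id \<epsilon>) \<and>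
                   (\<exists>\<eta>. natural_isomorphism C C funct_id (funct_comp G F) \<eta>)))
       \<and> (\<forall>T :: ('g, 'c) csc_thy. csc_theory T \<longrightarrow>
            (\<exists>V W. csc_translation T (int_lang (syn_model T)) V \<and>
                   csc_translation (int_lang (syn_model T)) T W \<and>
                   (\<exists>\<epsilon>. invertible_transformation (int_lang (syn_model T)) (int_lang (syn_model T))
                          (tr_comp V W) tr_id \<epsilon>) \<and>
                   (\<exists>\<eta>. invertible_transformation T T tr_id (tr_comp W V) \<eta>)))"
proof (intro conjI allI impI)
  fix C :: "('o, 'm) csc_structure" assume "csc_model C"
  then interpret model C by unfold_locales
  show "\<exists>F G. csc_model_morphism C (syn_model (int_lang C)) F \<and>
          csc_model_morphism (syn_model (int_lang C)) C G \<and>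
          (\<exists>\<epsilon>. natural_isomorphism (syn_model (int_lang C)) (syn_model (int_lang C))
                 (funct_comp F G) funct_id \<epsilon>) \<and>
          (\<exists>\<eta>. natural_isomorphism C C funct_id (funct_comp G F) \<eta>)"
    by (rule SL_equivalence)
next
  fix T :: "('g, 'c) csc_thy" assume "csc_theory T"
  then interpret theory_of T by unfold_locales
  show "\<exists>V W. csc_translation T (int_lang (syn_model T)) V \<and>
          csc_translation (int_lang (syn_model T)) T W \<and>
          (\<exists>\<epsilon>. invertible_transformation (int_lang (syn_model T)) (int_lang (syn_model T))
                 (tr_comp V W) tr_id \<epsilon>) \<and>
          (\<exists>\<eta>. invertible_transformation T T tr_id (tr_comp W V) \<eta>)"
    by (rule LS_equivalence)
qed

end
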